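(* Let $(\mathfrak{A},\mathsf{L})$ be an $F$-quasi-Leibniz quantum compact metric space for some admissible function $F$. Let $G$ be a compact metrizable group endowed with a continuous length function $\ell$. Let $\alpha$ be a strongly continuous action of $G$ on $\mathfrak{A}$ by *-automorphisms such that $\mathsf{L}\circ\alpha^g\leq\mathsf{L}$ for all $g\in G$. For any closed subgroup $H$ of $G$, let $$\mathfrak{A}_H=\{a\in\mathfrak{A} : \forall g\in H\quad \alpha^g(a)=a\}$$ be the fixed point C*-subalgebra of $\mathfrak{A}$ for the restriction of $\alpha$ to $H$. If $(G_n)_{n\in\mathbb{N}}$ is a sequence of closed subgroups of $G$ converging to a closed subgroup $G_\infty$ of $G$ for the Hausdorff distance $\mathsf{Haus}_\ell$, then $$\lim_{n\to\infty}\mathsf{\Lambda}_F\left((\mathfrak{A}_{G_n},\mathsf{L}),(\mathfrak{A}_{G_\infty},\mathsf{L})\right)=0,$$ where $\mathsf{L}$ also denotes the restriction of $\mathsf{L}$ to $\mathrm{dom}(\mathsf{L})\cap\mathfrak{A}_{G_n}$, respectively $\mathrm{dom}(\mathsf{L})\cap\mathfrak{A}_{G_\infty}$.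
   Context: The conclusion implicitly includes that the pairs $(\mathfrak{A}_{G_n},\mathsf{L})$ and $(\mathfrak{A}_{G_\infty},\mathsf{L})$ are $F$-quasi-Leibniz quantum compact metric spaces, so that $\mathsf{\Lambda}_F$ applies. For a unital C*-algebra $\mathfrak{A}$: $1_{\mathfrak{A}}$ is the unit, $\|\cdot\|_{\mathfrak{A}}$ the norm, $\mathfrak{sa}(\mathfrak{A})$ the space of self-adjoint elements, $\mathscr{S}(\mathfrak{A})$ the state space. A length function on $G$ with identity $e$ is $\ell:G\to[0,\infty)$ with $\ell(g)=0\iff g=e$, $\ell(g^{-1})=\ell(g)$ and $\ell(gh)\leq\ell(g)+\ell(h)$. $\mathsf{Haus}_\ell$ is the Hausdorff distance on closed subsets of $G$ for the invariant metric $(g,h)\mapsto\ell(g^{-1}h)$. Strongly continuous means $g\mapsto\alpha^g(a)$ is norm continuous for every $a\in\mathfrak{A}$. A function $F:[0,\infty)^4\to[0,\infty)$ is admissible when it is weakly increasing for the product order and $F(x,y,l_x,l_y)\geq x l_y+y l_x$ for all $x,y,l_x,l_y\geq 0$. Quasi-Leibniz quantum compact metric spaces. Let $F:[0,\infty)^4\to[0,\infty)$ be weakly increasing for the product order. An $F$-quasi-Leibniz quantum compact metric space $(\mathfrak{A},\mathsf{L})$ is a unital C*-algebra $\mathfrak{A}$ with a seminorm $\mathsf{L}$ defined on a dense Jordan-Lie subalgebra $\mathrm{dom}(\mathsf{L})$ of $\mathfrak{sa}(\mathfrak{A})$ (convention: $\mathsf{L}=\infty$ on $\mathfrak{sa}(\mathfrak{A})\setminus\mathrm{dom}(\mathsf{L})$,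 so that $\mathsf{L}\circ\alpha^g\leq\mathsf{L}$ includes $\alpha^g(\mathrm{dom}(\mathsf{L}))\subseteq\mathrm{dom}(\mathsf{L})$) such that: (i) $\{a\in\mathrm{dom}(\mathsf{L}) : \mathsf{L}(a)=0\} = \mathbb{R}1_{\mathfrak{A}}$; (ii) $\mathsf{mk}_{\mathsf{L}}(\varphi,\psi) = \sup\{|\varphi(a)-\psi(a)| : a\in\mathrm{dom}(\mathsf{L}), \mathsf{L}(a)\leq 1\}$ defines a metric on $\mathscr{S}(\mathfrak{A})$ which metrizes the weak* topology; (iii) $\mathsf{L}$ is lower semicontinuous for $\|\cdot\|_{\mathfrak{A}}$; (iv) for all $a,b\in\mathrm{dom}(\mathsf{L})$, $\max\{\mathsf{L}(\frac{ab+ba}{2}),\mathsf{L}(\frac{ab-ba}{2i})\}\leq F(\|a\|_{\mathfrak{A}},\|b\|_{\mathfrak{A}},\mathsf{L}(a),\mathsf{L}(b))$. Bridges. A bridge $\gamma=(\mathfrak{D},\pi_{\mathfrak{A}},\pi_{\mathfrak{B}},x)$ from a unital C*-algebra $\mathfrak{A}$ to a unital C*-algebra $\mathfrak{B}$ consists of a unital C*-algebra $\mathfrak{D}$, unital *-monomorphisms $\pi_{\mathfrak{A}}:\mathfrak{A}\hookrightarrow\mathfrak{D}$, $\pi_{\mathfrak{B}}:\mathfrak{B}\hookrightarrow\mathfrak{D}$, and $x\in\mathfrak{D}$ such that $\mathscr{S}(\mathfrak{D}|x)=\{\varphi\in\mathscr{S}(\mathfrak{D}) : \forall d\in\mathfrak{D},\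 \varphi(xd)=\varphi(dx)=\varphi(d)\}\neq\emptyset$. Given quantum compact metric spaces $(\mathfrak{A},\mathsf{L}_{\mathfrak{A}})$, $(\mathfrak{B},\mathsf{L}_{\mathfrak{B}})$, the length $\lambda(\gamma|\mathsf{L}_{\mathfrak{A}},\mathsf{L}_{\mathfrak{B}})$ is the maximum of the height, i.e. the maximum over $\mathfrak{C}\in\{\mathfrak{A},\mathfrak{B}\}$ of the Hausdorff distance, for $\mathsf{mk}_{\mathsf{L}_{\mathfrak{C}}}$, between $\mathscr{S}(\mathfrak{C})$ and $\{\varphi\circ\pi_{\mathfrak{C}} : \varphi\in\mathscr{S}(\mathfrak{D}|x)\}$, and the reach, i.e. the maximum of $\sup_{a}\inf_{b}\|\pi_{\mathfrak{A}}(a)x-x\pi_{\mathfrak{B}}(b)\|_{\mathfrak{D}}$ and $\sup_b\inf_a\|\pi_{\mathfrak{A}}(a)x-x\pi_{\mathfrak{B}}(b)\|_{\mathfrak{D}}$, where $a$ ranges over $\{a\in\mathfrak{sa}(\mathfrak{A}):\mathsf{L}_{\mathfrak{A}}(a)\leq 1\}$ and $b$ over $\{b\in\mathfrak{sa}(\mathfrak{B}):\mathsf{L}_{\mathfrak{B}}(b)\leq 1\}$. Quantum propinquity. $\mathsf{\Lambda}_F$ is the largest class function on pairs of $F$-quasi-Leibniz quantum compact metric spaces which: (1) is nonnegative, symmetric, and bounded above by the maximum of the diameters of the two state spaces for their metrics $\mathsf{mk}$; (2) satisfies the triangle inequality; (3) satisfies $\mathsf{\Lambda}_F((\mathfrak{A},\mathsf{L}_{\mathfrak{A}}),(\mathfrak{B},\mathsf{L}_{\mathfrak{B}}))\leq\lambda(\gamma|\mathsf{L}_{\mathfrak{A}},\mathsf{L}_{\mathfrak{B}})$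 for every bridge $\gamma$ from $\mathfrak{A}$ to $\mathfrak{B}$; (4) vanishes if and only if there is a *-isomorphism $\theta:\mathfrak{A}\to\mathfrak{B}$ with $\mathsf{L}_{\mathfrak{B}}\circ\theta=\mathsf{L}_{\mathfrak{A}}$. (Equivalently, it is the infimum, over finite chains of $F$-quasi-Leibniz quantum compact metric spaces joining the two spaces with a bridge between consecutive ones, of the sum of the lengths of the bridges.) *)

theory Defs
  imports
    "HOL-Analysis.Analysis"
    "HOL-Algebra.Module"
begin

section \<open>Unital C*-algebras\<close>

definition complex_field :: "complex ring" where
  "complex_field = \<lparr>carrier = UNIV, monoid.mult = (*), one = 1, ring.zero = 0, add = (+)\<rparr>"

record 'a cstar_algebra = "(complex, 'a) module" +
  star :: "'a \<Rightarrow> 'a"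
  cnorm :: "'a \<Rightarrow> real"

text \<open>The value off the carrier is a dummy: \<^locale>\<open>Metric_space\<close> requires nonnegativity and
  symmetry of the distance on the whole type.\<close>

definition cdist :: "'a cstar_algebra \<Rightarrow> 'a \<Rightarrow> 'a \<Rightarrow> real" where
  "cdist A a b = (if a \<in> carrier A \<and> b \<in> carrier A then cnorm A (a \<ominus>\<^bsub>A\<^esub> b) else 0)"

definition norm_topology :: "'a cstar_algebra \<Rightarrow> 'a topology" where
  "norm_topology A = Metric_space.mtopology (carrier A) (cdist A)"

text \<open>The zero algebra is excluded, so that every C*-algebra has states.\<close>

definition unital_cstar_algebra :: "'a cstar_algebra \<Rightarrow> bool" where
  "unital_cstar_algebra A \<longleftrightarrow>
     Ring.ring A \<and> Module.module complex_field A \<and>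
     \<one>\<^bsub>A\<^esub> \<noteq> \<zero>\<^bsub>A\<^esub> \<and>
     (\<forall>c. \<forall>a\<in>carrier A. \<forall>b\<in>carrier A.
        (c \<odot>\<^bsub>A\<^esub> a) \<otimes>\<^bsub>A\<^esub> b = c \<odot>\<^bsub>A\<^esub> (a \<otimes>\<^bsub>A\<^esub> b) \<and>
        a \<otimes>\<^bsub>A\<^esub> (c \<odot>\<^bsub>A\<^esub> b) = c \<odot>\<^bsub>A\<^esub> (a \<otimes>\<^bsub>A\<^esub> b)) \<and>
     (\<forall>a\<in>carrier A. star A a \<in> carrier A \<and> star A (star A a) = a) \<and>
     (\<forall>a\<in>carrier A. \<forall>b\<in>carrier A. star A (a \<oplus>\<^bsub>A\<^esub> b) = star A a \<oplus>\<^bsub>A\<^esub> star A b) \<and>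
     (\<forall>a\<in>carrier A. \<forall>b\<in>carrier A. star A (a \<otimes>\<^bsub>A\<^esub> b) = star A b \<otimes>\<^bsub>A\<^esub> star A a) \<and>
     (\<forall>c. \<forall>a\<in>carrier A. star A (c \<odot>\<^bsub>A\<^esub> a) = cnj c \<odot>\<^bsub>A\<^esub> star A a) \<and>
     (\<forall>a\<in>carrier A. 0 \<le> cnorm A a \<and> (cnorm A a = 0 \<longleftrightarrow> a = \<zero>\<^bsub>A\<^esub>)) \<and>
     (\<forall>a\<in>carrier A. \<forall>b\<in>carrier A. cnorm A (a \<oplus>\<^bsub>A\<^esub> b) \<le> cnorm A a + cnorm A b) \<and>
     (\<forall>c. \<forall>a\<in>carrier A. cnorm A (c \<odot>\<^bsub>A\<^esub> a) = cmod c * cnorm A a) \<and>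
     (\<forall>a\<in>carrier A. \<forall>b\<in>carrier A. cnorm A (a \<otimes>\<^bsub>A\<^esub> b) \<le> cnorm A a * cnorm A b) \<and>
     (\<forall>a\<in>carrier A. cnorm A (star A a \<otimes>\<^bsub>A\<^esub> a) = (cnorm A a)\<^sup>2) \<and>
     Metric_space.mcomplete (carrier A) (cdist A)"

definition sa :: "'a cstar_algebra \<Rightarrow> 'a set" where
  "sa A = {a \<in> carrier A. star A a = a}"

text \<open>\<^const>\<open>ring_hom\<close> already contains preservation of the unit.\<close>

definition star_hom :: "'a cstar_algebra \<Rightarrow> 'b cstar_algebra \<Rightarrow> ('a \<Rightarrow> 'b) set" where
  "star_hom A B = {h \<in> ring_hom A B.
     (\<forall>c. \<forall>a\<in>carrier A. h (c \<odot>\<^bsub>A\<^esub> a) = c \<odot>\<^bsub>B\<^esub> h a) \<and>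
     (\<forall>a\<in>carrier A. h (star A a) = star B (h a))}"

text \<open>States are made extensional on the carrier, so that equality of functions is equality of
  states, and the topology of pointwise convergence on the carrier is a
  subspace of a \<^const>\<open>product_topology\<close>.\<close>

definition states :: "'a cstar_algebra \<Rightarrow> ('a \<Rightarrow> complex) set" where
  "states A = {\<phi> \<in> extensional (carrier A).
     (\<forall>a\<in>carrier A. \<forall>b\<in>carrier A. \<phi> (a \<oplus>\<^bsub>A\<^esub> b) = \<phi> a + \<phi> b) \<and>
     (\<forall>c. \<forall>a\<in>carrier A. \<phi> (c \<odot>\<^bsub>A\<^esub> a) = c * \<phi> a) \<and>
     (\<forall>a\<in>carrier A. \<phi> (star A a \<otimes>\<^bsub>A\<^esub> a) \<in> \<real>\<^sub>\<ge>\<^sub>0) \<and>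
     \<phi> \<one>\<^bsub>A\<^esub> = 1}"

definition weak_star_topology :: "'a cstar_algebra \<Rightarrow> ('a \<Rightarrow> complex) topology" where
  "weak_star_topology A =
     subtopology (product_topology (\<lambda>_. euclidean) (carrier A)) (states A)"


section \<open>Quasi-Leibniz quantum compact metric spaces\<close>

definition admissible :: "(real \<Rightarrow> real \<Rightarrow> real \<Rightarrow> real \<Rightarrow> real) \<Rightarrow> bool" where
  "admissible F \<longleftrightarrow>
     (\<forall>x y l m x' y' l' m'. 0 \<le> x \<and> x \<le> x' \<and> 0 \<le> y \<and> y \<le> y' \<and> 0 \<le> l \<and> l \<le> l' \<and> 0 \<le> m \<and> m \<le> m'
        \<longrightarrow> F x y l m \<le> F x' y' l' m') \<and>
     (\<forall>x y l m. 0 \<le> x \<and> 0 \<le> y \<and> 0 \<le> l \<and> 0 \<le> m \<longrightarrow> x * m + y * l \<le> F x y l m)"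

text \<open>A seminorm defined on a subspace of \<^term>\<open>sa A\<close> is a function with values in \<open>[0, \<infinity>]\<close> that is
  finite exactly on that subspace. Its values off \<^term>\<open>sa A\<close> are never used, so the restriction of
  \<open>L\<close> to a C*-subalgebra is the same function \<open>L\<close>.\<close>

type_synonym 'a cstar_pair = "'a cstar_algebra \<times> ('a \<Rightarrow> ennreal)"

definition dom_lip :: "'a cstar_pair \<Rightarrow> 'a set" where
  "dom_lip = (\<lambda>(A, L). {a \<in> sa A. L a < \<infinity>})"

definition jordan_prod :: "'a cstar_algebra \<Rightarrow> 'a \<Rightarrow> 'a \<Rightarrow> 'a" where
  "jordan_prod A a b = (1 / 2) \<odot>\<^bsub>A\<^esub> (a \<otimes>\<^bsub>A\<^esub> b \<oplus>\<^bsub>A\<^esub> b \<otimes>\<^bsub>A\<^esub> a)"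

definition lie_prod :: "'a cstar_algebra \<Rightarrow> 'a \<Rightarrow> 'a \<Rightarrow> 'a" where
  "lie_prod A a b = (1 / (2 * \<i>)) \<odot>\<^bsub>A\<^esub> (a \<otimes>\<^bsub>A\<^esub> b \<ominus>\<^bsub>A\<^esub> b \<otimes>\<^bsub>A\<^esub> a)"

definition mk_dist :: "'a cstar_pair \<Rightarrow> ('a \<Rightarrow> complex) \<Rightarrow> ('a \<Rightarrow> complex) \<Rightarrow> ennreal" where
  "mk_dist = (\<lambda>(A, L) \<phi> \<psi>.
     SUP a \<in> {a \<in> dom_lip (A, L). L a \<le> 1}. ennreal (cmod (\<phi> a - \<psi> a)))"

definition quasi_leibniz_qcms ::
    "(real \<Rightarrow> real \<Rightarrow> real \<Rightarrow> real \<Rightarrow> real) \<Rightarrow> 'a cstar_pair \<Rightarrow> bool" where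
  "quasi_leibniz_qcms F = (\<lambda>(A, L).
     unital_cstar_algebra A \<and>
     (\<forall>a\<in>dom_lip (A, L). \<forall>b\<in>dom_lip (A, L). a \<oplus>\<^bsub>A\<^esub> b \<in> dom_lip (A, L) \<and> L (a \<oplus>\<^bsub>A\<^esub> b) \<le> L a + L b) \<and>
     (\<forall>r::real. \<forall>a\<in>dom_lip (A, L). complex_of_real r \<odot>\<^bsub>A\<^esub> a \<in> dom_lip (A, L) \<and>
        L (complex_of_real r \<odot>\<^bsub>A\<^esub> a) = ennreal \<bar>r\<bar> * L a) \<and>
     (\<forall>a\<in>dom_lip (A, L). \<forall>b\<in>dom_lip (A, L).
        jordan_prod A a b \<in> dom_lip (A, L) \<and> lie_prod A a b \<in> dom_lip (A, L)) \<and>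
     sa A \<subseteq> norm_topology A closure_of dom_lip (A, L) \<and>
     {a \<in> dom_lip (A, L). L a = 0} = range (\<lambda>r::real. complex_of_real r \<odot>\<^bsub>A\<^esub> \<one>\<^bsub>A\<^esub>) \<and>
     (\<forall>\<phi>\<in>states A. \<forall>\<psi>\<in>states A. mk_dist (A, L) \<phi> \<psi> < \<infinity>) \<and>
     Metric_space (states A) (\<lambda>\<phi> \<psi>. enn2real (mk_dist (A, L) \<phi> \<psi>)) \<and>
     Metric_space.mtopology (states A) (\<lambda>\<phi> \<psi>. enn2real (mk_dist (A, L) \<phi> \<psi>)) = weak_star_topology A \<and>
     (\<forall>r. closedin (subtopology (norm_topology A) (sa A)) {a \<in> sa A. L a \<le> r}) \<and>
     (\<forall>a\<in>dom_lip (A, L). \<forall>b\<in>dom_lip (A, L).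
        max (L (jordan_prod A a b)) (L (lie_prod A a b))
          \<le> ennreal (F (cnorm A a) (cnorm A b) (enn2real (L a)) (enn2real (L b)))))"


section \<open>Bridges and the quantum propinquity\<close>

definition hausdorff_distance :: "('a \<Rightarrow> 'a \<Rightarrow> ennreal) \<Rightarrow> 'a set \<Rightarrow> 'a set \<Rightarrow> ennreal" where
  "hausdorff_distance d X Y =
     max (SUP x\<in>X. INF y\<in>Y. d x y) (SUP y\<in>Y. INF x\<in>X. d x y)"

record ('a, 'b, 'd) bridge =
  bridge_algebra :: "'d cstar_algebra"
  bridge_left :: "'a \<Rightarrow> 'd"
  bridge_right :: "'b \<Rightarrow> 'd"
  pivot :: 'd

definition pivot_states :: "'d cstar_algebra \<Rightarrow> 'd \<Rightarrow> ('d \<Rightarrow> complex) set" where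
  "pivot_states D x = {\<phi> \<in> states D. \<forall>d\<in>carrier D. \<phi> (x \<otimes>\<^bsub>D\<^esub> d) = \<phi> d \<and> \<phi> (d \<otimes>\<^bsub>D\<^esub> x) = \<phi> d}"

definition is_bridge :: "('a, 'b, 'd) bridge \<Rightarrow> 'a cstar_algebra \<Rightarrow> 'b cstar_algebra \<Rightarrow> bool" where
  "is_bridge \<gamma> A B \<longleftrightarrow>
     unital_cstar_algebra (bridge_algebra \<gamma>) \<and>
     bridge_left \<gamma> \<in> star_hom A (bridge_algebra \<gamma>) \<and> inj_on (bridge_left \<gamma>) (carrier A) \<and>
     bridge_right \<gamma> \<in> star_hom B (bridge_algebra \<gamma>) \<and> inj_on (bridge_right \<gamma>) (carrier B) \<and>
     pivot \<gamma> \<in> carrier (bridge_algebra \<gamma>) \<and>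
     pivot_states (bridge_algebra \<gamma>) (pivot \<gamma>) \<noteq> {}"

definition bridge_height ::
    "('a, 'b, 'd) bridge \<Rightarrow> 'a cstar_pair \<Rightarrow> 'b cstar_pair \<Rightarrow> ennreal" where
  "bridge_height \<gamma> X Y =
     (let P = pivot_states (bridge_algebra \<gamma>) (pivot \<gamma>); A = fst X; B = fst Y in
      max (hausdorff_distance (mk_dist X) (states A)
             ((\<lambda>\<phi>. restrict (\<phi> \<circ> bridge_left \<gamma>) (carrier A)) ` P))
          (hausdorff_distance (mk_dist Y) (states B)
             ((\<lambda>\<phi>. restrict (\<phi> \<circ> bridge_right \<gamma>) (carrier B)) ` P)))"

definition bridge_reach ::
    "('a, 'b, 'd) bridge \<Rightarrow> 'a cstar_pair \<Rightarrow> 'b cstar_pair \<Rightarrow> ennreal" where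
  "bridge_reach \<gamma> = (\<lambda>(A, LA) (B, LB).
     (let D = bridge_algebra \<gamma>; x = pivot \<gamma>;
          SA = {a \<in> sa A. LA a \<le> 1}; SB = {b \<in> sa B. LB b \<le> 1};
          n = (\<lambda>a b. ennreal (cnorm D (bridge_left \<gamma> a \<otimes>\<^bsub>D\<^esub> x \<ominus>\<^bsub>D\<^esub> x \<otimes>\<^bsub>D\<^esub> bridge_right \<gamma> b)))
      in max (SUP a\<in>SA. INF b\<in>SB. n a b) (SUP b\<in>SB. INF a\<in>SA. n a b)))"

definition bridge_length ::
    "('a, 'b, 'd) bridge \<Rightarrow> 'a cstar_pair \<Rightarrow> 'b cstar_pair \<Rightarrow> ennreal" where
  "bridge_length \<gamma> X Y = max (bridge_height \<gamma> X Y) (bridge_reach \<gamma> X Y)"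

text \<open>\<open>bridge_chain F X Y r\<close>: there is a finite chain of \<open>F\<close>-quasi-Leibniz quantum compact metric
  spaces from \<open>X\<close> to \<open>Y\<close>, with a bridge between consecutive ones, whose lengths add up to \<open>r\<close>.

  The intermediate spaces and the algebras of the bridges live on the type \<open>'a\<close> that carries
  \<open>X\<close> and \<open>Y\<close>. Up to isomorphism this is no restriction. First, \<open>'a\<close> has at least the
  cardinality of the continuum, because \<open>c \<mapsto> c \<odot> 1\<close> is injective on the complex numbers.
  Second, a quantum compact metric space is separable, because its self-adjoint part embeds
  isometrically into the continuous functions on its compact metrizable state space.
  Third, the algebra \<open>D\<close> of a bridge may be replaced, without changing the length, by the separable
  C*-subalgebra generated by the two images and the pivot \<open>x\<close>: a state \<open>\<phi>\<close> belongs to the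
  states determined by \<open>x\<close> if and only if \<open>\<phi>\<close> vanishes at \<open>(1-x)*(1-x)\<close> and \<open>(1-x)(1-x)*\<close>,
  and states extend from C*-subalgebras. Finally, a separable C*-algebra has at most
  the cardinality of the continuum, hence has an isomorphic copy with carrier in \<open>'a\<close>, and the length
  of a bridge is invariant under isomorphisms.\<close>

inductive bridge_chain ::
    "(real \<Rightarrow> real \<Rightarrow> real \<Rightarrow> real \<Rightarrow> real) \<Rightarrow> 'a cstar_pair \<Rightarrow> 'a cstar_pair \<Rightarrow> ennreal \<Rightarrow> bool"
  for F where
  single: "\<lbrakk>quasi_leibniz_qcms F X; quasi_leibniz_qcms F Y;
            is_bridge (\<gamma> :: ('a, 'a, 'a) bridge) (fst X) (fst Y)\<rbrakk>
           \<Longrightarrow> bridge_chain F X Y (bridge_length \<gamma> X Y)"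
| snoc: "\<lbrakk>bridge_chain F X Y r; quasi_leibniz_qcms F Z;
            is_bridge (\<gamma> :: ('a, 'a, 'a) bridge) (fst Y) (fst Z)\<rbrakk>
           \<Longrightarrow> bridge_chain F X Z (r + bridge_length \<gamma> Y Z)"

definition quantum_propinquity ::
    "(real \<Rightarrow> real \<Rightarrow> real \<Rightarrow> real \<Rightarrow> real) \<Rightarrow> 'a cstar_pair \<Rightarrow> 'a cstar_pair \<Rightarrow> ennreal" where
  "quantum_propinquity F X Y = Inf {r. bridge_chain F X Y r}"

text \<open>The next three lemmas show that the propinquity is the largest function on pairs of
  \<open>F\<close>-quasi-Leibniz quantum compact metric spaces which satisfies the triangle inequality and is
  bounded above by the length of every bridge.\<close>

lemma quantum_propinquity_le_bridge_length:
  fixes \<gamma> :: "('a, 'a, 'a) bridge"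
  assumes "quasi_leibniz_qcms F X" "quasi_leibniz_qcms F Y" "is_bridge \<gamma> (fst X) (fst Y)"
  shows "quantum_propinquity F X Y \<le> bridge_length \<gamma> X Y"
  unfolding quantum_propinquity_def
  by (intro Inf_lower CollectI bridge_chain.single assms)

lemma bridge_chain_append:
  assumes "bridge_chain F Y Z s" "bridge_chain F X Y r"
  shows "bridge_chain F X Z (r + s)"
  using assms
proof (induction rule: bridge_chain.induct)
  case (single Y Z \<gamma>)
  then show ?case by (blast intro: bridge_chain.snoc)
next
  case (snoc Y W s Z \<gamma>)
  then have "bridge_chain F X Z ((r + s) + bridge_length \<gamma> W Z)"
    by (blast intro: bridge_chain.snoc)
  then show ?case by (simp add: add.assoc)
qed

lemma quantum_propinquity_triangle:
  "quantum_propinquity F X Z \<le> quantum_propinquity F X Y + quantum_propinquity F Y Z"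
proof -
  have *: "quantum_propinquity F X Z \<le> r + s"
    if "bridge_chain F X Y r" "bridge_chain F Y Z s" for r s
    unfolding quantum_propinquity_def
    by (intro Inf_lower CollectI bridge_chain_append[OF that(2,1)])
  show ?thesis
  proof (rule ennreal_le_epsilon)
    fix e :: real
    assume fin: "quantum_propinquity F X Y + quantum_propinquity F Y Z < top_class.top" and "0 < e"
    have ex: "\<exists>r. bridge_chain F U V r \<and> r < quantum_propinquity F U V + ennreal (e / 2)"
      if "quantum_propinquity F U V < top_class.top" for U V
    proof -
      have "quantum_propinquity F U V < quantum_propinquity F U V + ennreal (e / 2)"
        using that \<open>0 < e\<close> by (simp add: ennreal_add_left_cancel_less[of _ 0, simplified])
      then show ?thesis
        by (subst (asm) (1) quantum_propinquity_def) (auto simp: Inf_less_iff)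
    qed
    from fin obtain r s where rs: "bridge_chain F X Y r" "bridge_chain F Y Z s"
      "r < quantum_propinquity F X Y + ennreal (e / 2)"
      "s < quantum_propinquity F Y Z + ennreal (e / 2)"
      using ex[of X Y] ex[of Y Z] by auto
    have "quantum_propinquity F X Z \<le> r + s" using * rs by blast
    also have "\<dots> \<le> (quantum_propinquity F X Y + ennreal (e / 2)) +
        (quantum_propinquity F Y Z + ennreal (e / 2))"
      using rs by (intro add_mono) auto
    also have "\<dots> = quantum_propinquity F X Y + quantum_propinquity F Y Z +
        (ennreal (e / 2) + ennreal (e / 2))"
      by (simp only: ac_simps)
    also have "\<dots> = quantum_propinquity F X Y + quantum_propinquity F Y Z + ennreal e"
      using \<open>0 < e\<close> by (simp flip: ennreal_plus)
    finally show "quantum_propinquity F X Z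
        \<le> quantum_propinquity F X Y + quantum_propinquity F Y Z + ennreal e" .
  qed
qed

lemma quantum_propinquity_greatest:
  fixes \<Delta> :: "'a cstar_pair \<Rightarrow> 'a cstar_pair \<Rightarrow> ennreal"
  assumes tri: "\<And>X Y Z. quasi_leibniz_qcms F X \<Longrightarrow> quasi_leibniz_qcms F Y \<Longrightarrow>
      quasi_leibniz_qcms F Z \<Longrightarrow> \<Delta> X Z \<le> \<Delta> X Y + \<Delta> Y Z"
    and le: "\<And>X Y (\<gamma> :: ('a, 'a, 'a) bridge). quasi_leibniz_qcms F X \<Longrightarrow> quasi_leibniz_qcms F Y \<Longrightarrow>
      is_bridge \<gamma> (fst X) (fst Y) \<Longrightarrow> \<Delta> X Y \<le> bridge_length \<gamma> X Y"
  shows "\<Delta> X Y \<le> quantum_propinquity F X Y"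
proof -
  have "quasi_leibniz_qcms F X \<and> quasi_leibniz_qcms F Y \<and> \<Delta> X Y \<le> r"
    if "bridge_chain F X Y r" for r
    using that
  proof (induction rule: bridge_chain.induct)
    case (single X Y \<gamma>)
    then show ?case by (simp add: le)
  next
    case (snoc X Y r Z \<gamma>)
    then have "\<Delta> X Z \<le> \<Delta> X Y + \<Delta> Y Z" "\<Delta> Y Z \<le> bridge_length \<gamma> Y Z"
      by (simp_all add: tri le)
    with snoc show ?case by (meson add_mono order_trans)
  qed
  then show ?thesis unfolding quantum_propinquity_def by (auto intro: Inf_greatest)
qed


section \<open>Compact groups, length functions and actions\<close>

definition compact_metrizable_group :: "('g, 'm) monoid_scheme \<Rightarrow> 'g topology \<Rightarrow> bool" where
  "compact_metrizable_group G T \<longleftrightarrow>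
     group G \<and> topspace T = carrier G \<and> compact_space T \<and> metrizable_space T \<and>
     continuous_map (prod_topology T T) T (\<lambda>(g, h). g \<otimes>\<^bsub>G\<^esub> h) \<and>
     continuous_map T T (\<lambda>g. inv\<^bsub>G\<^esub> g)"

definition length_function :: "('g, 'm) monoid_scheme \<Rightarrow> ('g \<Rightarrow> real) \<Rightarrow> bool" where
  "length_function G len \<longleftrightarrow>
     (\<forall>g\<in>carrier G. 0 \<le> len g \<and> (len g = 0 \<longleftrightarrow> g = \<one>\<^bsub>G\<^esub>) \<and> len (inv\<^bsub>G\<^esub> g) = len g) \<and>
     (\<forall>g\<in>carrier G. \<forall>h\<in>carrier G. len (g \<otimes>\<^bsub>G\<^esub> h) \<le> len g + len h)"

definition haus_length :: "('g, 'm) monoid_scheme \<Rightarrow> ('g \<Rightarrow> real) \<Rightarrow> 'g set \<Rightarrow> 'g set \<Rightarrow> ennreal" where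
  "haus_length G len = hausdorff_distance (\<lambda>g h. ennreal (len (inv\<^bsub>G\<^esub> g \<otimes>\<^bsub>G\<^esub> h)))"

definition closed_subgroup :: "('g, 'm) monoid_scheme \<Rightarrow> 'g topology \<Rightarrow> 'g set \<Rightarrow> bool" where
  "closed_subgroup G T H \<longleftrightarrow> subgroup H G \<and> closedin T H"

definition strongly_continuous_action ::
    "('g, 'm) monoid_scheme \<Rightarrow> 'g topology \<Rightarrow> 'a cstar_algebra \<Rightarrow> ('g \<Rightarrow> 'a \<Rightarrow> 'a) \<Rightarrow> bool" where
  "strongly_continuous_action G T A \<alpha> \<longleftrightarrow>
     (\<forall>g\<in>carrier G. \<alpha> g \<in> star_hom A A \<and> bij_betw (\<alpha> g) (carrier A) (carrier A)) \<and>
     (\<forall>a\<in>carrier A. \<alpha> \<one>\<^bsub>G\<^esub> a = a) \<and>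
     (\<forall>g\<in>carrier G. \<forall>h\<in>carrier G. \<forall>a\<in>carrier A. \<alpha> (g \<otimes>\<^bsub>G\<^esub> h) a = \<alpha> g (\<alpha> h a)) \<and>
     (\<forall>a\<in>carrier A. continuous_map T (norm_topology A) (\<lambda>g. \<alpha> g a))"

definition fixed_point_algebra ::
    "'a cstar_algebra \<Rightarrow> ('g \<Rightarrow> 'a \<Rightarrow> 'a) \<Rightarrow> 'g set \<Rightarrow> 'a cstar_algebra" where
  "fixed_point_algebra A \<alpha> H = A\<lparr>carrier := {a \<in> carrier A. \<forall>g\<in>H. \<alpha> g a = a}\<rparr>"

end

theory Submission
  imports Defs "HOL-Algebra.Subrings"
begin

text \<open>
  Averaging over a closed subgroup \<open>H\<close>, that is, integrating \<open>h \<mapsto> \<alpha> h a\<close> against the Haar measure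
  of \<open>H\<close>, is a conditional expectation \<open>E\<close> of the algebra onto the fixed points of \<open>H\<close>. Since
  \<open>E a\<close> is a limit of convex combinations of the points \<open>\<alpha> h a\<close>, it inherits every closed convex
  property that these points share. In particular \<open>L (E a) \<le> L a\<close>, and \<open>E a\<close> is as close to \<open>a\<close> as
  the orbit of \<open>a\<close> is.

  The fixed point algebra is a quasi-Leibniz quantum compact metric space because \<open>\<phi> \<mapsto> \<phi> \<circ> E\<close>
  embeds its state space into the state space of the whole algebra, with restriction of states as
  a left inverse. By \<open>L (E a) \<le> L a\<close> this embedding is isometric for the Monge-Kantorovich
  metrics, and both maps are weak* continuous; so the metric of the fixed point algebra is finite
  and induces the weak* topology because the metric of the whole algebra does (\<open>mk_extend\<close>,
  \<open>mk_fixed_topology\<close>).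

  For two closed subgroups \<open>H\<close> and \<open>K\<close>, the whole algebra with pivot \<open>1\<close> and the two inclusions
  is a bridge. Every state of a fixed point algebra is the restriction of a state, so the height
  is \<open>0\<close>. For the reach, an element \<open>a\<close> fixed by \<open>H\<close> is matched with its average \<open>b\<close> over \<open>K\<close>. If
  each \<open>h \<in> K\<close> is within \<open>\<delta>\<close> of some \<open>g \<in> H\<close>, then \<open>\<alpha> h a = \<alpha> g (\<alpha> k a)\<close> for some \<open>k\<close> of length at
  most \<open>\<delta>\<close>, while \<open>\<alpha> g a = a\<close>; hence the distance from \<open>a\<close> to \<open>b\<close> is at most the supremum of the
  norms of \<open>\<alpha> k a - a\<close> over such \<open>k\<close>. This tends to \<open>0\<close> with \<open>\<delta>\<close>, uniformly in \<open>L a \<le> 1\<close>: the norm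
  of \<open>\<alpha> k a - a\<close> is attained at a state \<open>\<phi>\<close>, where its value is at most the Monge-Kantorovich
  distance of \<open>\<phi> \<circ> \<alpha> k\<close> and \<open>\<phi>\<close>, and these distances tend to \<open>0\<close> uniformly in \<open>\<phi>\<close> because the
  state space is weak* compact (\<open>uniform_modulus\<close>, \<open>propinquity_fixed_le\<close>).

  The averages are built by hand as limits of iterated means over finite nets of \<open>H\<close>
  (\<open>net_mean_oscillation\<close>, \<open>conditional_expectation_exists\<close>). From the theory of C*-algebras the
  argument takes four facts, derived below from a square root constructed by iteration and from a
  Hahn-Banach argument: \<open>adj a \<otimes> a\<close> is positive (\<open>adj_mult_pos\<close>), so that \<open>E\<close> maps squares to
  squares of the fixed point algebra and \<open>\<phi> \<circ> E\<close> is a state; states attain the norm of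
  self-adjoint elements (\<open>norming_state\<close>); the state space is weak* compact (\<open>compact_weak_star\<close>);
  and *-homomorphisms are contractive (\<open>star_hom_contractive\<close>), so that the group acts by
  isometries.
\<close>

section \<open>Arithmetic and norm of a unital C*-algebra\<close>

lemma complex_field_cring: "cring complex_field"
  unfolding complex_field_def
  by (rule cringI, rule abelian_groupI)
     (auto simp: algebra_simps comm_monoid_def monoid_def comm_monoid_axioms_def intro: exI[of _ "- x" for x])

locale cstar =
  fixes A :: "'a cstar_algebra" (structure)
  assumes cstar: "unital_cstar_algebra A"
begin

abbreviation adj :: "'a \<Rightarrow> 'a" where "adj \<equiv> star A"
abbreviation nrm :: "'a \<Rightarrow> real" where "nrm \<equiv> cnorm A"

sublocale ring A
  using cstar by (simp add: unital_cstar_algebra_def)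

sublocale M: Module.module complex_field A
  using cstar by (simp add: unital_cstar_algebra_def)

lemma one_not_zero: "\<one> \<noteq> \<zero>"
  and smult_mult_l: "a \<in> carrier A \<Longrightarrow> b \<in> carrier A \<Longrightarrow> (c \<odot> a) \<otimes> b = c \<odot> (a \<otimes> b)"
  and smult_mult_r: "a \<in> carrier A \<Longrightarrow> b \<in> carrier A \<Longrightarrow> a \<otimes> (c \<odot> b) = c \<odot> (a \<otimes> b)"
  and adj_closed [simp, intro]: "a \<in> carrier A \<Longrightarrow> adj a \<in> carrier A"
  and adj_adj [simp]: "a \<in> carrier A \<Longrightarrow> adj (adj a) = a"
  and adj_add: "a \<in> carrier A \<Longrightarrow> b \<in> carrier A \<Longrightarrow> adj (a \<oplus> b) = adj a \<oplus> adj b"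
  and adj_mult: "a \<in> carrier A \<Longrightarrow> b \<in> carrier A \<Longrightarrow> adj (a \<otimes> b) = adj b \<otimes> adj a"
  and adj_smult: "a \<in> carrier A \<Longrightarrow> adj (c \<odot> a) = cnj c \<odot> adj a"
  and nrm_ge0 [simp]: "a \<in> carrier A \<Longrightarrow> 0 \<le> nrm a"
  and nrm_eq0: "a \<in> carrier A \<Longrightarrow> nrm a = 0 \<longleftrightarrow> a = \<zero>"
  and nrm_add: "a \<in> carrier A \<Longrightarrow> b \<in> carrier A \<Longrightarrow> nrm (a \<oplus> b) \<le> nrm a + nrm b"
  and nrm_smult [simp]: "a \<in> carrier A \<Longrightarrow> nrm (c \<odot> a) = cmod c * nrm a"
  and nrm_mult: "a \<in> carrier A \<Longrightarrow> b \<in> carrier A \<Longrightarrow> nrm (a \<otimes> b) \<le> nrm a * nrm b"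
  and nrm_adj_mult: "a \<in> carrier A \<Longrightarrow> nrm (adj a \<otimes> a) = (nrm a)\<^sup>2"
  and mcomplete: "Metric_space.mcomplete (carrier A) (cdist A)"
  using cstar by (simp_all add: unital_cstar_algebra_def)

lemma smult_closed [simp, intro]: "a \<in> carrier A \<Longrightarrow> c \<odot> a \<in> carrier A"
  and smult_add_l: "a \<in> carrier A \<Longrightarrow> (c + d) \<odot> a = c \<odot> a \<oplus> d \<odot> a"
  and smult_add_r: "a \<in> carrier A \<Longrightarrow> b \<in> carrier A \<Longrightarrow> c \<odot> (a \<oplus> b) = c \<odot> a \<oplus> c \<odot> b"
  and smult_smult: "a \<in> carrier A \<Longrightarrow> c \<odot> (d \<odot> a) = (c * d) \<odot> a"
  and smult_1 [simp]: "a \<in> carrier A \<Longrightarrow> 1 \<odot> a = a"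
  and smult_0 [simp]: "a \<in> carrier A \<Longrightarrow> 0 \<odot> a = \<zero>"
  and smult_zero [simp]: "c \<odot> \<zero> = \<zero>"
  using M.smult_closed[of c a] M.smult_l_distr[of c d a] M.smult_r_distr[of c a b]
    M.smult_assoc1[of c d a] M.smult_one[of a] M.smult_l_null[of a] M.smult_r_null[of c]
  by (simp_all add: complex_field_def)

lemma smult_uminus: "a \<in> carrier A \<Longrightarrow> (- c) \<odot> a = \<ominus> (c \<odot> a)"
  and smult_neg: "a \<in> carrier A \<Longrightarrow> c \<odot> (\<ominus> a) = \<ominus> (c \<odot> a)"
proof -
  show "(- c) \<odot> a = \<ominus> (c \<odot> a)" if "a \<in> carrier A"
    using that smult_add_l[of a "-c" c] by (simp add: minus_equality)
  show "c \<odot> (\<ominus> a) = \<ominus> (c \<odot> a)" if "a \<in> carrier A"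
    using that M.smult_r_minus[of c a] by (simp add: complex_field_def)
qed

lemma neg_smult: "a \<in> carrier A \<Longrightarrow> \<ominus> a = (- 1) \<odot> a"
  by (simp add: smult_uminus)

lemma smult_diff_r: "a \<in> carrier A \<Longrightarrow> b \<in> carrier A \<Longrightarrow> c \<odot> (a \<ominus> b) = c \<odot> a \<ominus> c \<odot> b"
  by (simp add: minus_eq smult_add_r smult_neg)

lemma nrm_neg [simp]: "a \<in> carrier A \<Longrightarrow> nrm (\<ominus> a) = nrm a"
  by (simp add: neg_smult)

lemma nrm_zero [simp]: "nrm \<zero> = 0"
  by (simp add: nrm_eq0)

lemma nrm_diff_commute: "a \<in> carrier A \<Longrightarrow> b \<in> carrier A \<Longrightarrow> nrm (a \<ominus> b) = nrm (b \<ominus> a)"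
  using nrm_neg[of "a \<ominus> b"] by (simp add: minus_eq minus_add a_comm)

lemma nrm_diff_triangle:
  assumes "a \<in> carrier A" "b \<in> carrier A" "c \<in> carrier A"
  shows "nrm (a \<ominus> c) \<le> nrm (a \<ominus> b) + nrm (b \<ominus> c)"
proof -
  have "a \<ominus> c = (a \<ominus> b) \<oplus> (b \<ominus> c)" using assms by algebra
  then show ?thesis using assms nrm_add[of "a \<ominus> b" "b \<ominus> c"] by simp
qed

lemma nrm_diff_le: "a \<in> carrier A \<Longrightarrow> b \<in> carrier A \<Longrightarrow> nrm (a \<ominus> b) \<le> nrm a + nrm b"
  using nrm_add[of a "\<ominus> b"] by (simp add: minus_eq)

lemma nrm_le_diff: "a \<in> carrier A \<Longrightarrow> b \<in> carrier A \<Longrightarrow> nrm a \<le> nrm (a \<ominus> b) + nrm b"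
  using nrm_diff_triangle[of a b \<zero>] by (simp add: minus_eq)

lemma diff_eq_zero_iff: "a \<in> carrier A \<Longrightarrow> b \<in> carrier A \<Longrightarrow> a \<ominus> b = \<zero> \<longleftrightarrow> a = b"
  by (metis add.inv_closed add.inv_comm minus_eq minus_equality minus_minus r_neg)

lemma nrm_diff_eq0: "a \<in> carrier A \<Longrightarrow> b \<in> carrier A \<Longrightarrow> nrm (a \<ominus> b) = 0 \<longleftrightarrow> a = b"
  by (simp add: nrm_eq0 diff_eq_zero_iff)

lemma adj_one [simp]: "adj \<one> = \<one>"
proof -
  have "adj (\<one> \<otimes> adj \<one>) = \<one> \<otimes> adj \<one>"
    by (subst adj_mult) simp_all
  then show ?thesis by simp
qed

lemma adj_neg: "a \<in> carrier A \<Longrightarrow> adj (\<ominus> a) = \<ominus> adj a"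
  by (simp add: neg_smult adj_smult)

lemma adj_diff: "a \<in> carrier A \<Longrightarrow> b \<in> carrier A \<Longrightarrow> adj (a \<ominus> b) = adj a \<ominus> adj b"
  by (simp add: minus_eq adj_add adj_neg)

lemma adj_zero [simp]: "adj \<zero> = \<zero>"
  using adj_smult[of \<one> 0] by simp

lemma nrm_adj [simp]:
  assumes "a \<in> carrier A" shows "nrm (adj a) = nrm a"
proof -
  have le: "nrm x \<le> nrm (adj x)" if "x \<in> carrier A" for x
  proof (cases "nrm x = 0")
    case False
    have "nrm x * nrm x \<le> nrm (adj x) * nrm x"
      using nrm_adj_mult[OF that] nrm_mult[of "adj x" x] that by (simp add: power2_eq_square)
    with False that show ?thesis by (simp add: order_less_le)
  qed (use that in simp)
  show ?thesis using le[of a] le[of "adj a"] assms by simp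
qed

lemma nrm_one [simp]: "nrm \<one> = 1"
proof -
  have "nrm \<one> = (nrm \<one>)\<^sup>2" using nrm_adj_mult[of \<one>] by simp
  moreover have "nrm \<one> \<noteq> 0" using nrm_eq0[of \<one>] one_not_zero by simp
  ultimately show ?thesis by (simp add: power2_eq_square)
qed

section \<open>Norm limits\<close>

definition norm_lim :: "(nat \<Rightarrow> 'a) \<Rightarrow> 'a \<Rightarrow> bool" where
  "norm_lim x l \<longleftrightarrow> (\<forall>n. x n \<in> carrier A) \<and> l \<in> carrier A \<and> (\<lambda>n. nrm (x n \<ominus> l)) \<longlonglongrightarrow> 0"

lemma norm_limD: "norm_lim x l \<Longrightarrow> x n \<in> carrier A" "norm_lim x l \<Longrightarrow> l \<in> carrier A"
  "norm_lim x l \<Longrightarrow> (\<lambda>n. nrm (x n \<ominus> l)) \<longlonglongrightarrow> 0"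
  by (simp_all add: norm_lim_def)

lemma norm_limI:
  assumes "\<And>n. x n \<in> carrier A" "l \<in> carrier A" "\<And>n. nrm (x n \<ominus> l) \<le> r n" "r \<longlonglongrightarrow> 0"
  shows "norm_lim x l"
proof -
  have "(\<lambda>n. nrm (x n \<ominus> l)) \<longlonglongrightarrow> 0"
    by (rule tendsto_sandwich[OF _ _ tendsto_const assms(4)]) (use assms(1-3) in auto)
  then show ?thesis using assms by (simp add: norm_lim_def)
qed

lemma norm_lim_const: "a \<in> carrier A \<Longrightarrow> norm_lim (\<lambda>_. a) a"
  by (rule norm_limI[where r="\<lambda>_. 0"]) (simp_all add: minus_eq r_neg)

lemma norm_lim_nrm:
  assumes "norm_lim x l" shows "(\<lambda>n. nrm (x n)) \<longlonglongrightarrow> nrm l"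
proof -
  note c [simp] = norm_limD(1,2)[OF assms]
  have "\<bar>nrm (x n) - nrm l\<bar> \<le> nrm (x n \<ominus> l)" for n
    using nrm_le_diff[of "x n" l] nrm_le_diff[of l "x n"] nrm_diff_commute[of "x n" l] by simp
  then have "(\<lambda>n. nrm (x n) - nrm l) \<longlonglongrightarrow> 0"
    by (intro Lim_null_comparison[OF _ norm_limD(3)[OF assms]] always_eventually) simp
  then show ?thesis by (simp add: LIM_zero_iff)
qed

lemma norm_lim_add:
  assumes "norm_lim x l" "norm_lim y m"
  shows "norm_lim (\<lambda>n. x n \<oplus> y n) (l \<oplus> m)"
proof (rule norm_limI)
  note [simp] = norm_limD(1,2)[OF assms(1)] norm_limD(1,2)[OF assms(2)]
  show "nrm (x n \<oplus> y n \<ominus> (l \<oplus> m)) \<le> nrm (x n \<ominus> l) + nrm (y n \<ominus> m)" for n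
  proof -
    have "x n \<in> carrier A" "y n \<in> carrier A" "l \<in> carrier A" "m \<in> carrier A" by simp_all
    then have "x n \<oplus> y n \<ominus> (l \<oplus> m) = (x n \<ominus> l) \<oplus> (y n \<ominus> m)" by algebra
    then show ?thesis using nrm_add[of "x n \<ominus> l" "y n \<ominus> m"] by simp
  qed
  show "(\<lambda>n. nrm (x n \<ominus> l) + nrm (y n \<ominus> m)) \<longlonglongrightarrow> 0"
    using tendsto_add[OF norm_limD(3)[OF assms(1)] norm_limD(3)[OF assms(2)]] by simp
qed (use norm_limD[OF assms(1)] norm_limD[OF assms(2)] in simp_all)

lemma norm_lim_smult:
  assumes "norm_lim x l" shows "norm_lim (\<lambda>n. c \<odot> x n) (c \<odot> l)"
proof (rule norm_limI)
  note [simp] = norm_limD(1,2)[OF assms(1)]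
  show "nrm (c \<odot> x n \<ominus> c \<odot> l) \<le> cmod c * nrm (x n \<ominus> l)" for n
    by (simp flip: smult_diff_r)
  show "(\<lambda>n. cmod c * nrm (x n \<ominus> l)) \<longlonglongrightarrow> 0"
    using tendsto_mult_left[OF norm_limD(3)[OF assms(1)], of "cmod c"] by simp
qed (use norm_limD[OF assms] in simp_all)

lemma norm_lim_adj:
  assumes "norm_lim x l" shows "norm_lim (\<lambda>n. adj (x n)) (adj l)"
  by (rule norm_limI[OF _ _ _ norm_limD(3)[OF assms]])
     (use norm_limD[OF assms] in \<open>simp_all flip: adj_diff\<close>)

lemma norm_lim_neg: "norm_lim x l \<Longrightarrow> norm_lim (\<lambda>n. \<ominus> x n) (\<ominus> l)"
  using norm_lim_smult[of x l "-1"] norm_limD(1,2)[of x l] by (simp add: neg_smult)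

lemma norm_lim_diff: "norm_lim x l \<Longrightarrow> norm_lim y m \<Longrightarrow> norm_lim (\<lambda>n. x n \<ominus> y n) (l \<ominus> m)"
  unfolding minus_eq by (intro norm_lim_add norm_lim_neg)

lemma norm_lim_mult:
  assumes "norm_lim x l" "norm_lim y m"
  shows "norm_lim (\<lambda>n. x n \<otimes> y n) (l \<otimes> m)"
proof (rule norm_limI)
  note [simp] = norm_limD(1,2)[OF assms(1)] norm_limD(1,2)[OF assms(2)]
  show "nrm (x n \<otimes> y n \<ominus> l \<otimes> m) \<le> nrm (x n) * nrm (y n \<ominus> m) + nrm (x n \<ominus> l) * nrm m" for n
  proof -
    have "x n \<in> carrier A" "y n \<in> carrier A" "l \<in> carrier A" "m \<in> carrier A" by simp_all
    then have "x n \<otimes> y n \<ominus> l \<otimes> m = x n \<otimes> (y n \<ominus> m) \<oplus> (x n \<ominus> l) \<otimes> m" by algebra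
    then show ?thesis
      using nrm_add[of "x n \<otimes> (y n \<ominus> m)" "(x n \<ominus> l) \<otimes> m"] nrm_mult[of "x n" "y n \<ominus> m"]
        nrm_mult[of "x n \<ominus> l" m] by simp
  qed
  show "(\<lambda>n. nrm (x n) * nrm (y n \<ominus> m) + nrm (x n \<ominus> l) * nrm m) \<longlonglongrightarrow> 0"
    using tendsto_add[OF tendsto_mult[OF norm_lim_nrm[OF assms(1)] norm_limD(3)[OF assms(2)]]
        tendsto_mult_right[OF norm_limD(3)[OF assms(1)], of "nrm m"]] by simp
qed (use norm_limD[OF assms(1)] norm_limD[OF assms(2)] in simp_all)

lemma norm_lim_unique:
  assumes "norm_lim x l" "norm_lim x m" shows "l = m"
proof -
  note [simp] = norm_limD(1,2)[OF assms(1)] norm_limD(1,2)[OF assms(2)]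
  have "norm_lim (\<lambda>n. x n \<ominus> x n) (l \<ominus> m)" by (rule norm_lim_diff[OF assms])
  then have "(\<lambda>n. 0) \<longlonglongrightarrow> nrm (l \<ominus> m)" using norm_lim_nrm by (force simp: minus_eq r_neg)
  then have "nrm (l \<ominus> m) = 0" by (simp add: LIMSEQ_const_iff)
  then show ?thesis by (simp add: nrm_diff_eq0)
qed

lemma norm_lim_nrm_le:
  assumes "norm_lim x l" "\<And>n. nrm (x n) \<le> r" shows "nrm l \<le> r"
  using LIMSEQ_le_const2[OF norm_lim_nrm[OF assms(1)]] assms(2) by blast

lemma norm_lim_subseq: "norm_lim x l \<Longrightarrow> strict_mono f \<Longrightarrow> norm_lim (x \<circ> f) l"
  using LIMSEQ_subseq_LIMSEQ[of "\<lambda>n. nrm (x n \<ominus> l)" 0 f] by (auto simp: norm_lim_def o_def)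

lemma norm_lim_Suc: "norm_lim x l \<Longrightarrow> norm_lim (\<lambda>n. x (Suc n)) l"
  using norm_lim_subseq[of x l Suc] by (simp add: strict_mono_Suc_iff o_def)

lemma metric: "Metric_space (carrier A) (cdist A)"
  by unfold_locales
     (auto simp: cdist_def nrm_diff_commute nrm_diff_eq0 nrm_diff_triangle)

sublocale metric: Metric_space "carrier A" "cdist A"
  by (rule metric)

lemma cdist_eq: "a \<in> carrier A \<Longrightarrow> b \<in> carrier A \<Longrightarrow> cdist A a b = nrm (a \<ominus> b)"
  by (simp add: cdist_def)

lemma limitin_norm_iff:
  assumes "\<And>n. x n \<in> carrier A"
  shows "limitin metric.mtopology x l sequentially \<longleftrightarrow> norm_lim x l"
  using assms
  by (auto simp: metric.limitin_metric_dist_null norm_lim_def cdist_def)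

lemma norm_Cauchy_lim:
  assumes x: "\<And>n. x n \<in> carrier A"
    and C: "\<And>e. 0 < e \<Longrightarrow> \<exists>N. \<forall>m\<ge>N. \<forall>n\<ge>N. nrm (x n \<ominus> x m) < e"
  obtains l where "norm_lim x l"
proof -
  have "metric.MCauchy x"
    unfolding metric.MCauchy_def using x C by (auto simp: cdist_def) blast
  then obtain l where "limitin metric.mtopology x l sequentially"
    using mcomplete by (auto simp: metric.mcomplete_def)
  then show thesis using that limitin_norm_iff[of x l] x by simp
qed

section \<open>Self-adjoint elements\<close>

lemma saD: "x \<in> sa A \<Longrightarrow> x \<in> carrier A" "x \<in> sa A \<Longrightarrow> adj x = x"
  by (auto simp: sa_def)

lemma saI: "x \<in> carrier A \<Longrightarrow> adj x = x \<Longrightarrow> x \<in> sa A"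
  by (simp add: sa_def)

lemma sa_carrier [simp]: "x \<in> sa A \<Longrightarrow> x \<in> carrier A"
  by (rule saD(1))

lemma sa_one [simp]: "\<one> \<in> sa A" and sa_zero [simp]: "\<zero> \<in> sa A"
  by (auto intro!: saI)

lemma sa_add [simp]: "x \<in> sa A \<Longrightarrow> y \<in> sa A \<Longrightarrow> x \<oplus> y \<in> sa A"
  by (rule saI) (simp_all add: adj_add saD(2))

lemma sa_diff [simp]: "x \<in> sa A \<Longrightarrow> y \<in> sa A \<Longrightarrow> x \<ominus> y \<in> sa A"
  by (rule saI) (simp_all add: adj_diff saD(2))

lemma sa_neg [simp]: "x \<in> sa A \<Longrightarrow> \<ominus> x \<in> sa A"
  by (rule saI) (simp_all add: adj_neg saD(2))

lemma sa_smult [simp]: "x \<in> sa A \<Longrightarrow> complex_of_real r \<odot> x \<in> sa A"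
  by (rule saI) (simp_all add: adj_smult saD(2))

lemma sa_mult: "x \<in> sa A \<Longrightarrow> y \<in> sa A \<Longrightarrow> x \<otimes> y = y \<otimes> x \<Longrightarrow> x \<otimes> y \<in> sa A"
  by (rule saI) (simp_all add: adj_mult saD(2))

lemma sa_square [simp]: "x \<in> sa A \<Longrightarrow> x \<otimes> x \<in> sa A"
  by (simp add: sa_mult)

lemma sa_adj_mult: "x \<in> carrier A \<Longrightarrow> adj x \<otimes> x \<in> sa A"
  by (rule saI) (simp_all add: adj_mult)

lemma nrm_square: "x \<in> sa A \<Longrightarrow> nrm (x \<otimes> x) = (nrm x)\<^sup>2"
  using nrm_adj_mult[of x] by (simp add: saD(2))

lemma square_eq_zero: "x \<in> sa A \<Longrightarrow> x \<otimes> x = \<zero> \<Longrightarrow> x = \<zero>"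
  using nrm_square[of x] nrm_eq0[of x] by simp

lemma sa_norm_lim:
  assumes "norm_lim x l" "\<And>n. x n \<in> sa A" shows "l \<in> sa A"
proof (rule saI)
  have "norm_lim x (adj l)" using norm_lim_adj[OF assms(1)] assms(2) by (simp add: saD(2))
  then show "adj l = l" using norm_lim_unique[OF _ assms(1)] by blast
qed (rule norm_limD(2)[OF assms(1)])

lemma half_add_half: "a \<in> carrier A \<Longrightarrow> (1/2) \<odot> a \<oplus> (1/2) \<odot> a = a"
  by (simp flip: smult_add_l)

section \<open>Square roots\<close>

text \<open>With \<open>z = 1 - x\<close> one looks for \<open>v = 1 - s\<close>, and \<open>s\<^sup>2 = x\<close> means \<open>v = (z + v\<^sup>2) / 2\<close>.
  The iterates \<open>w\<^sub>n\<close> of this equation from \<open>0\<close> are polynomials in \<open>z\<close>, hence self-adjoint and in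
  the commutant of the commutant of \<open>x\<close>. Their increments are dominated by those of the scalar
  iteration \<open>t \<mapsto> (1 + t\<^sup>2) / 2\<close>, which increases to a limit at most \<open>1\<close>; this covers the boundary
  case where \<open>1 - x\<close> has norm exactly \<open>1\<close>.\<close>

lemma sqrt_near_one:
  assumes x: "x \<in> sa A" and near: "nrm (\<one> \<ominus> x) \<le> 1"
  obtains s where "s \<in> sa A" "s \<otimes> s = x" "nrm (\<one> \<ominus> s) \<le> 1"
    "\<And>u. u \<in> carrier A \<Longrightarrow> u \<otimes> x = x \<otimes> u \<Longrightarrow> u \<otimes> s = s \<otimes> u"
proof -
  define z where "z = \<one> \<ominus> x"
  have z [simp]: "z \<in> sa A" "z \<in> carrier A" and zn: "nrm z \<le> 1" and [simp]: "x \<in> carrier A"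
    using x near by (auto simp: z_def)
  define f where "f w = (1/2) \<odot> (z \<oplus> w \<otimes> w)" for w
  define w where "w n = (f ^^ n) \<zero>" for n
  define t :: "nat \<Rightarrow> real" where "t n = ((\<lambda>t. (1 + t\<^sup>2) / 2) ^^ n) 0" for n
  have w0: "w 0 = \<zero>" and wS: "w (Suc n) = f (w n)" for n by (simp_all add: w_def)
  have t0: "t 0 = 0" and tS: "t (Suc n) = (1 + (t n)\<^sup>2) / 2" for n by (simp_all add: t_def)
  have ws: "w n \<in> sa A" for n
  proof (induction n)
    case (Suc n)
    then show ?case using sa_smult[of "z \<oplus> w n \<otimes> w n" "1/2"] by (simp add: wS f_def)
  qed (simp add: w0)
  have wc [simp]: "w n \<in> carrier A" for n using ws by simp
  have tb: "0 \<le> t n \<and> t n \<le> 1" for n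
  proof (induction n)
    case (Suc n)
    then have "(t n)\<^sup>2 \<le> 1" by (simp add: power_le_one)
    then show ?case by (simp add: tS)
  qed (simp add: t0)
  have wt: "nrm (w n) \<le> t n" for n
  proof (induction n)
    case (Suc n)
    have "nrm (z \<oplus> w n \<otimes> w n) \<le> nrm z + (nrm (w n))\<^sup>2"
      using nrm_add[of z "w n \<otimes> w n"] nrm_square[OF ws[of n]] by simp
    also have "\<dots> \<le> 1 + (t n)\<^sup>2" using zn Suc by (intro add_mono power_mono) auto
    finally show ?case by (simp add: wS tS f_def norm_divide)
  qed (simp add: w0 t0)
  \<comment> \<open>The factorization \<open>a\<^sup>2 - b\<^sup>2 = a (a - b) + (a - b) b\<close> holds without commutativity.\<close>
  have step: "nrm (w (Suc n) \<ominus> w n) \<le> t (Suc n) - t n" for n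
  proof (induction n)
    case 0
    show ?case using wt[of 1] by (simp add: w0 t0 minus_eq)
  next
    case (Suc n)
    let ?a = "w (Suc n)" and ?b = "w n"
    have c: "?a \<in> carrier A" "?b \<in> carrier A" "z \<in> carrier A" by simp_all
    then have "(z \<oplus> ?a \<otimes> ?a) \<ominus> (z \<oplus> ?b \<otimes> ?b) = ?a \<otimes> (?a \<ominus> ?b) \<oplus> (?a \<ominus> ?b) \<otimes> ?b"
      by algebra
    then have "f ?a \<ominus> f ?b = (1/2) \<odot> (?a \<otimes> (?a \<ominus> ?b) \<oplus> (?a \<ominus> ?b) \<otimes> ?b)"
      by (simp add: f_def flip: smult_diff_r)
    then have "nrm (f ?a \<ominus> f ?b) \<le> (nrm ?a * nrm (?a \<ominus> ?b) + nrm (?a \<ominus> ?b) * nrm ?b) / 2"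
      using nrm_add[of "?a \<otimes> (?a \<ominus> ?b)" "(?a \<ominus> ?b) \<otimes> ?b"] nrm_mult[of ?a "?a \<ominus> ?b"]
        nrm_mult[of "?a \<ominus> ?b" ?b] by (simp add: norm_divide)
    moreover have "t n \<le> t (Suc n)" using Suc nrm_ge0[of "?a \<ominus> ?b"] c by (simp del: nrm_ge0)
    then have "(nrm ?a * nrm (?a \<ominus> ?b) + nrm (?a \<ominus> ?b) * nrm ?b) / 2
        \<le> (t (Suc n) * (t (Suc n) - t n) + (t (Suc n) - t n) * t n) / 2"
      using Suc wt[of n] wt[of "Suc n"] tb[of n] tb[of "Suc n"]
      by (intro divide_right_mono add_mono mult_mono) auto
    moreover have "(t (Suc n) * (t (Suc n) - t n) + (t (Suc n) - t n) * t n) / 2 = t (Suc (Suc n)) - t (Suc n)"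
      unfolding tS[of "Suc n"] using tS[of n] by (simp add: power2_eq_square field_simps)
    ultimately show ?case by (simp only: wS)
  qed
  have "t n \<le> t (Suc n)" for n
    using step[of n] nrm_ge0[of "w (Suc n) \<ominus> w n"] by (simp del: nrm_ge0)
  then have inc: "incseq t" by (simp add: incseq_SucI)
  have diff: "m \<le> n \<Longrightarrow> nrm (w n \<ominus> w m) \<le> t n - t m" for m n
  proof (induction n rule: dec_induct)
    case base
    show ?case by (simp add: minus_eq r_neg)
  next
    case (step n)
    then show ?case
      using nrm_diff_triangle[of "w (Suc n)" "w n" "w m"] \<open>\<And>n. nrm (w (Suc n) \<ominus> w n) \<le> t (Suc n) - t n\<close>[of n]
      by simp
  qed
  obtain T where T: "t \<longlonglongrightarrow> T" "\<And>n. t n \<le> T"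
    using incseq_convergent[OF inc, of 1] tb by auto
  have diffT: "nrm (w n \<ominus> w m) \<le> T - t m" if "m \<le> n" for m n
    using diff[OF that] T(2)[of n] by simp
  have "(\<lambda>m. T - t m) \<longlonglongrightarrow> 0" using tendsto_diff[OF tendsto_const T(1), of T] by simp
  note T0 = this
  obtain v where v: "norm_lim w v"
  proof (rule norm_Cauchy_lim[OF wc])
    fix e :: real assume "0 < e"
    then obtain N where N: "\<And>n. N \<le> n \<Longrightarrow> T - t n < e"
      using order_tendstoD(2)[OF T0, of e] by (auto simp: eventually_sequentially)
    have "nrm (w n \<ominus> w m) < e" if "N \<le> m" "N \<le> n" for m n
      using diffT[of m n] diffT[of n m] N[OF that(1)] N[OF that(2)] nrm_diff_commute[OF wc wc, of n m]
      by (cases "m \<le> n") auto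
    then show "\<exists>N. \<forall>m\<ge>N. \<forall>n\<ge>N. nrm (w n \<ominus> w m) < e" by blast
  qed (rule that)
  have [simp]: "v \<in> carrier A" using norm_limD[OF v] by simp
  have vsa: "v \<in> sa A" using sa_norm_lim[OF v] ws by blast
  have "norm_lim (\<lambda>n. f (w n)) (f v)"
    unfolding f_def by (intro norm_lim_smult norm_lim_add norm_lim_mult norm_lim_const v z)
  then have fv: "f v = v" using norm_lim_unique norm_lim_Suc[OF v] wS by simp
  have "v \<oplus> v = (1/2) \<odot> (z \<oplus> v \<otimes> v) \<oplus> (1/2) \<odot> (z \<oplus> v \<otimes> v)"
    using fv by (simp add: f_def)
  then have vv: "v \<oplus> v = z \<oplus> v \<otimes> v" by (simp add: half_add_half)
  have "(\<one> \<ominus> v) \<otimes> (\<one> \<ominus> v) = \<one> \<oplus> v \<otimes> v \<ominus> (v \<oplus> v)"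
    by (simp add: minus_eq r_distr l_distr r_minus l_minus minus_add a_ac)
  also have "\<dots> = \<one> \<ominus> z" unfolding vv using \<open>v \<in> carrier A\<close> z(2) by algebra
  also have "\<dots> = x" unfolding z_def using \<open>x \<in> carrier A\<close> by algebra
  finally have sq: "(\<one> \<ominus> v) \<otimes> (\<one> \<ominus> v) = x" .
  have "nrm v \<le> 1" using norm_lim_nrm_le[OF v] wt tb order_trans by blast
  moreover have "\<one> \<ominus> (\<one> \<ominus> v) = v" using \<open>v \<in> carrier A\<close> by algebra
  ultimately have near': "nrm (\<one> \<ominus> (\<one> \<ominus> v)) \<le> 1" by simp
  have comm: "u \<otimes> (\<one> \<ominus> v) = (\<one> \<ominus> v) \<otimes> u" if u: "u \<in> carrier A" "u \<otimes> x = x \<otimes> u" for u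
  proof -
    have uz: "u \<otimes> z = z \<otimes> u"
      using u by (simp add: z_def minus_eq r_distr l_distr r_minus l_minus)
    have uw: "u \<otimes> w n = w n \<otimes> u" for n
    proof (induction n)
      case (Suc n)
      have "u \<otimes> (w n \<otimes> w n) = (u \<otimes> w n) \<otimes> w n" using u by (simp add: m_assoc)
      also have "\<dots> = w n \<otimes> (u \<otimes> w n)" using u by (simp add: Suc m_assoc)
      also have "\<dots> = (w n \<otimes> w n) \<otimes> u" using u by (simp add: Suc m_assoc)
      finally show ?case
        using u uz by (simp add: wS f_def smult_mult_r smult_mult_l r_distr l_distr)
    qed (use u in \<open>simp add: w0\<close>)
    have "norm_lim (\<lambda>n. u \<otimes> w n) (u \<otimes> v)" by (intro norm_lim_mult norm_lim_const v u)
    moreover have "norm_lim (\<lambda>n. u \<otimes> w n) (v \<otimes> u)"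
      unfolding uw by (intro norm_lim_mult norm_lim_const v u)
    ultimately have "u \<otimes> v = v \<otimes> u" by (rule norm_lim_unique)
    then show ?thesis using u by (simp add: minus_eq r_distr l_distr r_minus l_minus)
  qed
  show thesis
    by (rule that[OF _ sq near' comm]) (use vsa in simp_all)
qed

section \<open>The positive cone\<close>

text \<open>Squares of self-adjoint elements. The lemmas \<open>pos_near\<close> and \<open>pos_nearD\<close> describe them
  by a norm inequality, which makes it visible that they form a closed convex cone.\<close>

definition pos :: "'a set" where
  "pos = {s \<otimes> s | s. s \<in> sa A}"

lemma posE: assumes "x \<in> pos" obtains s where "s \<in> sa A" "x = s \<otimes> s"
  using assms by (auto simp: pos_def)

lemma pos_sa [simp]: "x \<in> pos \<Longrightarrow> x \<in> sa A" and pos_carrier [simp]: "x \<in> pos \<Longrightarrow> x \<in> carrier A"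
  by (auto simp: pos_def)

lemma pos_squareI: "s \<in> sa A \<Longrightarrow> s \<otimes> s \<in> pos"
  unfolding pos_def by blast

text \<open>For commuting \<open>y\<close> and \<open>s\<close>, the element \<open>u = y + \<i> s\<close> is normal with
  \<open>adj u \<otimes> u = y\<^sup>2 + s\<^sup>2\<close>, and \<open>y\<close> is its real part. This inequality replaces the spectral radius
  in the arguments below.\<close>

lemma nrm_le_sum_squares:
  assumes y: "y \<in> sa A" and s: "s \<in> sa A" and ys: "y \<otimes> s = s \<otimes> y"
  shows "(nrm y)\<^sup>2 \<le> nrm (y \<otimes> y \<oplus> s \<otimes> s)"
proof -
  have c: "y \<in> carrier A" "s \<in> carrier A" using y s by auto
  define u where "u = y \<oplus> \<i> \<odot> s"
  have u: "u \<in> carrier A" using c by (simp add: u_def)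
  have au: "adj u = y \<ominus> \<i> \<odot> s"
    using y s by (simp add: u_def adj_add adj_smult saD(2) smult_uminus minus_eq)
  have "adj u \<otimes> u = y \<otimes> y \<oplus> s \<otimes> s"
  proof -
    have "(\<i> \<odot> s) \<otimes> (\<i> \<odot> s) = \<ominus> (s \<otimes> s)"
      using c by (simp add: smult_mult_l smult_mult_r smult_smult neg_smult)
    moreover have "(\<i> \<odot> s) \<otimes> y = y \<otimes> (\<i> \<odot> s)"
      using c ys by (simp add: smult_mult_l smult_mult_r)
    moreover have "(y \<ominus> \<i> \<odot> s) \<otimes> (y \<oplus> \<i> \<odot> s)
        = y \<otimes> y \<oplus> y \<otimes> (\<i> \<odot> s) \<ominus> (\<i> \<odot> s) \<otimes> y \<ominus> (\<i> \<odot> s) \<otimes> (\<i> \<odot> s)"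
      using c(1) smult_closed[OF c(2), of \<i>] by algebra
    moreover have "y \<otimes> y \<oplus> y \<otimes> (\<i> \<odot> s) \<ominus> y \<otimes> (\<i> \<odot> s) \<ominus> \<ominus> (s \<otimes> s) = y \<otimes> y \<oplus> s \<otimes> s"
      using c smult_closed[OF c(2), of \<i>] by algebra
    ultimately show ?thesis unfolding au by (simp add: u_def)
  qed
  then have n: "nrm (y \<otimes> y \<oplus> s \<otimes> s) = (nrm u)\<^sup>2" using nrm_adj_mult[OF u] by simp
  have "u \<oplus> adj u = y \<oplus> y"
    unfolding au unfolding u_def using c(1) smult_closed[OF c(2), of \<i>] by algebra
  also have "\<dots> = 2 \<odot> y" using c smult_add_l[of y 1 1] by simp
  finally have "2 * nrm y \<le> nrm u + nrm (adj u)"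
    using nrm_add[of u "adj u"] u c nrm_smult[of y 2] by simp
  then have "nrm y \<le> nrm u" using u by simp
  then show ?thesis unfolding n using c by (intro power_mono) auto
qed

text \<open>If \<open>r\<close> is the square root of \<open>1 - s\<^sup>2\<close>, then \<open>r\<close> and \<open>s\<close> commute and \<open>r\<^sup>2 + s\<^sup>2 = 1\<close>,
  so the norm of \<open>r\<close> is at most \<open>1\<close>.\<close>

lemma nrm_one_minus_square:
  assumes s: "s \<in> sa A" and n: "nrm s \<le> 1"
  shows "nrm (\<one> \<ominus> s \<otimes> s) \<le> 1"
proof -
  have c: "s \<in> carrier A" using s by auto
  have e: "\<one> \<ominus> (\<one> \<ominus> s \<otimes> s) = s \<otimes> s" using c by algebra
  have "(nrm s)\<^sup>2 \<le> 1" using n c by (simp add: power_le_one)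
  then have "nrm (\<one> \<ominus> (\<one> \<ominus> s \<otimes> s)) \<le> 1" using nrm_square[OF s] e by simp
  from sqrt_near_one[OF sa_diff[OF sa_one sa_square[OF s]] this]
  obtain r where r: "r \<in> sa A" "r \<otimes> r = \<one> \<ominus> s \<otimes> s"
    and comm: "\<And>u. u \<in> carrier A \<Longrightarrow> u \<otimes> (\<one> \<ominus> s \<otimes> s) = (\<one> \<ominus> s \<otimes> s) \<otimes> u \<Longrightarrow> u \<otimes> r = r \<otimes> u"
    by blast
  have "s \<otimes> (\<one> \<ominus> s \<otimes> s) = (\<one> \<ominus> s \<otimes> s) \<otimes> s"
    using c by (simp add: minus_eq r_distr l_distr r_minus l_minus m_assoc)
  then have "r \<otimes> s = s \<otimes> r" using comm[OF c] by simp
  then have "(nrm r)\<^sup>2 \<le> nrm (r \<otimes> r \<oplus> s \<otimes> s)" using nrm_le_sum_squares r s by blast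
  also have "r \<otimes> r \<oplus> s \<otimes> s = \<one>" unfolding r(2) using c by algebra
  finally show ?thesis using nrm_square[OF r(1)] r(2) by simp
qed

lemma nrm_le_zero_iff [simp]: "a \<in> carrier A \<Longrightarrow> nrm a \<le> 0 \<longleftrightarrow> a = \<zero>"
  using nrm_ge0[of a] nrm_eq0[of a] by linarith

lemma scaled_near:
  assumes "t > 0" "x \<in> carrier A"
  shows "nrm (\<one> \<ominus> of_real (1/t) \<odot> x) \<le> 1 \<longleftrightarrow> nrm (of_real t \<odot> \<one> \<ominus> x) \<le> t"
proof -
  have "of_real t \<odot> (\<one> \<ominus> of_real (1/t) \<odot> x) = of_real t \<odot> \<one> \<ominus> x"
    using assms by (simp add: smult_diff_r smult_smult)
  then have "nrm (of_real t \<odot> \<one> \<ominus> x) = t * nrm (\<one> \<ominus> of_real (1/t) \<odot> x)"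
    using assms nrm_smult[of "\<one> \<ominus> of_real (1/t) \<odot> x" "of_real t"] by simp
  then show ?thesis using assms by simp
qed

lemma pos_smult:
  assumes "x \<in> pos" "0 \<le> r" shows "of_real r \<odot> x \<in> pos"
proof -
  obtain s where s: "s \<in> sa A" "x = s \<otimes> s" by (rule posE[OF assms(1)])
  have "of_real r \<odot> x = (of_real (sqrt r) \<odot> s) \<otimes> (of_real (sqrt r) \<odot> s)"
    using s assms(2) by (simp add: smult_mult_l smult_mult_r smult_smult flip: of_real_mult)
  then show ?thesis using s by (simp add: pos_squareI)
qed

lemma pos_nearI:
  assumes x: "x \<in> sa A" and n: "nrm (of_real t \<odot> \<one> \<ominus> x) \<le> t"
  obtains s where "s \<in> pos" "s \<otimes> s = x"
    "\<And>u. u \<in> carrier A \<Longrightarrow> u \<otimes> x = x \<otimes> u \<Longrightarrow> u \<otimes> s = s \<otimes> u"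
proof (cases "t > 0")
  case False
  have "0 \<le> nrm (of_real t \<odot> \<one> \<ominus> x)" using x by simp
  then have "t = 0" using n False by simp
  then have "x = \<zero>" using n x by (simp add: minus_eq)
  then show thesis using that[of \<zero>] pos_squareI[of \<zero>] by simp
next
  case True
  let ?y = "of_real (1/t) \<odot> x"
  have yx: "of_real t \<odot> ?y = x" using True x by (simp add: smult_smult)
  have y: "?y \<in> sa A" "nrm (\<one> \<ominus> ?y) \<le> 1" using x n True scaled_near[of t x] sa_smult[of x "1/t"] by auto
  from sqrt_near_one[OF this] obtain s where s: "s \<in> sa A" "s \<otimes> s = ?y" "nrm (\<one> \<ominus> s) \<le> 1"
    and comm: "\<And>u. u \<in> carrier A \<Longrightarrow> u \<otimes> ?y = ?y \<otimes> u \<Longrightarrow> u \<otimes> s = s \<otimes> u"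
    by blast
  from sqrt_near_one[OF s(1,3)] obtain s' where "s' \<in> sa A" "s' \<otimes> s' = s" by blast
  then have "s \<in> pos" using pos_squareI by blast
  then have 1: "of_real (sqrt t) \<odot> s \<in> pos" using True pos_smult by simp
  have 2: "(of_real (sqrt t) \<odot> s) \<otimes> (of_real (sqrt t) \<odot> s) = x"
    using s True x by (simp add: smult_mult_l smult_mult_r smult_smult flip: of_real_mult)
  have 3: "u \<otimes> (of_real (sqrt t) \<odot> s) = (of_real (sqrt t) \<odot> s) \<otimes> u"
    if "u \<in> carrier A" "u \<otimes> x = x \<otimes> u" for u
    using comm[of u] that s x by (simp add: smult_mult_l smult_mult_r)
  show thesis by (rule that[OF 1 2 3])
qed

lemma pos_nearD:
  assumes "x \<in> pos" "nrm x \<le> t"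
  shows "nrm (of_real t \<odot> \<one> \<ominus> x) \<le> t"
proof (cases "t > 0")
  case False
  then have "nrm x \<le> 0" using assms(2) by simp
  then have "x = \<zero>" using assms(1) by simp
  then have "t = 0" using False assms(2) by simp
  then show ?thesis using \<open>x = \<zero>\<close> by (simp add: minus_eq)
next
  case True
  obtain s where s: "s \<in> sa A" "x = s \<otimes> s" by (rule posE[OF assms(1)])
  let ?r = "of_real (1 / sqrt t) \<odot> s"
  have e: "?r \<otimes> ?r = of_real (1/t) \<odot> x"
    using s True by (simp add: smult_mult_l smult_mult_r smult_smult flip: of_real_mult of_real_divide)
  have r: "?r \<in> sa A" using s sa_smult[of s "1 / sqrt t"] by simp
  have "(nrm ?r)\<^sup>2 = nrm (of_real (1/t) \<odot> x)" using nrm_square[OF r] e by simp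
  also have "\<dots> \<le> 1" using assms True by (simp add: norm_divide)
  finally have "nrm ?r \<le> 1" using r by (simp add: power2_le_iff_abs_le abs_square_le_1)
  from nrm_one_minus_square[OF r this] e have "nrm (\<one> \<ominus> of_real (1/t) \<odot> x) \<le> 1" by simp
  then show ?thesis using scaled_near[of t x] True assms by simp
qed

lemma pos_near:
  assumes "x \<in> sa A" "nrm (of_real t \<odot> \<one> \<ominus> x) \<le> t" shows "x \<in> pos"
proof -
  obtain s where "s \<in> pos" "s \<otimes> s = x" by (rule pos_nearI[OF assms])
  then show ?thesis using pos_squareI[OF pos_sa, of s] by simp
qed

lemma pos_root:
  assumes "x \<in> pos"
  obtains s where "s \<in> pos" "s \<otimes> s = x"
    "\<And>u. u \<in> carrier A \<Longrightarrow> u \<otimes> x = x \<otimes> u \<Longrightarrow> u \<otimes> s = s \<otimes> u"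
  using pos_nearI[OF pos_sa[OF assms] pos_nearD[OF assms order_refl]] by blast

lemma pos_add:
  assumes "x \<in> pos" "y \<in> pos" shows "x \<oplus> y \<in> pos"
proof (rule pos_near)
  let ?a = "of_real (nrm x) \<odot> \<one>" and ?b = "of_real (nrm y) \<odot> \<one>"
  have c: "x \<in> carrier A" "y \<in> carrier A" "?a \<in> carrier A" "?b \<in> carrier A" using assms by auto
  have "of_real (nrm x + nrm y) \<odot> \<one> \<ominus> (x \<oplus> y) = (?a \<oplus> ?b) \<ominus> (x \<oplus> y)"
    by (simp add: smult_add_l)
  also have "\<dots> = (?a \<ominus> x) \<oplus> (?b \<ominus> y)" using c by algebra
  finally show "nrm (of_real (nrm x + nrm y) \<odot> \<one> \<ominus> (x \<oplus> y)) \<le> nrm x + nrm y"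
    using nrm_add[of "?a \<ominus> x" "?b \<ominus> y"] c pos_nearD[OF assms(1) order_refl]
      pos_nearD[OF assms(2) order_refl] by simp
qed (use assms in simp)

lemma pos_norm_lim:
  assumes l: "norm_lim x l" and p: "\<And>n. x n \<in> pos"
  shows "l \<in> pos"
proof -
  have sa: "l \<in> sa A" using sa_norm_lim[OF l] p by simp
  obtain t where t: "\<And>n. nrm (x n) \<le> t"
    using convergent_imp_Bseq[OF convergentI[OF norm_lim_nrm[OF l]]] p by (auto simp: Bseq_def)
  have "norm_lim (\<lambda>n. of_real t \<odot> \<one> \<ominus> x n) (of_real t \<odot> \<one> \<ominus> l)"
    by (intro norm_lim_diff norm_lim_const l) simp
  then have "nrm (of_real t \<odot> \<one> \<ominus> l) \<le> t"
    by (rule norm_lim_nrm_le) (rule pos_nearD[OF p t])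
  then show ?thesis by (rule pos_near[OF sa])
qed

text \<open>If \<open>x = s\<^sup>2\<close> and \<open>- x = r\<^sup>2\<close> with commuting roots, then \<open>s\<^sup>2 + r\<^sup>2 = 0\<close> and
  \<open>nrm_le_sum_squares\<close> forces \<open>s = 0\<close>.\<close>

lemma pos_antisym:
  assumes "x \<in> pos" "\<ominus> x \<in> pos" shows "x = \<zero>"
proof -
  obtain s where s: "s \<in> pos" "s \<otimes> s = x" by (rule pos_root[OF assms(1)]) blast
  obtain r where r: "r \<in> pos" "r \<otimes> r = \<ominus> x"
    and comm: "\<And>u. u \<in> carrier A \<Longrightarrow> u \<otimes> (\<ominus> x) = (\<ominus> x) \<otimes> u \<Longrightarrow> u \<otimes> r = r \<otimes> u"
    by (rule pos_root[OF assms(2)]) blast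
  have c: "s \<in> carrier A" using s by simp
  have "s \<otimes> \<ominus> (s \<otimes> s) = \<ominus> (s \<otimes> s) \<otimes> s" using c by algebra
  then have "s \<otimes> r = r \<otimes> s" using comm[OF c] s by simp
  then have "(nrm s)\<^sup>2 \<le> nrm (s \<otimes> s \<oplus> r \<otimes> r)" using s r by (intro nrm_le_sum_squares) auto
  also have "s \<otimes> s \<oplus> r \<otimes> r = \<zero>" using s r assms by (simp add: r_neg)
  finally have "s = \<zero>" using c by (simp add: nrm_eq0)
  then show ?thesis using s by auto
qed

lemma pos_sum_zero: "x \<in> pos \<Longrightarrow> y \<in> pos \<Longrightarrow> x \<oplus> y = \<zero> \<Longrightarrow> x = \<zero>"
  by (metis minus_equality pos_antisym pos_carrier a_comm)

lemma nrm_le_imp_pos: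
  assumes "x \<in> sa A" "nrm x \<le> r"
  shows "of_real r \<odot> \<one> \<ominus> x \<in> pos" "of_real r \<odot> \<one> \<oplus> x \<in> pos"
proof -
  have c: "x \<in> carrier A" "of_real r \<odot> \<one> \<in> carrier A" using assms by auto
  have "of_real r \<odot> \<one> \<ominus> (of_real r \<odot> \<one> \<ominus> x) = x" using c by algebra
  moreover have "of_real r \<odot> \<one> \<ominus> (of_real r \<odot> \<one> \<oplus> x) = \<ominus> x" using c by algebra
  ultimately show "of_real r \<odot> \<one> \<ominus> x \<in> pos" "of_real r \<odot> \<one> \<oplus> x \<in> pos"
    using assms c by (auto intro!: pos_near[where t = r])
qed

text \<open>If \<open>s\<close> and \<open>t\<close> are the roots of \<open>r - x\<close> and \<open>r + x\<close>, then everything commutes and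
  \<open>x\<^sup>2 + (s t)\<^sup>2 = r\<^sup>2\<close>. Together with \<open>nrm_le_imp_pos\<close> this recovers the norm of a self-adjoint
  element from the algebraic structure alone.\<close>

lemma pos_imp_nrm_le:
  assumes x: "x \<in> sa A"
    and p: "of_real r \<odot> \<one> \<ominus> x \<in> pos" "of_real r \<odot> \<one> \<oplus> x \<in> pos"
  shows "nrm x \<le> \<bar>r\<bar>"
proof -
  let ?r = "of_real r \<odot> \<one>"
  have c: "x \<in> carrier A" "?r \<in> carrier A" using x by auto
  have rc: "u \<otimes> ?r = ?r \<otimes> u" if "u \<in> carrier A" for u
    using that by (simp add: smult_mult_l smult_mult_r)
  obtain s where s: "s \<in> pos" "s \<otimes> s = ?r \<ominus> x"
    and s': "\<And>u. u \<in> carrier A \<Longrightarrow> u \<otimes> (?r \<ominus> x) = (?r \<ominus> x) \<otimes> u \<Longrightarrow> u \<otimes> s = s \<otimes> u"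
    by (rule pos_root[OF p(1)]) blast
  obtain t where t: "t \<in> pos" "t \<otimes> t = ?r \<oplus> x"
    and t': "\<And>u. u \<in> carrier A \<Longrightarrow> u \<otimes> (?r \<oplus> x) = (?r \<oplus> x) \<otimes> u \<Longrightarrow> u \<otimes> t = t \<otimes> u"
    by (rule pos_root[OF p(2)]) blast
  have sc: "s \<in> carrier A" and tc: "t \<in> carrier A" using s t by auto
  have xs: "x \<otimes> s = s \<otimes> x"
    by (rule s') (use c rc[of x] in \<open>simp_all add: minus_eq r_distr l_distr r_minus l_minus\<close>)
  have xt: "x \<otimes> t = t \<otimes> x"
    by (rule t') (use c rc[of x] in \<open>simp_all add: minus_eq r_distr l_distr r_minus l_minus\<close>)
  have st: "s \<otimes> t = t \<otimes> s"
    by (rule t') (use c sc rc[of s] xs in \<open>simp_all add: r_distr l_distr\<close>)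
  have "x \<otimes> (s \<otimes> t) = (x \<otimes> s) \<otimes> t" using c sc tc by (simp add: m_assoc)
  also have "\<dots> = s \<otimes> (x \<otimes> t)" unfolding xs using c sc tc by (simp add: m_assoc)
  also have "\<dots> = (s \<otimes> t) \<otimes> x" unfolding xt using c sc tc by (simp add: m_assoc)
  finally have "x \<otimes> (s \<otimes> t) = (s \<otimes> t) \<otimes> x" .
  then have "(nrm x)\<^sup>2 \<le> nrm (x \<otimes> x \<oplus> (s \<otimes> t) \<otimes> (s \<otimes> t))"
    using x s t st by (intro nrm_le_sum_squares sa_mult) auto
  also have "(s \<otimes> t) \<otimes> (s \<otimes> t) = (s \<otimes> s) \<otimes> (t \<otimes> t)"
    using sc tc st by (metis m_assoc m_closed)
  also have "\<dots> = ?r \<otimes> ?r \<ominus> x \<otimes> x"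
  proof -
    have "(?r \<ominus> x) \<otimes> (?r \<oplus> x) = ?r \<otimes> ?r \<oplus> ?r \<otimes> x \<ominus> x \<otimes> ?r \<ominus> x \<otimes> x" using c by algebra
    also have "\<dots> = ?r \<otimes> ?r \<ominus> x \<otimes> x" unfolding rc[OF c(1)] using c by algebra
    finally show ?thesis using s t by simp
  qed
  also have "x \<otimes> x \<oplus> (?r \<otimes> ?r \<ominus> x \<otimes> x) = ?r \<otimes> ?r" using c by algebra
  also have "nrm \<dots> = r\<^sup>2" by (simp add: smult_mult_l smult_mult_r power2_eq_square)
  finally show ?thesis by (simp add: abs_le_square_iff[symmetric] c)
qed

text \<open>Kaplansky's theorem. Let \<open>y = adj b \<otimes> b\<close>, let \<open>a\<close> be the square root of \<open>y\<^sup>2\<close>, and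
  \<open>u = a - y\<close>, which is twice the negative part of \<open>y\<close>. For \<open>c = b u\<close> one finds
  \<open>adj c \<otimes> c = - d\<^sup>2\<close> with \<open>d\<close> self-adjoint. For \<open>e = c d\<close> both products of \<open>e\<close> with its adjoint
  are then negatives of squares, namely \<open>- (d\<^sup>2)\<^sup>2\<close> and \<open>- (c \<otimes> adj c)\<^sup>2\<close>. But their sum is also
  half of \<open>h\<^sup>2 + k\<^sup>2\<close>, where \<open>h = e + adj e\<close> and \<open>k = \<i> (e - adj e)\<close> are self-adjoint. The cone
  being pointed, all these squares vanish, so \<open>d = 0\<close>, \<open>c = 0\<close> and finally \<open>u = 0\<close>, which says
  that \<open>y = a\<close>.\<close>

lemma adj_mult_pos:
  assumes b: "b \<in> carrier A"
  shows "adj b \<otimes> b \<in> pos"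
proof -
  define y where "y = adj b \<otimes> b"
  have y: "y \<in> sa A" and yc: "y \<in> carrier A" using b sa_adj_mult by (auto simp: y_def)
  obtain a where a: "a \<in> pos" "a \<otimes> a = y \<otimes> y"
    and a': "\<And>u. u \<in> carrier A \<Longrightarrow> u \<otimes> (y \<otimes> y) = (y \<otimes> y) \<otimes> u \<Longrightarrow> u \<otimes> a = a \<otimes> u"
    by (rule pos_root[OF pos_squareI[OF y]]) blast
  have ac: "a \<in> carrier A" using a by simp
  have ya: "y \<otimes> a = a \<otimes> y" by (rule a') (use yc in \<open>simp_all add: m_assoc\<close>)
  obtain r where r: "r \<in> pos" "r \<otimes> r = a"
    and r': "\<And>u. u \<in> carrier A \<Longrightarrow> u \<otimes> a = a \<otimes> u \<Longrightarrow> u \<otimes> r = r \<otimes> u"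
    by (rule pos_root[OF a(1)]) blast
  have rc: "r \<in> carrier A" using r by simp
  define u where "u = a \<ominus> y"
  have us: "u \<in> sa A" and uc: "u \<in> carrier A" using a y by (auto simp: u_def)
  have ua: "u \<otimes> a = a \<otimes> u"
    using ac yc ya by (simp add: u_def minus_eq r_distr l_distr r_minus l_minus)
  have ur: "u \<otimes> r = r \<otimes> u" by (rule r'[OF uc ua])
  have yu: "y \<otimes> u = \<ominus> (a \<otimes> u)"
    using ac yc ya a(2) by (simp add: u_def minus_eq r_distr r_minus minus_add a_comm)
  define c where "c = b \<otimes> u"
  have cc: "c \<in> carrier A" using b uc by (simp add: c_def)
  have adjc: "adj c = u \<otimes> adj b" using b uc us by (simp add: c_def adj_mult saD(2))
  define d where "d = r \<otimes> u"
  have ds: "d \<in> sa A" unfolding d_def using r us ur by (intro sa_mult) auto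
  have dc: "d \<in> carrier A" using ds by simp
  have dd: "d \<otimes> d = u \<otimes> (a \<otimes> u)"
  proof -
    have "d \<otimes> d = (u \<otimes> r) \<otimes> (r \<otimes> u)" by (simp add: d_def ur)
    also have "\<dots> = u \<otimes> ((r \<otimes> r) \<otimes> u)" using uc rc by (simp add: m_assoc)
    finally show ?thesis using r by simp
  qed
  have cdd: "adj c \<otimes> c = \<ominus> (d \<otimes> d)"
  proof -
    have "adj c \<otimes> c = u \<otimes> (y \<otimes> u)"
      unfolding adjc unfolding c_def y_def using b uc by (simp add: m_assoc)
    also have "\<dots> = \<ominus> (d \<otimes> d)" using uc ac by (simp add: yu dd r_minus)
    finally show ?thesis .
  qed
  define e where "e = c \<otimes> d"
  define f where "f = adj e"
  have ec: "e \<in> carrier A" "f \<in> carrier A" using cc dc by (auto simp: e_def f_def)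
  have adje: "f = d \<otimes> adj c" using cc ds by (simp add: f_def e_def adj_mult saD(2))
  define p where "p = d \<otimes> d"
  define q where "q = c \<otimes> adj c"
  have ps: "p \<in> sa A" and qs: "q \<in> sa A"
    using ds cc sa_adj_mult[of "adj c"] by (auto simp: p_def q_def)
  have pc: "p \<in> carrier A" "q \<in> carrier A" using ps qs by auto
  have ee1: "f \<otimes> e = \<ominus> (p \<otimes> p)"
  proof -
    have "f \<otimes> e = d \<otimes> (adj c \<otimes> c) \<otimes> d" using cc dc by (simp add: adje e_def m_assoc)
    also have "\<dots> = d \<otimes> \<ominus> (d \<otimes> d) \<otimes> d" by (simp only: cdd)
    also have "\<dots> = \<ominus> (p \<otimes> p)" using dc by (simp add: p_def r_minus l_minus m_assoc)
    finally show ?thesis .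
  qed
  have ee2: "e \<otimes> f = \<ominus> (q \<otimes> q)"
  proof -
    have "d \<otimes> d = \<ominus> (adj c \<otimes> c)" using cdd dc by simp
    moreover have "e \<otimes> f = c \<otimes> (d \<otimes> d) \<otimes> adj c" using cc dc by (simp add: adje e_def m_assoc)
    ultimately have "e \<otimes> f = c \<otimes> \<ominus> (adj c \<otimes> c) \<otimes> adj c" by simp
    also have "\<dots> = \<ominus> (q \<otimes> q)" using cc by (simp add: q_def r_minus l_minus m_assoc)
    finally show ?thesis .
  qed
  define h where "h = e \<oplus> f"
  define k where "k = \<i> \<odot> (e \<ominus> f)"
  have hs: "h \<in> sa A" by (rule saI) (use ec in \<open>simp_all add: h_def f_def adj_add a_comm\<close>)
  have ks: "k \<in> sa A"
  proof (rule saI)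
    have "adj k = (- \<i>) \<odot> (f \<ominus> e)" using ec by (simp add: k_def f_def adj_smult adj_diff)
    also have "\<dots> = \<i> \<odot> (\<ominus> (f \<ominus> e))" using ec by (simp add: smult_uminus smult_neg)
    also have "\<ominus> (f \<ominus> e) = e \<ominus> f" using ec by algebra
    finally show "adj k = k" by (simp add: k_def)
  qed (use ec in \<open>simp add: k_def\<close>)
  have kk: "k \<otimes> k = \<ominus> ((e \<ominus> f) \<otimes> (e \<ominus> f))"
    using ec by (simp add: k_def smult_mult_l smult_mult_r smult_smult neg_smult)
  have "h \<otimes> h \<oplus> k \<otimes> k = (e \<otimes> f \<oplus> f \<otimes> e) \<oplus> (e \<otimes> f \<oplus> f \<otimes> e)"
    unfolding kk unfolding h_def using ec by algebra
  also have "\<dots> = (\<ominus> (q \<otimes> q) \<oplus> \<ominus> (p \<otimes> p)) \<oplus> (\<ominus> (q \<otimes> q) \<oplus> \<ominus> (p \<otimes> p))"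
    by (simp only: ee1 ee2)
  finally have hk: "h \<otimes> h \<oplus> k \<otimes> k = (\<ominus> (q \<otimes> q) \<oplus> \<ominus> (p \<otimes> p)) \<oplus> (\<ominus> (q \<otimes> q) \<oplus> \<ominus> (p \<otimes> p))" .
  have "p \<otimes> p \<oplus> (p \<otimes> p \<oplus> ((q \<otimes> q \<oplus> q \<otimes> q) \<oplus> (h \<otimes> h \<oplus> k \<otimes> k))) = \<zero>"
    unfolding hk using pc by algebra
  then have "p \<otimes> p = \<zero>"
    by (rule pos_sum_zero[rotated 2]) (intro pos_add pos_squareI ps qs hs ks)+
  then have "p = \<zero>" by (rule square_eq_zero[OF ps])
  then have "adj c \<otimes> c = \<zero>" using cdd by (simp add: p_def)
  then have "c = \<zero>" using nrm_adj_mult[OF cc] nrm_eq0[OF cc] by simp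
  then have "adj b \<otimes> (b \<otimes> u) = \<zero>" using b by (simp add: c_def)
  then have "y \<otimes> u = \<zero>" using b uc by (simp add: y_def m_assoc)
  moreover from this have "a \<otimes> u = \<zero>" using yu ac uc by (metis add.inv_eq_1_iff m_closed)
  ultimately have "u \<otimes> u = \<zero>"
    using ac yc uc by (subst (1) u_def) (simp add: minus_eq l_distr l_minus)
  then have "u = \<zero>" by (rule square_eq_zero[OF us])
  then have "a = y" using ac yc by (simp add: u_def diff_eq_zero_iff)
  then show ?thesis using a by (simp add: y_def)
qed

end

lemma closedin_Collect_ball:
  assumes "\<And>i. i \<in> I \<Longrightarrow> closedin X {x \<in> topspace X. P i x}"
  shows "closedin X {x \<in> topspace X. \<forall>i\<in>I. P i x}"
proof (cases "I = {}")
  case False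
  then have "{x \<in> topspace X. \<forall>i\<in>I. P i x} = (\<Inter>i\<in>I. {x \<in> topspace X. P i x})" by auto
  then show ?thesis using assms False by auto
qed simp

context cstar begin

section \<open>Linear functionals below sublinear functionals\<close>

text \<open>The values outside the self-adjoint part are arbitrary. Homogeneity for \<open>r = 0\<close> follows
  from the case \<open>r > 0\<close> (\<open>sublinear_zero\<close>).\<close>

definition sublinear :: "('a \<Rightarrow> real) \<Rightarrow> bool" where
  "sublinear q \<longleftrightarrow> (\<forall>x\<in>sa A. \<forall>y\<in>sa A. q (x \<oplus> y) \<le> q x + q y) \<and>
     (\<forall>r>0. \<forall>x\<in>sa A. q (of_real r \<odot> x) = r * q x)"

lemma sublinearD:
  assumes "sublinear q"
  shows "x \<in> sa A \<Longrightarrow> y \<in> sa A \<Longrightarrow> q (x \<oplus> y) \<le> q x + q y"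
    and "0 < r \<Longrightarrow> x \<in> sa A \<Longrightarrow> q (of_real r \<odot> x) = r * q x"
  using assms by (auto simp: sublinear_def)

lemma sublinear_zero: "sublinear q \<Longrightarrow> q \<zero> = 0"
  using sublinearD(2)[of q 2 \<zero>] by simp

lemma sublinear_smult: "sublinear q \<Longrightarrow> 0 \<le> r \<Longrightarrow> x \<in> sa A \<Longrightarrow> q (of_real r \<odot> x) = r * q x"
  using sublinearD(2)[of q r x] sublinear_zero[of q] by (cases "r = 0") auto

lemma sublinear_neg: "sublinear q \<Longrightarrow> x \<in> sa A \<Longrightarrow> - q (\<ominus> x) \<le> q x"
  using sublinearD(1)[of q x "\<ominus> x"] sublinear_zero[of q] by (simp add: r_neg)

text \<open>The infimum of a family is sublinear as soon as the family absorbs sums and positive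
  multiples. This serves three times: for chains in Zorn's lemma, for \<open>sublinear_through\<close>, and for
  the functional that yields norming states.\<close>

lemma sublinear_INF:
  fixes h :: "'i \<Rightarrow> 'a \<Rightarrow> real"
  assumes I: "I \<noteq> {}"
    and bdd: "\<And>x. x \<in> sa A \<Longrightarrow> bdd_below ((\<lambda>i. h i x) ` I)"
    and add: "\<And>i j x y. i \<in> I \<Longrightarrow> j \<in> I \<Longrightarrow> x \<in> sa A \<Longrightarrow> y \<in> sa A \<Longrightarrow>
      \<exists>k\<in>I. h k (x \<oplus> y) \<le> h i x + h j y"
    and scale: "\<And>i r x. i \<in> I \<Longrightarrow> 0 < r \<Longrightarrow> x \<in> sa A \<Longrightarrow>
      \<exists>k\<in>I. h k (of_real r \<odot> x) \<le> r * h i x"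
  shows "sublinear (\<lambda>x. INF i\<in>I. h i x)"
proof -
  let ?u = "\<lambda>x. INF i\<in>I. h i x"
  have low: "?u x \<le> h i x" if "i \<in> I" "x \<in> sa A" for i x
    by (rule cINF_lower[OF bdd[OF that(2)] that(1)])
  have le: "?u (of_real r \<odot> x) \<le> r * ?u x" if r: "0 < r" and x: "x \<in> sa A" for r x
  proof -
    have "?u (of_real r \<odot> x) / r \<le> ?u x"
    proof (rule cINF_greatest[OF I])
      fix i assume "i \<in> I"
      then obtain k where "k \<in> I" "h k (of_real r \<odot> x) \<le> r * h i x" using scale[OF _ r x] by blast
      then have "?u (of_real r \<odot> x) \<le> r * h i x" using low[of k "of_real r \<odot> x"] x by simp
      then show "?u (of_real r \<odot> x) / r \<le> h i x" using r by (simp add: field_simps)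
    qed
    then show ?thesis using r by (simp add: field_simps)
  qed
  show ?thesis
    unfolding sublinear_def
  proof (intro conjI ballI allI impI)
    fix x y assume x: "x \<in> sa A" and y: "y \<in> sa A"
    have "?u (x \<oplus> y) - h j y \<le> ?u x" if j: "j \<in> I" for j
    proof (rule cINF_greatest[OF I])
      fix i assume "i \<in> I"
      then obtain k where "k \<in> I" "h k (x \<oplus> y) \<le> h i x + h j y" using add[OF _ j x y] by blast
      then show "?u (x \<oplus> y) - h j y \<le> h i x" using low[of k "x \<oplus> y"] x y by simp
    qed
    then have "?u (x \<oplus> y) - ?u x \<le> h j y" if "j \<in> I" for j using that by (simp add: algebra_simps)
    then have "?u (x \<oplus> y) - ?u x \<le> ?u y" by (intro cINF_greatest[OF I])
    then show "?u (x \<oplus> y) \<le> ?u x + ?u y" by simp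
  next
    fix r :: real and x assume r: "0 < r" and x: "x \<in> sa A"
    have "of_real (1 / r) \<odot> (of_real r \<odot> x) = x" using r x by (simp add: smult_smult)
    then have "?u x \<le> (1 / r) * ?u (of_real r \<odot> x)"
      using le[of "1 / r" "of_real r \<odot> x"] r x by simp
    then have "r * ?u x \<le> ?u (of_real r \<odot> x)" using r by (simp add: field_simps)
    then show "?u (of_real r \<odot> x) = r * ?u x" using le[OF r x] by simp
  qed
qed

text \<open>Passing to the infimum of \<open>q (x + t y) - t q y\<close> over \<open>t \<ge> 0\<close> pushes \<open>q\<close> down until it
  is linear in the direction \<open>y\<close>, keeping the value at \<open>y\<close>.\<close>

lemma sublinear_through:
  assumes q: "sublinear q" and y: "y \<in> sa A"
  obtains g where "sublinear g" "\<And>x. x \<in> sa A \<Longrightarrow> g x \<le> q x" "g (\<ominus> y) \<le> - q y"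
proof -
  define h where "h t x = q (x \<oplus> of_real t \<odot> y) - t * q y" for t x
  have lb: "- q (\<ominus> x) \<le> h t x" if "0 \<le> t" "x \<in> sa A" for t x
  proof -
    have c: "x \<in> carrier A" "of_real t \<odot> y \<in> carrier A" using that y by auto
    have "x \<oplus> of_real t \<odot> y \<oplus> \<ominus> x = of_real t \<odot> y" using c by algebra
    then have "t * q y \<le> q (x \<oplus> of_real t \<odot> y) + q (\<ominus> x)"
      using sublinearD(1)[OF q, of "x \<oplus> of_real t \<odot> y" "\<ominus> x"] sublinear_smult[OF q that(1) y] that y
      by simp
    then show ?thesis by (simp add: h_def)
  qed
  let ?g = "\<lambda>x. INF t\<in>{0..}. h t x"
  have bdd: "bdd_below ((\<lambda>t. h t x) ` {0..})" if "x \<in> sa A" for x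
    using lb that by (intro bdd_belowI2[where m = "- q (\<ominus> x)"]) auto
  have low: "?g x \<le> h t x" if "x \<in> sa A" "0 \<le> t" for x t
    using cINF_lower[OF bdd[OF that(1)], of t] that by simp
  have "sublinear ?g"
  proof (rule sublinear_INF)
    fix s t :: real and x z assume s: "s \<in> {0..}" and t: "t \<in> {0..}" and x: "x \<in> sa A" and z: "z \<in> sa A"
    have c: "x \<in> carrier A" "z \<in> carrier A" "of_real s \<odot> y \<in> carrier A" "of_real t \<odot> y \<in> carrier A"
      using x y z by auto
    have "x \<oplus> z \<oplus> of_real (s + t) \<odot> y = x \<oplus> z \<oplus> (of_real s \<odot> y \<oplus> of_real t \<odot> y)"
      using y by (simp add: smult_add_l)
    also have "\<dots> = (x \<oplus> of_real s \<odot> y) \<oplus> (z \<oplus> of_real t \<odot> y)" using c by algebra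
    finally have "h (s + t) (x \<oplus> z) \<le> h s x + h t z"
      using sublinearD(1)[OF q, of "x \<oplus> of_real s \<odot> y" "z \<oplus> of_real t \<odot> y"] x y z
      by (simp add: h_def algebra_simps)
    then show "\<exists>k\<in>{0..}. h k (x \<oplus> z) \<le> h s x + h t z" using s t by (intro bexI[of _ "s + t"]) auto
  next
    fix t r :: real and x assume t: "t \<in> {0..}" and r: "0 < r" and x: "x \<in> sa A"
    have "of_real r \<odot> x \<oplus> of_real (r * t) \<odot> y = of_real r \<odot> (x \<oplus> of_real t \<odot> y)"
      using x y by (simp add: smult_add_r smult_smult)
    then have "h (r * t) (of_real r \<odot> x) = r * h t x"
      using sublinearD(2)[OF q r, of "x \<oplus> of_real t \<odot> y"] x y by (simp add: h_def algebra_simps)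
    then show "\<exists>k\<in>{0..}. h k (of_real r \<odot> x) \<le> r * h t x"
      using t r by (intro bexI[of _ "r * t"]) auto
  qed (use bdd in auto)
  moreover have "?g x \<le> q x" if "x \<in> sa A" for x using low[OF that, of 0] that y by (simp add: h_def)
  moreover have "?g (\<ominus> y) \<le> - q y"
    using low[of "\<ominus> y" 1] y sublinear_zero[OF q] by (simp add: h_def l_neg)
  ultimately show thesis using that[of ?g] by blast
qed

text \<open>The Hahn-Banach theorem: a minimal sublinear functional below \<open>p\<close> is linear, because by
  \<open>sublinear_through\<close> it is linear in each direction. Linearity is recorded as oddness, which for
  a sublinear functional is equivalent.\<close>

lemma linear_below_sublinear:
  assumes p: "sublinear p"
  obtains f where "sublinear f" "\<And>x. x \<in> sa A \<Longrightarrow> f x \<le> p x" "\<And>x. x \<in> sa A \<Longrightarrow> f (\<ominus> x) = - f x"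
proof -
  \<comment> \<open>Extensionality makes the pointwise order on the self-adjoint part antisymmetric.\<close>
  let ?S = "{q. sublinear q \<and> (\<forall>x\<in>sa A. q x \<le> p x) \<and> q \<in> extensional (sa A)}"
  let ?P = "\<lambda>q q'. \<forall>x\<in>sa A. (q' x :: real) \<le> q x"
  have restr: "restrict q (sa A) \<in> ?S" if "sublinear q" "\<forall>x\<in>sa A. q x \<le> p x" for q
    using that by (auto simp: sublinear_def)
  have "\<exists>m\<in>?S. \<forall>a\<in>?S. ?P m a \<longrightarrow> a = m"
  proof (rule predicate_Zorn)
    show "partial_order_on ?S (relation_of ?P ?S)"
    proof (rule partial_order_on_relation_ofI)
      fix q r assume qr: "q \<in> ?S" "r \<in> ?S" "?P q r" "?P r q"
      show "q = r"
        by (rule extensionalityI[where A = "sa A"]) (use qr in \<open>auto intro: antisym\<close>)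
    qed (blast intro: order_trans)+
  next
    fix C assume C: "C \<in> Chains (relation_of ?P ?S)"
    then have CS: "C \<subseteq> ?S" and chain: "\<And>q r. q \<in> C \<Longrightarrow> r \<in> C \<Longrightarrow> ?P q r \<or> ?P r q"
      by (auto simp: Chains_def relation_of_def)
    show "\<exists>u\<in>?S. \<forall>a\<in>C. ?P a u"
    proof (cases "C = {}")
      case True
      then show ?thesis using restr[OF p] by auto
    next
      case False
      let ?u = "\<lambda>x. INF q\<in>C. q x"
      have lb: "- p (\<ominus> x) \<le> q x" if q: "q \<in> C" and x: "x \<in> sa A" for q x
      proof -
        have "sublinear q" "q (\<ominus> x) \<le> p (\<ominus> x)" using CS q x by auto
        then show ?thesis using sublinear_neg[of q x] x by simp
      qed
      have bdd: "bdd_below ((\<lambda>q. q x) ` C)" if "x \<in> sa A" for x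
        using lb that by (intro bdd_belowI2[where m = "- p (\<ominus> x)"]) auto
      have low: "?u x \<le> q x" if "x \<in> sa A" "q \<in> C" for x q
        by (rule cINF_lower[OF bdd[OF that(1)] that(2)])
      have "sublinear ?u"
      proof (rule sublinear_INF[OF False bdd])
        fix q r x y assume q: "q \<in> C" and r: "r \<in> C" and x: "x \<in> sa A" and y: "y \<in> sa A"
        have sub: "sublinear q" "sublinear r" using CS q r by auto
        show "\<exists>k\<in>C. k (x \<oplus> y) \<le> q x + r y"
          using chain[OF q r]
        proof
          assume "?P q r"
          then show ?thesis using sublinearD(1)[OF sub(2) x y] r x by (intro bexI[of _ r]) auto
        next
          assume "?P r q"
          then show ?thesis using sublinearD(1)[OF sub(1) x y] q y by (intro bexI[of _ q]) auto
        qed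
      next
        fix q r x assume "q \<in> C" "0 < (r::real)" "x \<in> sa A"
        moreover from this CS have "sublinear q" by auto
        ultimately show "\<exists>k\<in>C. k (of_real r \<odot> x) \<le> r * q x"
          using sublinearD(2)[of q r x] by (intro bexI[of _ q]) auto
      qed
      moreover obtain q where "q \<in> C" using False by blast
      then have "?u x \<le> p x" if "x \<in> sa A" for x
        using low[OF that \<open>q \<in> C\<close>] CS that by (force intro: order_trans)
      ultimately show ?thesis using restr[of ?u] low by (intro bexI[of _ "restrict ?u (sa A)"]) auto
    qed
  qed
  then obtain m where m: "sublinear m" "\<And>x. x \<in> sa A \<Longrightarrow> m x \<le> p x" "m \<in> extensional (sa A)"
    and min: "\<And>a. a \<in> ?S \<Longrightarrow> ?P m a \<Longrightarrow> a = m" by blast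
  have "m (\<ominus> y) = - m y" if y: "y \<in> sa A" for y
  proof -
    obtain g where g: "sublinear g" "\<And>x. x \<in> sa A \<Longrightarrow> g x \<le> m x" "g (\<ominus> y) \<le> - m y"
      using sublinear_through[OF m(1) y] by metis
    have "restrict g (sa A) \<in> ?S" by (rule restr) (use g m order_trans in blast)+
    then have "restrict g (sa A) = m" by (rule min) (use g in simp)
    then have "m (\<ominus> y) = g (\<ominus> y)" using y by (metis restrict_apply' sa_neg)
    then show ?thesis using g(3) sublinear_neg[OF m(1) y] by simp
  qed
  then show thesis using that[of m] m by blast
qed

section \<open>States\<close>

text \<open>The real part. The imaginary part is \<open>re ((- \<i>) \<odot> a)\<close>, see \<open>re_decomp\<close>.\<close>

definition re :: "'a \<Rightarrow> 'a" where
  "re a = (1/2) \<odot> (a \<oplus> adj a)"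

lemma re_sa [simp]: "a \<in> carrier A \<Longrightarrow> re a \<in> sa A"
proof -
  assume a: "a \<in> carrier A"
  then have "a \<oplus> adj a \<in> sa A" by (intro saI) (simp_all add: adj_add a_comm)
  from sa_smult[OF this, of "1/2"] show ?thesis by (simp add: re_def)
qed

lemma re_add: "a \<in> carrier A \<Longrightarrow> b \<in> carrier A \<Longrightarrow> re (a \<oplus> b) = re a \<oplus> re b"
  by (simp add: re_def adj_add a_ac smult_add_r)

lemma re_smult: "a \<in> carrier A \<Longrightarrow> re (of_real r \<odot> a) = of_real r \<odot> re a"
  by (simp add: re_def adj_smult smult_add_r smult_smult mult.commute)

lemma re_of_sa: "a \<in> sa A \<Longrightarrow> re a = a"
  by (simp add: re_def saD(2) smult_add_r half_add_half)

lemma re_i_sa: "a \<in> sa A \<Longrightarrow> re (\<i> \<odot> a) = \<zero>"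
  by (simp add: re_def saD(2) adj_smult smult_uminus r_neg)

lemma nrm_re: "a \<in> carrier A \<Longrightarrow> nrm (re a) \<le> nrm a"
  using nrm_add[of a "adj a"] by (simp add: re_def norm_divide)

lemma re_decomp: "a \<in> carrier A \<Longrightarrow> a = re a \<oplus> \<i> \<odot> re ((- \<i>) \<odot> a)"
proof -
  assume a: "a \<in> carrier A"
  have "\<i> \<odot> re ((- \<i>) \<odot> a) = (1/2) \<odot> a \<oplus> (-1/2) \<odot> adj a"
    using a by (simp add: re_def adj_smult smult_add_r smult_smult)
  moreover have "(-1/2) \<odot> adj a = \<ominus> ((1/2) \<odot> adj a)"
    using a smult_uminus[of "adj a" "1/2"] by simp
  moreover have "re a = (1/2) \<odot> a \<oplus> (1/2) \<odot> adj a" using a by (simp add: re_def smult_add_r)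
  moreover have "(1/2) \<odot> a \<oplus> (1/2) \<odot> adj a \<oplus> ((1/2) \<odot> a \<oplus> \<ominus> ((1/2) \<odot> adj a)) = (1/2) \<odot> a \<oplus> (1/2) \<odot> a"
    using smult_closed[OF a, of "1/2"] smult_closed[OF adj_closed[OF a], of "1/2"] by algebra
  ultimately show ?thesis using half_add_half[OF a] by simp
qed

lemma stateD:
  assumes "\<phi> \<in> states A"
  shows "a \<in> carrier A \<Longrightarrow> b \<in> carrier A \<Longrightarrow> \<phi> (a \<oplus> b) = \<phi> a + \<phi> b"
    and "a \<in> carrier A \<Longrightarrow> \<phi> (c \<odot> a) = c * \<phi> a"
    and "a \<in> carrier A \<Longrightarrow> \<phi> (adj a \<otimes> a) \<in> \<real>\<^sub>\<ge>\<^sub>0"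
    and "\<phi> \<one> = 1" and "\<phi> \<in> extensional (carrier A)"
  using assms by (auto simp: states_def)

lemma state_diff: "\<phi> \<in> states A \<Longrightarrow> a \<in> carrier A \<Longrightarrow> b \<in> carrier A \<Longrightarrow> \<phi> (a \<ominus> b) = \<phi> a - \<phi> b"
  by (simp add: minus_eq neg_smult stateD(1,2))

lemma state_pos: "\<phi> \<in> states A \<Longrightarrow> x \<in> pos \<Longrightarrow> \<phi> x \<in> \<real>\<^sub>\<ge>\<^sub>0"
  by (erule posE) (metis stateD(3) saD)

lemma state_sa_bound:
  assumes \<phi>: "\<phi> \<in> states A" and x: "x \<in> sa A"
  shows "Im (\<phi> x) = 0" "cmod (\<phi> x) \<le> nrm x"
proof -
  have "\<phi> (of_real (nrm x) \<odot> \<one> \<ominus> x) \<in> \<real>\<^sub>\<ge>\<^sub>0" "\<phi> (of_real (nrm x) \<odot> \<one> \<oplus> x) \<in> \<real>\<^sub>\<ge>\<^sub>0"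
    using state_pos[OF \<phi>] nrm_le_imp_pos[OF x order_refl] by auto
  then have "of_real (nrm x) - \<phi> x \<in> \<real>\<^sub>\<ge>\<^sub>0" "of_real (nrm x) + \<phi> x \<in> \<real>\<^sub>\<ge>\<^sub>0"
    using x by (simp_all add: state_diff[OF \<phi>] stateD(1,2,4)[OF \<phi>])
  then have "Im (\<phi> x) = 0" "\<bar>Re (\<phi> x)\<bar> \<le> nrm x" by (auto simp: complex_nonneg_Reals_iff)
  then show "Im (\<phi> x) = 0" "cmod (\<phi> x) \<le> nrm x" by (simp_all add: cmod_def)
qed

text \<open>The real and the imaginary part of \<open>a\<close> contribute one norm of \<open>a\<close> each.\<close>

lemma state_bound:
  assumes \<phi>: "\<phi> \<in> states A" and a: "a \<in> carrier A"
  shows "cmod (\<phi> a) \<le> 2 * nrm a"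
proof -
  have "cmod (\<phi> a) = cmod (\<phi> (re a) + \<i> * \<phi> (re ((- \<i>) \<odot> a)))"
    using a by (subst (1) re_decomp[OF a]) (simp add: stateD(1,2)[OF \<phi>])
  also have "\<dots> \<le> cmod (\<phi> (re a)) + cmod (\<phi> (re ((- \<i>) \<odot> a)))"
    using norm_triangle_ineq[of "\<phi> (re a)" "\<i> * \<phi> (re ((- \<i>) \<odot> a))"] by (simp add: norm_mult)
  also have "\<dots> \<le> nrm a + nrm ((- \<i>) \<odot> a)"
    using a by (intro add_mono order_trans[OF state_sa_bound(2)[OF \<phi>] nrm_re]) auto
  finally show ?thesis using a by simp
qed

text \<open>A real linear functional dominated by the norm and equal to \<open>1\<close> at the unit is
  positive: for positive \<open>x\<close> of norm \<open>t\<close> one has \<open>t - f x = f (t - x)\<close>, and the norm of \<open>t - x\<close> is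
  at most \<open>t\<close>. It is complexified by \<open>a \<mapsto> f (re a) - \<i> f (re (\<i> a))\<close>.\<close>

lemma state_of_functional:
  assumes f: "sublinear f" "\<And>x. x \<in> sa A \<Longrightarrow> f x \<le> nrm x" "\<And>x. x \<in> sa A \<Longrightarrow> f (\<ominus> x) = - f x"
    and f1: "f \<one> = 1"
  obtains \<phi> where "\<phi> \<in> states A" "\<And>x. x \<in> sa A \<Longrightarrow> \<phi> x = of_real (f x)"
proof -
  have fadd: "f (x \<oplus> y) = f x + f y" if "x \<in> sa A" "y \<in> sa A" for x y
  proof (rule antisym)
    have "\<ominus> x \<oplus> \<ominus> y = \<ominus> (x \<oplus> y)" using that by (simp add: minus_add)
    then have "- f (x \<oplus> y) \<le> - f x - f y"
      using sublinearD(1)[OF f(1), of "\<ominus> x" "\<ominus> y"] f(3) that by simp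
    then show "f x + f y \<le> f (x \<oplus> y)" by simp
  qed (rule sublinearD(1)[OF f(1) that])
  have fsm: "f (of_real r \<odot> x) = r * f x" if "x \<in> sa A" for r x
  proof (cases "0 \<le> r")
    case False
    have "of_real r \<odot> x = \<ominus> (of_real (- r) \<odot> x)" using that by (simp flip: smult_uminus)
    then have "f (of_real r \<odot> x) = f (\<ominus> (of_real (- r) \<odot> x))" by (simp only:)
    also have "\<dots> = - f (of_real (- r) \<odot> x)" by (rule f(3)[OF sa_smult[OF that]])
    also have "\<dots> = - (- r * f x)"
      using sublinear_smult[OF f(1) _ that, of "- r"] False by (simp only: neg_0_le_iff_le linorder_not_le less_imp_le)
    finally show ?thesis by simp
  qed (rule sublinear_smult[OF f(1) _ that])
  have f0: "f \<zero> = 0" by (rule sublinear_zero[OF f(1)])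
  define g where "g a = f (re a)" for a
  have gadd: "g (a \<oplus> b) = g a + g b" if "a \<in> carrier A" "b \<in> carrier A" for a b
    using that by (simp add: g_def re_add fadd)
  have gsm: "g (of_real r \<odot> a) = r * g a" if "a \<in> carrier A" for r a
    using that by (simp add: g_def re_smult fsm)
  define \<psi> where "\<psi> a = of_real (g a) - \<i> * of_real (g (\<i> \<odot> a))" for a
  have \<psi>add: "\<psi> (a \<oplus> b) = \<psi> a + \<psi> b" if "a \<in> carrier A" "b \<in> carrier A" for a b
    using that by (simp add: \<psi>_def gadd smult_add_r algebra_simps)
  have \<psi>sm: "\<psi> (c \<odot> a) = c * \<psi> a" if a: "a \<in> carrier A" for c a
  proof -
    have c: "c = of_real (Re c) + of_real (Im c) * \<i>" by (simp add: complex_eq_iff)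
    have "c \<odot> a = of_real (Re c) \<odot> a \<oplus> of_real (Im c) \<odot> (\<i> \<odot> a)"
      using a by (subst c) (simp only: smult_add_l smult_smult)
    moreover have "\<i> \<odot> (c \<odot> a) = of_real (Re c) \<odot> (\<i> \<odot> a) \<oplus> of_real (- Im c) \<odot> a"
    proof -
      have "\<i> * c = of_real (Re c) * \<i> + of_real (- Im c)" by (simp add: complex_eq_iff)
      then show ?thesis using a by (simp only: smult_smult) (simp only: smult_add_l smult_smult)
    qed
    ultimately have "g (c \<odot> a) = Re c * g a + Im c * g (\<i> \<odot> a)"
      and "g (\<i> \<odot> (c \<odot> a)) = Re c * g (\<i> \<odot> a) + (- Im c) * g a"
      using a by (simp_all only: gadd gsm smult_closed)
    then show ?thesis unfolding \<psi>_def by (simp add: complex_eq_iff algebra_simps)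
  qed
  have \<psi>f: "\<psi> x = of_real (f x)" if "x \<in> sa A" for x
    using that by (simp add: \<psi>_def g_def re_of_sa re_i_sa f0)
  have fpos: "0 \<le> f x" if x: "x \<in> pos" for x
  proof -
    let ?t = "of_real (nrm x) \<odot> \<one>"
    have "nrm x + f (\<ominus> x) = f (?t \<ominus> x)"
      using x fadd[of ?t "\<ominus> x"] fsm[of \<one> "nrm x"] f1 by (simp add: minus_eq)
    also have "\<dots> \<le> nrm (?t \<ominus> x)" using x by (intro f(2)) simp
    also have "\<dots> \<le> nrm x" by (rule pos_nearD[OF x order_refl])
    finally show ?thesis using f(3)[of x] x by simp
  qed
  have "restrict \<psi> (carrier A) \<in> states A"
    using \<psi>add \<psi>sm \<psi>f[OF sa_adj_mult] fpos[OF adj_mult_pos] \<psi>f[of \<one>] f1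
    by (simp add: states_def)
  then show thesis using that[of "restrict \<psi> (carrier A)"] \<psi>f by simp
qed

text \<open>The functional \<open>p y\<close>, the infimum of the norm of \<open>t + y\<close> minus \<open>t\<close> over \<open>t \<ge> 0\<close>, is the
  largest spectral value of \<open>y\<close>. One of \<open>p x\<close> and \<open>p (- x)\<close> is the norm of \<open>x\<close>: otherwise both
  \<open>r - x\<close> and \<open>r + x\<close> would be positive for some \<open>r\<close> below the norm, contradicting
  \<open>pos_imp_nrm_le\<close>. A linear functional below \<open>p\<close> that touches \<open>p\<close> at \<open>x\<close> or \<open>- x\<close> is therefore
  norming, and it takes the value \<open>1\<close> at the unit because \<open>p (- 1) \<le> - 1\<close>.\<close>

lemma norming_state:
  assumes x: "x \<in> sa A"
  obtains \<phi> where "\<phi> \<in> states A" "cmod (\<phi> x) = nrm x"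
proof -
  define h where "h t y = nrm (of_real t \<odot> \<one> \<oplus> y) - t" for t y
  define p where "p y = (INF t\<in>{0..}. h t y)" for y
  have lb: "- nrm y \<le> h t y" if "0 \<le> t" "y \<in> sa A" for t y
  proof -
    have c: "y \<in> carrier A" "of_real t \<odot> \<one> \<in> carrier A" using that by auto
    have "of_real t \<odot> \<one> \<oplus> y \<oplus> \<ominus> y = of_real t \<odot> \<one>" using c by algebra
    then show ?thesis using nrm_add[of "of_real t \<odot> \<one> \<oplus> y" "\<ominus> y"] that by (simp add: h_def)
  qed
  have bdd: "bdd_below ((\<lambda>t. h t y) ` {0..})" if "y \<in> sa A" for y
    using lb that by (intro bdd_belowI2[where m = "- nrm y"]) auto
  have low: "p y \<le> h t y" if "y \<in> sa A" "0 \<le> t" for y t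
    unfolding p_def using cINF_lower[OF bdd[OF that(1)], of t] that by simp
  have p: "sublinear p"
    unfolding p_def
  proof (rule sublinear_INF)
    fix s t :: real and y z assume s: "s \<in> {0..}" and t: "t \<in> {0..}" and y: "y \<in> sa A" and z: "z \<in> sa A"
    have c: "y \<in> carrier A" "z \<in> carrier A" "of_real s \<odot> \<one> \<in> carrier A" "of_real t \<odot> \<one> \<in> carrier A"
      using y z by auto
    have "of_real (s + t) \<odot> \<one> \<oplus> (y \<oplus> z) = of_real s \<odot> \<one> \<oplus> of_real t \<odot> \<one> \<oplus> (y \<oplus> z)"
      by (simp add: smult_add_l)
    also have "\<dots> = (of_real s \<odot> \<one> \<oplus> y) \<oplus> (of_real t \<odot> \<one> \<oplus> z)" using c by algebra
    finally have "h (s + t) (y \<oplus> z) \<le> h s y + h t z"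
      using nrm_add[of "of_real s \<odot> \<one> \<oplus> y" "of_real t \<odot> \<one> \<oplus> z"] y z by (simp add: h_def)
    then show "\<exists>k\<in>{0..}. h k (y \<oplus> z) \<le> h s y + h t z" using s t by (intro bexI[of _ "s + t"]) auto
  next
    fix t r :: real and y assume t: "t \<in> {0..}" and r: "0 < r" and y: "y \<in> sa A"
    have "of_real (r * t) \<odot> \<one> \<oplus> of_real r \<odot> y = of_real r \<odot> (of_real t \<odot> \<one> \<oplus> y)"
      using y by (simp add: smult_add_r smult_smult)
    then have "h (r * t) (of_real r \<odot> y) = r * h t y" using r y by (simp add: h_def algebra_simps)
    then show "\<exists>k\<in>{0..}. h k (of_real r \<odot> y) \<le> r * h t y"
      using t r by (intro bexI[of _ "r * t"]) auto
  qed (use bdd in auto)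
  have p_nrm: "p y \<le> nrm y" if "y \<in> sa A" for y using low[OF that, of 0] that by (simp add: h_def)
  have "nrm x \<le> p x \<or> nrm x \<le> p (\<ominus> x)"
  proof (rule ccontr)
    assume "\<not> ?thesis"
    then have less: "p x < nrm x" "p (\<ominus> x) < nrm x" by auto
    then obtain t where t: "0 \<le> t" "h t x < nrm x"
      unfolding p_def using x bdd by (subst (asm) cINF_less_iff) auto
    obtain s where s: "0 \<le> s" "h s (\<ominus> x) < nrm x"
      using less(2) unfolding p_def using x bdd by (subst (asm) cINF_less_iff) auto
    have "x \<noteq> \<zero>" using less(1) sublinear_zero[OF p] by auto
    then have nx: "0 < nrm x" using x nrm_ge0[of x] nrm_eq0[of x] by (simp add: less_le)
    define r where "r = max 0 (max (h t x) (h s (\<ominus> x)))"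
    have r: "0 \<le> r" "r < nrm x" "h t x \<le> r" "h s (\<ominus> x) \<le> r" using s t nx by (auto simp: r_def)
    have c: "x \<in> carrier A" "of_real r \<odot> \<one> \<in> carrier A" "of_real t \<odot> \<one> \<in> carrier A"
      "of_real s \<odot> \<one> \<in> carrier A" using x by auto
    have "of_real (t + r) \<odot> \<one> \<ominus> (of_real r \<odot> \<one> \<ominus> x)
        = of_real t \<odot> \<one> \<oplus> of_real r \<odot> \<one> \<ominus> (of_real r \<odot> \<one> \<ominus> x)" by (simp add: smult_add_l)
    also have "\<dots> = of_real t \<odot> \<one> \<oplus> x" using c by algebra
    finally have "of_real r \<odot> \<one> \<ominus> x \<in> pos"
      using r x by (intro pos_near[where t = "t + r"]) (auto simp: h_def)
    moreover have "of_real (s + r) \<odot> \<one> \<ominus> (of_real r \<odot> \<one> \<oplus> x)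
        = of_real s \<odot> \<one> \<oplus> of_real r \<odot> \<one> \<ominus> (of_real r \<odot> \<one> \<oplus> x)" by (simp add: smult_add_l)
    then have "of_real (s + r) \<odot> \<one> \<ominus> (of_real r \<odot> \<one> \<oplus> x) = of_real s \<odot> \<one> \<oplus> \<ominus> x"
      using c by algebra
    then have "of_real r \<odot> \<one> \<oplus> x \<in> pos"
      using r x by (intro pos_near[where t = "s + r"]) (auto simp: h_def)
    ultimately have "nrm x \<le> \<bar>r\<bar>" by (rule pos_imp_nrm_le[OF x])
    then show False using r by simp
  qed
  then obtain y where y: "y \<in> sa A" "nrm x \<le> p y" "y = x \<or> y = \<ominus> x"
    using x sa_neg[OF x] by metis
  obtain g where g: "sublinear g" "\<And>z. z \<in> sa A \<Longrightarrow> g z \<le> p z" "g (\<ominus> y) \<le> - p y"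
    using sublinear_through[OF p y(1)] by metis
  obtain f where f: "sublinear f" "\<And>z. z \<in> sa A \<Longrightarrow> f z \<le> g z" "\<And>z. z \<in> sa A \<Longrightarrow> f (\<ominus> z) = - f z"
    using linear_below_sublinear[OF g(1)] by metis
  have fp: "f z \<le> p z" if "z \<in> sa A" for z using f(2)[OF that] g(2)[OF that] by simp
  then have fn: "f z \<le> nrm z" if "z \<in> sa A" for z using p_nrm[OF that] that by force
  have "f (\<ominus> \<one>) \<le> - 1" using fp[of "\<ominus> \<one>"] low[of "\<ominus> \<one>" 1] by (simp add: h_def r_neg)
  then have f1: "f \<one> = 1" using fn[of \<one>] f(3)[of \<one>] by simp
  obtain \<phi> where \<phi>: "\<phi> \<in> states A" "\<And>z. z \<in> sa A \<Longrightarrow> \<phi> z = of_real (f z)"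
    using state_of_functional[OF f(1) fn f(3) f1] by metis
  have "f (\<ominus> y) \<le> - p y" using f(2)[of "\<ominus> y"] g(3) y(1) by simp
  then have "nrm x \<le> f y" using f(3)[OF y(1)] y(2) by simp
  moreover have "\<bar>f y\<bar> = cmod (\<phi> x)" using y(3) \<phi>(2)[OF x] f(3)[OF x] by auto
  ultimately show thesis using that[OF \<phi>(1)] state_sa_bound(2)[OF \<phi>(1) x] by simp
qed

text \<open>The Banach-Alaoglu argument: the states are a closed subset of a product of discs, by
  \<open>state_bound\<close>.\<close>

lemma compact_weak_star: "compact_space (weak_star_topology A)"
proof -
  let ?X = "product_topology (\<lambda>_. euclidean :: complex topology) (carrier A)"
  have top: "topspace ?X = extensional (carrier A)" by (simp add: PiE_def)
  have proj: "continuous_map ?X euclidean (\<lambda>\<phi>. \<phi> a)" if "a \<in> carrier A" for a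
    using continuous_map_product_projection[OF that, of "\<lambda>_. euclidean"] by simp
  have cm: "continuous_map ?X euclidean (\<lambda>\<phi>. c * \<phi> a + d * \<phi> b)" if "a \<in> carrier A" "b \<in> carrier A" for a b c d
  proof -
    have "continuous_map ?X euclidean ((\<lambda>w. e * w) \<circ> (\<lambda>\<phi>. \<phi> x))" if "x \<in> carrier A" for e x
      by (rule continuous_map_compose[OF proj[OF that]]) (auto intro!: continuous_intros)
    from continuous_map_add[OF this[OF that(1), of c] this[OF that(2), of d]]
    show ?thesis by (simp add: o_def)
  qed
  have eq: "closedin ?X {\<phi> \<in> topspace ?X. \<phi> z = c * \<phi> a + d * \<phi> b}"
    if "z \<in> carrier A" "a \<in> carrier A" "b \<in> carrier A" for z a b c d
    by (rule closedin_continuous_maps_eq[OF _ proj cm]) (use that in auto)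
  let ?S1 = "{\<phi> \<in> topspace ?X. \<forall>(a, b)\<in>carrier A \<times> carrier A. \<phi> (a \<oplus> b) = 1 * \<phi> a + 1 * \<phi> b}"
    and ?S2 = "{\<phi> \<in> topspace ?X. \<forall>(c, a)\<in>UNIV \<times> carrier A. \<phi> (c \<odot> a) = c * \<phi> a + 0 * \<phi> a}"
    and ?S3 = "{\<phi> \<in> topspace ?X. \<forall>a\<in>carrier A. \<phi> (adj a \<otimes> a) \<in> \<real>\<^sub>\<ge>\<^sub>0}"
    and ?S4 = "{\<phi> \<in> topspace ?X. \<phi> \<one> \<in> {1}}"
  have "closedin ?X ?S1"
  proof (rule closedin_Collect_ball)
    fix i assume "i \<in> carrier A \<times> carrier A"
    then show "closedin ?X {\<phi> \<in> topspace ?X. case i of (a, b) \<Rightarrow> \<phi> (a \<oplus> b) = 1 * \<phi> a + 1 * \<phi> b}"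
      using eq[of "fst i \<oplus> snd i" "fst i" "snd i" 1 1] by (auto simp: case_prod_beta)
  qed
  moreover have "closedin ?X ?S2"
  proof (rule closedin_Collect_ball)
    fix i :: "complex \<times> 'a" assume "i \<in> UNIV \<times> carrier A"
    then show "closedin ?X {\<phi> \<in> topspace ?X. case i of (c, a) \<Rightarrow> \<phi> (c \<odot> a) = c * \<phi> a + 0 * \<phi> a}"
      using eq[of "fst i \<odot> snd i" "snd i" "snd i" "fst i" 0] by (auto simp: case_prod_beta)
  qed
  moreover have "closedin ?X ?S3"
    by (rule closedin_Collect_ball, rule closedin_continuous_map_preimage[OF proj]) auto
  moreover have "closedin ?X ?S4"
    by (rule closedin_continuous_map_preimage[OF proj]) auto
  moreover have "states A = ?S1 \<inter> ?S2 \<inter> ?S3 \<inter> ?S4"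
    unfolding states_def top by auto
  ultimately have closed: "closedin ?X (states A)" by (simp only: closedin_Int)
  have "compactin ?X (PiE (carrier A) (\<lambda>a. cball 0 (2 * nrm a)))"
    by (simp add: compactin_PiE)
  moreover have "states A \<subseteq> PiE (carrier A) (\<lambda>a. cball 0 (2 * nrm a))"
    using state_bound by (auto simp: PiE_def stateD(5))
  ultimately have "compactin ?X (states A)" using closed by (rule closed_compactin)
  then show ?thesis unfolding weak_star_topology_def by (rule compact_space_subtopology)
qed

end

section \<open>Contractivity of *-homomorphisms\<close>

lemma star_homD:
  assumes "h \<in> star_hom A B"
  shows "a \<in> carrier A \<Longrightarrow> h a \<in> carrier B"
    and "a \<in> carrier A \<Longrightarrow> b \<in> carrier A \<Longrightarrow> h (a \<oplus>\<^bsub>A\<^esub> b) = h a \<oplus>\<^bsub>B\<^esub> h b"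
    and "a \<in> carrier A \<Longrightarrow> b \<in> carrier A \<Longrightarrow> h (a \<otimes>\<^bsub>A\<^esub> b) = h a \<otimes>\<^bsub>B\<^esub> h b"
    and "h \<one>\<^bsub>A\<^esub> = \<one>\<^bsub>B\<^esub>"
    and "a \<in> carrier A \<Longrightarrow> h (c \<odot>\<^bsub>A\<^esub> a) = c \<odot>\<^bsub>B\<^esub> h a"
    and "a \<in> carrier A \<Longrightarrow> h (star A a) = star B (h a)"
  using assms by (auto simp: star_hom_def ring_hom_def)

text \<open>For self-adjoint elements the bound is the positivity of \<open>r - x\<close> and \<open>r + x\<close>, which a
  *-homomorphism preserves; the C*-identity does the rest.\<close>

lemma star_hom_contractive:
  assumes "cstar A" "cstar B" "h \<in> star_hom A B" "a \<in> carrier A"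
  shows "cnorm B (h a) \<le> cnorm A a"
proof -
  interpret A: cstar A by fact
  interpret B: cstar B by fact
  note h = star_homD[OF assms(3)]
  have hsa: "h x \<in> sa B" if "x \<in> sa A" for x
    using that h(6)[of x] by (intro B.saI) (simp_all add: h(1) A.saD(2))
  have hpos: "h x \<in> B.pos" if "x \<in> A.pos" for x
    using that by (elim A.posE) (simp add: h(3) hsa B.pos_squareI)
  have hdiff: "h (x \<ominus>\<^bsub>A\<^esub> y) = h x \<ominus>\<^bsub>B\<^esub> h y" if "x \<in> carrier A" "y \<in> carrier A" for x y
    using that by (simp add: A.minus_eq B.minus_eq A.neg_smult B.neg_smult h(1,2,5))
  have sa_le: "cnorm B (h x) \<le> cnorm A x" if x: "x \<in> sa A" for x
  proof -
    let ?r = "complex_of_real (cnorm A x) \<odot>\<^bsub>A\<^esub> \<one>\<^bsub>A\<^esub>"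
    have "h (?r \<ominus>\<^bsub>A\<^esub> x) \<in> B.pos" "h (?r \<oplus>\<^bsub>A\<^esub> x) \<in> B.pos"
      using A.nrm_le_imp_pos[OF x order_refl] hpos by auto
    then have "cnorm B (h x) \<le> \<bar>cnorm A x\<bar>"
      using x by (intro B.pos_imp_nrm_le[OF hsa[OF x]]) (simp_all add: hdiff h(2,4,5))
    then show ?thesis using x by simp
  qed
  have "(cnorm B (h a))\<^sup>2 = cnorm B (h (star A a \<otimes>\<^bsub>A\<^esub> a))"
    using B.nrm_adj_mult[of "h a"] assms(4) by (simp add: h(1,3,6))
  also have "\<dots> \<le> (cnorm A a)\<^sup>2"
    using sa_le[OF A.sa_adj_mult[OF assms(4)]] A.nrm_adj_mult[OF assms(4)] by simp
  finally show ?thesis using assms(4) by (simp add: h(1) power2_le_iff_abs_le)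
qed

context cstar begin

section \<open>Midpoint convexity\<close>

text \<open>A closed set that contains the midpoints of its points is convex, so midpoints stand in
  for all convex combinations. Means over lists are written as iterated midpoints
  \<open>foldr mid xs y\<close>, which have dyadic weights.\<close>

definition mid :: "'a \<Rightarrow> 'a \<Rightarrow> 'a" where
  "mid x y = (1/2) \<odot> (x \<oplus> y)"

definition midconvex :: "'a set \<Rightarrow> bool" where
  "midconvex C \<longleftrightarrow> C \<subseteq> carrier A \<and> (\<forall>x\<in>C. \<forall>y\<in>C. mid x y \<in> C)"

lemma mid_closed [simp]: "x \<in> carrier A \<Longrightarrow> y \<in> carrier A \<Longrightarrow> mid x y \<in> carrier A"
  by (simp add: mid_def)

lemma nrm_mid_diff:
  assumes "x \<in> carrier A" "y \<in> carrier A" "c \<in> carrier A"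
  shows "nrm (mid x y \<ominus> c) \<le> (nrm (x \<ominus> c) + nrm (y \<ominus> c)) / 2"
proof -
  have "mid x y \<ominus> c = (1/2) \<odot> (x \<oplus> y) \<ominus> (1/2) \<odot> (c \<oplus> c)"
    using assms(3) by (simp add: mid_def smult_add_r[of c c] half_add_half)
  also have "\<dots> = (1/2) \<odot> ((x \<oplus> y) \<ominus> (c \<oplus> c))" using assms by (simp add: smult_diff_r)
  also have "(x \<oplus> y) \<ominus> (c \<oplus> c) = (x \<ominus> c) \<oplus> (y \<ominus> c)" using assms by algebra
  finally show ?thesis using nrm_add[of "x \<ominus> c" "y \<ominus> c"] assms by (simp add: norm_divide)
qed

text \<open>Complex linearity on the carrier; the values elsewhere are arbitrary.\<close>

definition linear_map :: "('a \<Rightarrow> 'a) \<Rightarrow> bool" where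
  "linear_map S \<longleftrightarrow> (\<forall>a\<in>carrier A. S a \<in> carrier A) \<and>
     (\<forall>a\<in>carrier A. \<forall>b\<in>carrier A. S (a \<oplus> b) = S a \<oplus> S b) \<and>
     (\<forall>c. \<forall>a\<in>carrier A. S (c \<odot> a) = c \<odot> S a)"

lemma linear_mapD:
  assumes "linear_map S"
  shows "a \<in> carrier A \<Longrightarrow> S a \<in> carrier A"
    and "a \<in> carrier A \<Longrightarrow> b \<in> carrier A \<Longrightarrow> S (a \<oplus> b) = S a \<oplus> S b"
    and "a \<in> carrier A \<Longrightarrow> S (c \<odot> a) = c \<odot> S a"
  using assms by (auto simp: linear_map_def)

lemma linear_map_mid: "linear_map S \<Longrightarrow> x \<in> carrier A \<Longrightarrow> y \<in> carrier A \<Longrightarrow> S (mid x y) = mid (S x) (S y)"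
  by (simp add: mid_def linear_mapD)

lemma linear_map_diff: "linear_map S \<Longrightarrow> x \<in> carrier A \<Longrightarrow> y \<in> carrier A \<Longrightarrow> S (x \<ominus> y) = S x \<ominus> S y"
  by (simp add: minus_eq neg_smult linear_mapD)

lemma midconvex_ball: "c \<in> carrier A \<Longrightarrow> midconvex {y \<in> carrier A. nrm (y \<ominus> c) \<le> r}"
proof -
  assume c: "c \<in> carrier A"
  have "nrm (mid x y \<ominus> c) \<le> r"
    if "x \<in> carrier A" "nrm (x \<ominus> c) \<le> r" "y \<in> carrier A" "nrm (y \<ominus> c) \<le> r" for x y
  proof -
    have "(nrm (x \<ominus> c) + nrm (y \<ominus> c)) / 2 \<le> (r + r) / 2"
      by (intro divide_right_mono add_mono that(2,4)) simp
    then show ?thesis using nrm_mid_diff[OF that(1,3) c] by simp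
  qed
  then show ?thesis by (simp add: midconvex_def subset_iff)
qed

lemma midconvex_vimage: "linear_map S \<Longrightarrow> midconvex C \<Longrightarrow> midconvex {y \<in> carrier A. S y \<in> C}"
  by (auto simp: midconvex_def linear_map_mid)

lemma midconvex_foldr:
  "midconvex C \<Longrightarrow> set xs \<subseteq> C \<Longrightarrow> y \<in> C \<Longrightarrow> foldr mid xs y \<in> C"
  by (induction xs) (auto simp: midconvex_def)

lemma foldr_mid_closed:
  "set xs \<subseteq> carrier A \<Longrightarrow> y \<in> carrier A \<Longrightarrow> foldr mid xs y \<in> carrier A"
  by (induction xs) auto

lemma linear_map_foldr_mid:
  "linear_map S \<Longrightarrow> set xs \<subseteq> carrier A \<Longrightarrow> y \<in> carrier A \<Longrightarrow>
    S (foldr mid xs y) = foldr mid (map S xs) (S y)"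
  by (induction xs) (auto simp: linear_map_mid foldr_mid_closed)

text \<open>One point of the list that is within \<open>w\<close> of \<open>c\<close> pulls the whole mean towards \<open>c\<close>,
  because its weight is at least \<open>(1/2) ^ length xs\<close>. This is the source of the contraction in
  \<open>net_mean_oscillation\<close>.\<close>

lemma foldr_mid_contract:
  assumes "set xs \<subseteq> carrier A" "y \<in> carrier A" "c \<in> carrier A" "0 \<le> D"
    and far: "\<And>x. x \<in> insert y (set xs) \<Longrightarrow> nrm (x \<ominus> c) \<le> w + D"
    and close: "\<exists>x\<in>set xs. nrm (x \<ominus> c) \<le> w"
  shows "nrm (foldr mid xs y \<ominus> c) \<le> w + (1 - (1/2) ^ length xs) * D"
  using assms(1) far close
proof (induction xs)
  case (Cons x xs)
  let ?m = "foldr mid xs y"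
  have c: "x \<in> carrier A" "set xs \<subseteq> carrier A" using Cons.prems by auto
  have m: "?m \<in> carrier A" by (rule foldr_mid_closed[OF c(2) assms(2)])
  have half: "nrm (foldr mid (x # xs) y \<ominus> c) \<le> (nrm (x \<ominus> c) + nrm (?m \<ominus> c)) / 2"
    using nrm_mid_diff[OF c(1) m assms(3)] by simp
  show ?case
  proof (cases "nrm (x \<ominus> c) \<le> w")
    case True
    have "?m \<in> {z \<in> carrier A. nrm (z \<ominus> c) \<le> w + D}"
      by (rule midconvex_foldr[OF midconvex_ball[OF assms(3)]]) (use Cons.prems c assms in auto)
    then have "nrm (foldr mid (x # xs) y \<ominus> c) \<le> w + (1 - 1/2) * D" using half True by (simp add: field_simps)
    also have "(1 - 1/2) * D \<le> (1 - (1/2) ^ length (x # xs)) * D"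
      using assms(4) power_le_one[of "1/2::real" "length xs"] by (intro mult_right_mono) auto
    finally show ?thesis by simp
  next
    case False
    then have "\<exists>x\<in>set xs. nrm (x \<ominus> c) \<le> w" using Cons.prems(3) by auto
    then have "nrm (?m \<ominus> c) \<le> w + (1 - (1/2) ^ length xs) * D"
      using Cons.prems c by (intro Cons.IH) auto
    moreover have "nrm (x \<ominus> c) \<le> w + D" using Cons.prems(2) by simp
    ultimately have "nrm (foldr mid (x # xs) y \<ominus> c) \<le> ((w + D) + (w + (1 - (1/2) ^ length xs) * D)) / 2"
      using half by simp
    also have "\<dots> = w + (1 - (1/2) ^ length (x # xs)) * D"
      by (simp add: left_diff_distrib add_divide_distrib diff_divide_distrib)
    finally show ?thesis .
  qed
qed simp

end

section \<open>Actions of compact groups\<close>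

locale compact_action = cstar A
  for A :: "'a cstar_algebra" (structure) +
  fixes G :: "('g, 'm) monoid_scheme" and T :: "'g topology" and len :: "'g \<Rightarrow> real"
    and \<alpha> :: "'g \<Rightarrow> 'a \<Rightarrow> 'a"
  assumes compact_group: "compact_metrizable_group G T"
    and length_fun: "length_function G len" and len_cont: "continuous_map T euclideanreal len"
    and action: "strongly_continuous_action G T A \<alpha>"
begin

sublocale G: group G
  using compact_group by (simp add: compact_metrizable_group_def)

lemma topspace_T: "topspace T = carrier G" and compact_T: "compact_space T"
  and mult_cont: "continuous_map (prod_topology T T) T (\<lambda>(g, h). g \<otimes>\<^bsub>G\<^esub> h)"
  and inv_cont: "continuous_map T T (\<lambda>g. inv\<^bsub>G\<^esub> g)"
  using compact_group by (auto simp: compact_metrizable_group_def)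

lemma len_one: "len \<one>\<^bsub>G\<^esub> = 0" and len_ge0: "g \<in> carrier G \<Longrightarrow> 0 \<le> len g"
  and len_eq0: "g \<in> carrier G \<Longrightarrow> len g = 0 \<longleftrightarrow> g = \<one>\<^bsub>G\<^esub>"
  using length_fun by (auto simp: length_function_def)

lemma act_hom: "g \<in> carrier G \<Longrightarrow> \<alpha> g \<in> star_hom A A"
  and act_one: "a \<in> carrier A \<Longrightarrow> \<alpha> \<one>\<^bsub>G\<^esub> a = a"
  and act_mult: "g \<in> carrier G \<Longrightarrow> h \<in> carrier G \<Longrightarrow> a \<in> carrier A \<Longrightarrow> \<alpha> (g \<otimes>\<^bsub>G\<^esub> h) a = \<alpha> g (\<alpha> h a)"
  and act_cont: "a \<in> carrier A \<Longrightarrow> continuous_map T (norm_topology A) (\<lambda>g. \<alpha> g a)"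
  using action by (auto simp: strongly_continuous_action_def)

lemma act_closed [simp]: "g \<in> carrier G \<Longrightarrow> a \<in> carrier A \<Longrightarrow> \<alpha> g a \<in> carrier A"
  using star_homD(1)[OF act_hom] by blast

lemma act_linear: "g \<in> carrier G \<Longrightarrow> linear_map (\<alpha> g)"
  using star_homD[OF act_hom, of g] by (auto simp: linear_map_def)

lemma act_sa: "g \<in> carrier G \<Longrightarrow> x \<in> sa A \<Longrightarrow> \<alpha> g x \<in> sa A"
  using star_homD(6)[OF act_hom, of g x] by (intro saI) (simp_all add: saD(2))

lemma act_inv: "g \<in> carrier G \<Longrightarrow> a \<in> carrier A \<Longrightarrow> \<alpha> (inv\<^bsub>G\<^esub> g) (\<alpha> g a) = a"
  by (simp add: act_one flip: act_mult)

lemma act_nrm [simp]: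
  assumes "g \<in> carrier G" "a \<in> carrier A" shows "nrm (\<alpha> g a) = nrm a"
proof (rule antisym)
  have le: "nrm (\<alpha> h b) \<le> nrm b" if "h \<in> carrier G" "b \<in> carrier A" for h b
    by (rule star_hom_contractive[OF cstar_axioms cstar_axioms act_hom[OF that(1)] that(2)])
  show "nrm (\<alpha> g a) \<le> nrm a" by (rule le[OF assms])
  show "nrm a \<le> nrm (\<alpha> g a)" using le[of "inv\<^bsub>G\<^esub> g" "\<alpha> g a"] assms by (simp add: act_inv)
qed

lemma act_diff: "g \<in> carrier G \<Longrightarrow> a \<in> carrier A \<Longrightarrow> b \<in> carrier A \<Longrightarrow> \<alpha> g (a \<ominus> b) = \<alpha> g a \<ominus> \<alpha> g b"
  by (rule linear_map_diff[OF act_linear])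

lemma nrm_act_diff:
  assumes "g \<in> carrier G" "h \<in> carrier G" "a \<in> carrier A"
  shows "nrm (\<alpha> g a \<ominus> \<alpha> h a) = nrm (\<alpha> (inv\<^bsub>G\<^esub> g \<otimes>\<^bsub>G\<^esub> h) a \<ominus> a)"
proof -
  have "\<alpha> h a = \<alpha> g (\<alpha> (inv\<^bsub>G\<^esub> g \<otimes>\<^bsub>G\<^esub> h) a)"
    using assms by (simp add: G.m_assoc[symmetric] flip: act_mult)
  then have "\<alpha> g a \<ominus> \<alpha> h a = \<alpha> g (a \<ominus> \<alpha> (inv\<^bsub>G\<^esub> g \<otimes>\<^bsub>G\<^esub> h) a)"
    using assms by (simp add: act_diff)
  then show ?thesis using assms nrm_diff_commute[of a "\<alpha> (inv\<^bsub>G\<^esub> g \<otimes>\<^bsub>G\<^esub> h) a"] by simp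
qed

text \<open>Length balls form a neighbourhood base at the identity: off an open neighbourhood of
  the identity the continuous function \<open>len\<close> has a positive minimum, by compactness.\<close>

lemma act_modulus:
  assumes a: "a \<in> carrier A" and e: "0 < e"
  obtains d where "0 < d" "\<And>k. k \<in> carrier G \<Longrightarrow> len k \<le> d \<Longrightarrow> nrm (\<alpha> k a \<ominus> a) \<le> e"
proof -
  define U where "U = {k \<in> topspace T. \<alpha> k a \<in> metric.mball a e}"
  have "openin T U" unfolding U_def
    by (rule openin_continuous_map_preimage[OF act_cont[OF a]]) (simp add: norm_topology_def)
  then have "closedin T (topspace T - U)" by blast
  then have K: "compactin T (topspace T - U)" using compact_T closedin_compact_space by blast
  have U: "nrm (\<alpha> k a \<ominus> a) \<le> e" if "k \<in> U" for k
    using that a nrm_diff_commute[of "\<alpha> k a" a] by (auto simp: U_def topspace_T cdist_eq)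
  show thesis
  proof (cases "topspace T - U = {}")
    case True
    then show thesis using U that[of 1] by (auto simp: topspace_T)
  next
    case False
    have "compact (len ` (topspace T - U))"
      using image_compactin[OF K len_cont] by simp
    then obtain k where k: "k \<in> topspace T - U" "\<And>h. h \<in> topspace T - U \<Longrightarrow> len k \<le> len h"
      using compact_attains_inf[of "len ` (topspace T - U)"] False by auto
    have "\<one>\<^bsub>G\<^esub> \<in> U" using a e by (simp add: U_def topspace_T act_one cdist_def minus_eq r_neg)
    then have "k \<noteq> \<one>\<^bsub>G\<^esub>" using k by auto
    then have pos: "0 < len k" using k(1) len_ge0[of k] len_eq0[of k] by (auto simp: topspace_T less_le)
    show thesis
    proof (rule that[of "len k / 2"])
      fix h assume "h \<in> carrier G" "len h \<le> len k / 2"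
      then show "nrm (\<alpha> h a \<ominus> a) \<le> e" using k(2)[of h] pos U by (force simp: topspace_T)
    qed (use pos in simp)
  qed
qed

text \<open>Each \<open>y \<in> H\<close> is approximated by a point of the net even after conjugation by any group
  element, so that left and right translates of the net are again nets. The distance
  \<open>len (inv g \<otimes> h)\<close> is only left invariant; uniformity over conjugations comes from the tube
  lemma.\<close>

lemma closed_subgroup_finite_net:
  assumes H: "closed_subgroup G T H" and d: "0 < d"
  obtains hs where "set hs \<subseteq> H"
    "\<And>y. y \<in> H \<Longrightarrow> \<exists>h\<in>set hs. \<forall>g\<in>carrier G. len (inv\<^bsub>G\<^esub> g \<otimes>\<^bsub>G\<^esub> (inv\<^bsub>G\<^esub> h \<otimes>\<^bsub>G\<^esub> y) \<otimes>\<^bsub>G\<^esub> g) \<le> d"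
proof -
  have Hc: "H \<subseteq> carrier G" and Hcl: "closedin T H"
    using H subgroup.subset by (auto simp: closed_subgroup_def)
  have mult: "continuous_map X T (\<lambda>x. f x \<otimes>\<^bsub>G\<^esub> g x)" if "continuous_map X T f" "continuous_map X T g"
    for X :: "'x topology" and f g
  proof -
    have "continuous_map X T ((\<lambda>(g, h). g \<otimes>\<^bsub>G\<^esub> h) \<circ> (\<lambda>x. (f x, g x)))"
      by (rule continuous_map_compose[OF continuous_map_pairedI[OF that] mult_cont])
    then show ?thesis by (simp add: o_def)
  qed
  define W where "W = {p \<in> topspace (prod_topology T T).
    len (inv\<^bsub>G\<^esub> (snd p) \<otimes>\<^bsub>G\<^esub> fst p \<otimes>\<^bsub>G\<^esub> snd p) \<in> {..<d}}"
  have "continuous_map (prod_topology T T) T (\<lambda>p. inv\<^bsub>G\<^esub> (snd p))"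
    using continuous_map_compose[OF continuous_map_snd inv_cont] by (simp add: o_def)
  then have "continuous_map (prod_topology T T) T (\<lambda>p. inv\<^bsub>G\<^esub> (snd p) \<otimes>\<^bsub>G\<^esub> fst p \<otimes>\<^bsub>G\<^esub> snd p)"
    by (intro mult continuous_map_fst continuous_map_snd)
  from continuous_map_compose[OF this len_cont]
  have "openin (prod_topology T T) W"
    unfolding W_def by (intro openin_continuous_map_preimage[where Y = euclideanreal]) (simp_all add: o_def)
  moreover have "compactin T (carrier G)" using compact_T by (simp add: compact_space_def topspace_T)
  moreover have "{\<one>\<^bsub>G\<^esub>} \<times> carrier G \<subseteq> W"
    using d by (auto simp: W_def topspace_T len_one)
  ultimately obtain U V where U: "openin T U" "\<one>\<^bsub>G\<^esub> \<in> U" "carrier G \<subseteq> V" "U \<times> V \<subseteq> W"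
    using tube_lemma_right[of T T W "carrier G" "\<one>\<^bsub>G\<^esub>"] by (auto simp: topspace_T)
  define N where "N h = {y \<in> topspace T. inv\<^bsub>G\<^esub> h \<otimes>\<^bsub>G\<^esub> y \<in> U}" for h
  have "openin T (N h)" if "h \<in> H" for h
  proof -
    have "continuous_map T T (\<lambda>y. inv\<^bsub>G\<^esub> h \<otimes>\<^bsub>G\<^esub> y)"
      by (intro mult) (use that Hc in \<open>auto simp: topspace_T\<close>)
    then show ?thesis unfolding N_def using U(1) by (rule openin_continuous_map_preimage)
  qed
  moreover have "H \<subseteq> \<Union> (N ` H)"
  proof
    fix h assume "h \<in> H"
    then show "h \<in> \<Union> (N ` H)"
      using subsetD[OF Hc] U(2) by (intro UnionI[of "N h"]) (simp_all add: N_def topspace_T)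
  qed
  moreover have "compactin T H" using Hcl compact_T closedin_compact_space by blast
  ultimately obtain F where F: "finite F" "F \<subseteq> N ` H" "H \<subseteq> \<Union> F"
    using compactinD[of T H "N ` H"] by auto
  then obtain K where K: "finite K" "K \<subseteq> H" "F = N ` K" by (meson finite_subset_image)
  obtain hs where hs: "set hs = K" using finite_list[OF K(1)] by blast
  show thesis
  proof (rule that[of hs])
    fix y assume y: "y \<in> H"
    then obtain h where h: "h \<in> K" "y \<in> N h" using F K by auto
    have "len (inv\<^bsub>G\<^esub> g \<otimes>\<^bsub>G\<^esub> (inv\<^bsub>G\<^esub> h \<otimes>\<^bsub>G\<^esub> y) \<otimes>\<^bsub>G\<^esub> g) \<le> d" if "g \<in> carrier G" for g
      using subsetD[OF U(4), of "(inv\<^bsub>G\<^esub> h \<otimes>\<^bsub>G\<^esub> y, g)"] h that U(3) by (auto simp: N_def W_def)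
    then show "\<exists>h\<in>set hs. \<forall>g\<in>carrier G. len (inv\<^bsub>G\<^esub> g \<otimes>\<^bsub>G\<^esub> (inv\<^bsub>G\<^esub> h \<otimes>\<^bsub>G\<^esub> y) \<otimes>\<^bsub>G\<^esub> g) \<le> d"
      using h hs by blast
  qed (use K hs in simp)
qed

section \<open>Averaging operators\<close>

text \<open>Closed under composition, as iterated means are needed. By \<open>averaging_hull\<close> the value
  of such an operator at \<open>a\<close> lies in every convex set that contains the orbit of \<open>a\<close>.\<close>

inductive_set averaging :: "'g set \<Rightarrow> ('a \<Rightarrow> 'a) set" for H where
  ident: "(\<lambda>a. a) \<in> averaging H"
| act: "h \<in> H \<Longrightarrow> \<alpha> h \<in> averaging H"
| mid: "P \<in> averaging H \<Longrightarrow> Q \<in> averaging H \<Longrightarrow> (\<lambda>a. mid (P a) (Q a)) \<in> averaging H"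
| comp: "P \<in> averaging H \<Longrightarrow> Q \<in> averaging H \<Longrightarrow> (\<lambda>a. P (Q a)) \<in> averaging H"

lemma averaging_linear:
  assumes "H \<subseteq> carrier G" "P \<in> averaging H" shows "linear_map P"
  using assms(2)
proof induction
  case (act h)
  then show ?case using act_linear assms(1) by auto
next
  case (mid P Q)
  then have c: "P a \<in> carrier A" "Q a \<in> carrier A" if "a \<in> carrier A" for a
    using that by (auto dest: linear_mapD(1))
  show ?case
    using mid.IH c by (auto simp: linear_map_def mid_def smult_add_r smult_smult mult.commute a_ac)
qed (auto simp: linear_map_def)

lemma averaging_hull:
  assumes H: "subgroup H G" and P: "P \<in> averaging H"
  shows "midconvex C \<Longrightarrow> a \<in> carrier A \<Longrightarrow> (\<And>h. h \<in> H \<Longrightarrow> \<alpha> h a \<in> C) \<Longrightarrow> P a \<in> C"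
  using P
proof (induction arbitrary: C a)
  case ident
  then show ?case using subgroup.one_closed[OF H] act_one[of a] by metis
next
  case (mid P Q)
  have "P a \<in> C" "Q a \<in> C" using mid.IH mid.prems by blast+
  then show ?case using mid.prems(1) by (auto simp: midconvex_def)
next
  case (comp P Q)
  have Hc: "H \<subseteq> carrier G" by (rule subgroup.subset[OF H])
  show ?case
  proof (rule comp.IH(1)[OF comp.prems(1)])
    show Qa: "Q a \<in> carrier A"
      using linear_mapD(1)[OF averaging_linear[OF Hc comp.hyps(2)]] comp.prems(2) .
    fix h assume h: "h \<in> H"
    have "Q a \<in> {y \<in> carrier A. \<alpha> h y \<in> C}"
    proof (rule comp.IH(2))
      show "midconvex {y \<in> carrier A. \<alpha> h y \<in> C}"
        using midconvex_vimage[OF act_linear comp.prems(1)] h Hc by blast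
      fix k assume k: "k \<in> H"
      have "\<alpha> h (\<alpha> k a) = \<alpha> (h \<otimes>\<^bsub>G\<^esub> k) a" using h k Hc comp.prems(2) by (simp add: act_mult subsetD)
      then show "\<alpha> k a \<in> {y \<in> carrier A. \<alpha> h y \<in> C}"
        using comp.prems(2,3) k Hc subgroup.m_closed[OF H h k] by (auto simp: subsetD)
    qed (rule comp.prems(2))
    then show "\<alpha> h (Q a) \<in> C" by simp
  qed
qed auto

lemma averaging_funpow: "P \<in> averaging H \<Longrightarrow> P ^^ n \<in> averaging H"
proof (induction n)
  case 0
  then show ?case using averaging.ident by (simp add: id_def)
next
  case (Suc n)
  then show ?case using averaging.comp[of P H "P ^^ n"] by (simp add: o_def)
qed

text \<open>The final argument \<open>a\<close> of the fold is the term of the identity of the group.\<close>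

definition net_mean :: "'g list \<Rightarrow> 'a \<Rightarrow> 'a" where
  "net_mean hs a = foldr mid (map (\<lambda>h. \<alpha> h a) hs) a"

lemma net_mean_averaging: "set hs \<subseteq> H \<Longrightarrow> net_mean hs \<in> averaging H"
proof (induction hs)
  case Nil
  then show ?case using averaging.ident by (simp add: net_mean_def[abs_def])
next
  case (Cons h hs)
  then show ?case using averaging.mid[OF averaging.act[of h H], of "net_mean hs"]
    by (simp add: net_mean_def[abs_def])
qed

lemma averaging_nrm:
  assumes H: "subgroup H G" and P: "P \<in> averaging H" and a: "a \<in> carrier A"
  shows "nrm (P a) \<le> nrm a"
proof -
  have "P a \<in> {y \<in> carrier A. nrm (y \<ominus> \<zero>) \<le> nrm a}"
    by (rule averaging_hull[OF H P midconvex_ball a])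
       (use a subgroup.subset[OF H] in \<open>auto simp: minus_eq subsetD\<close>)
  then show ?thesis by (auto simp: minus_eq)
qed

text \<open>The mean \<open>P\<close> over a net at scale \<open>d\<close> contracts both the left oscillation, of
  \<open>g \<mapsto> \<alpha> g (P\<^sup>n a)\<close>, and the right oscillation, of \<open>g \<mapsto> P\<^sup>n (\<alpha> g a)\<close>, by a fixed factor \<open>q < 1\<close>,
  up to the modulus of continuity \<open>w\<close> of \<open>a\<close> at scale \<open>d\<close>. Indeed, a translate of the net comes
  close to any prescribed group element, so one of the averaged points is within \<open>w\<close> of the
  comparison point and \<open>foldr_mid_contract\<close> applies. The right oscillation is what makes different
  means of \<open>a\<close> comparable.\<close>

lemma net_mean_oscillation:
  fixes n :: nat
  assumes H: "subgroup H G" and hs: "set hs \<subseteq> H"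
    and net: "\<And>y. y \<in> H \<Longrightarrow> \<exists>h\<in>set hs. \<forall>g\<in>carrier G. len (inv\<^bsub>G\<^esub> g \<otimes>\<^bsub>G\<^esub> (inv\<^bsub>G\<^esub> h \<otimes>\<^bsub>G\<^esub> y) \<otimes>\<^bsub>G\<^esub> g) \<le> d"
    and a: "a \<in> carrier A"
    and modulus: "\<And>k. k \<in> carrier G \<Longrightarrow> len k \<le> d \<Longrightarrow> nrm (\<alpha> k a \<ominus> a) \<le> w"
    and w: "0 \<le> w"
  defines "P \<equiv> net_mean hs" and "q \<equiv> 1 - (1/2) ^ length hs"
  shows "g \<in> H \<Longrightarrow> z \<in> H \<Longrightarrow> nrm (\<alpha> g ((P ^^ n) a) \<ominus> \<alpha> z ((P ^^ n) a)) \<le> w + q ^ n * (2 * nrm a)"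
    and "g \<in> H \<Longrightarrow> z \<in> H \<Longrightarrow> nrm ((P ^^ n) (\<alpha> g a) \<ominus> (P ^^ n) (\<alpha> z a)) \<le> w + q ^ n * (2 * nrm a)"
proof -
  have Hc: "H \<subseteq> carrier G" by (rule subgroup.subset[OF H])
  have Hc' [simp]: "h \<in> H \<Longrightarrow> h \<in> carrier G" for h using Hc by blast
  have hsc: "h \<in> set hs \<Longrightarrow> h \<in> H" for h using hs by blast
  note Hm [simp] = subgroup.m_closed[OF H] and Hi [simp] = subgroup.m_inv_closed[OF H]
  have q0: "0 \<le> q" by (simp add: q_def power_le_one)
  have P: "P \<in> averaging H" unfolding P_def by (rule net_mean_averaging[OF hs])
  have Pn: "P ^^ n \<in> averaging H" for n by (rule averaging_funpow[OF P])
  note Plin = averaging_linear[OF Hc P] and Pnlin = averaging_linear[OF Hc Pn]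
  have Pc [simp]: "P b \<in> carrier A" if "b \<in> carrier A" for b using linear_mapD(1)[OF Plin that] .
  have Pnc [simp]: "(P ^^ n) b \<in> carrier A" if "b \<in> carrier A" for n b using linear_mapD(1)[OF Pnlin that] .
  \<comment> \<open>The estimate must hold after translating by every \<open>x \<in> H\<close>, since it is applied to means of the points \<open>\<alpha> x a\<close>.\<close>
  have closeL: "\<exists>h\<in>set hs. \<forall>x\<in>H. nrm (\<alpha> (g \<otimes>\<^bsub>G\<^esub> h \<otimes>\<^bsub>G\<^esub> x) a \<ominus> \<alpha> (z \<otimes>\<^bsub>G\<^esub> x) a) \<le> w"
    if g: "g \<in> H" and z: "z \<in> H" for g z
  proof -
    obtain h where h: "h \<in> set hs"
      "\<And>x. x \<in> carrier G \<Longrightarrow> len (inv\<^bsub>G\<^esub> x \<otimes>\<^bsub>G\<^esub> (inv\<^bsub>G\<^esub> h \<otimes>\<^bsub>G\<^esub> (inv\<^bsub>G\<^esub> g \<otimes>\<^bsub>G\<^esub> z)) \<otimes>\<^bsub>G\<^esub> x) \<le> d"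
      using net[of "inv\<^bsub>G\<^esub> g \<otimes>\<^bsub>G\<^esub> z"] g z by auto
    have hH: "h \<in> H" using h(1) hsc by simp
    have "nrm (\<alpha> (g \<otimes>\<^bsub>G\<^esub> h \<otimes>\<^bsub>G\<^esub> x) a \<ominus> \<alpha> (z \<otimes>\<^bsub>G\<^esub> x) a) \<le> w" if x: "x \<in> H" for x
    proof -
      have "inv\<^bsub>G\<^esub> (g \<otimes>\<^bsub>G\<^esub> h \<otimes>\<^bsub>G\<^esub> x) \<otimes>\<^bsub>G\<^esub> (z \<otimes>\<^bsub>G\<^esub> x)
          = inv\<^bsub>G\<^esub> x \<otimes>\<^bsub>G\<^esub> (inv\<^bsub>G\<^esub> h \<otimes>\<^bsub>G\<^esub> (inv\<^bsub>G\<^esub> g \<otimes>\<^bsub>G\<^esub> z)) \<otimes>\<^bsub>G\<^esub> x"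
        using g z x hH by (simp add: G.inv_mult_group G.m_assoc)
      then show ?thesis using nrm_act_diff[of "g \<otimes>\<^bsub>G\<^esub> h \<otimes>\<^bsub>G\<^esub> x" "z \<otimes>\<^bsub>G\<^esub> x" a] g z x hH a h(2)[of x]
        by (simp add: modulus)
    qed
    then show ?thesis using h(1) by blast
  qed
  have closeR: "\<exists>h\<in>set hs. nrm (\<alpha> (h \<otimes>\<^bsub>G\<^esub> g) a \<ominus> \<alpha> z a) \<le> w"
    if g: "g \<in> H" and z: "z \<in> H" for g z
  proof -
    obtain h where h: "h \<in> set hs"
      "\<And>x. x \<in> carrier G \<Longrightarrow> len (inv\<^bsub>G\<^esub> x \<otimes>\<^bsub>G\<^esub> (inv\<^bsub>G\<^esub> h \<otimes>\<^bsub>G\<^esub> (z \<otimes>\<^bsub>G\<^esub> inv\<^bsub>G\<^esub> g)) \<otimes>\<^bsub>G\<^esub> x) \<le> d"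
      using net[of "z \<otimes>\<^bsub>G\<^esub> inv\<^bsub>G\<^esub> g"] g z by auto
    have hH: "h \<in> H" using h(1) hsc by simp
    have "inv\<^bsub>G\<^esub> (h \<otimes>\<^bsub>G\<^esub> g) \<otimes>\<^bsub>G\<^esub> z = inv\<^bsub>G\<^esub> g \<otimes>\<^bsub>G\<^esub> (inv\<^bsub>G\<^esub> h \<otimes>\<^bsub>G\<^esub> (z \<otimes>\<^bsub>G\<^esub> inv\<^bsub>G\<^esub> g)) \<otimes>\<^bsub>G\<^esub> g"
      using g z hH by (simp add: G.inv_mult_group G.m_assoc)
    then have "nrm (\<alpha> (h \<otimes>\<^bsub>G\<^esub> g) a \<ominus> \<alpha> z a) \<le> w"
      using nrm_act_diff[of "h \<otimes>\<^bsub>G\<^esub> g" z a] g z hH a h(2)[of g] by (simp add: modulus)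
    then show ?thesis using h(1) by blast
  qed
  have L: "\<forall>g\<in>H. \<forall>z\<in>H. nrm (\<alpha> g ((P ^^ n) a) \<ominus> \<alpha> z ((P ^^ n) a)) \<le> w + q ^ n * (2 * nrm a)" for n
  proof (induction n)
    case 0
    have "nrm (\<alpha> g a \<ominus> \<alpha> z a) \<le> w + 2 * nrm a" if "g \<in> H" "z \<in> H" for g z
      using nrm_diff_le[of "\<alpha> g a" "\<alpha> z a"] that a w by simp
    then show ?case by simp
  next
    case (Suc n)
    define b where "b = (P ^^ n) a"
    define D where "D = q ^ n * (2 * nrm a)"
    have b: "b \<in> carrier A" using a by (simp add: b_def)
    have D: "0 \<le> D" using q0 a by (simp add: D_def)
    have IH: "nrm (\<alpha> g b \<ominus> \<alpha> z b) \<le> w + D" if "g \<in> H" "z \<in> H" for g z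
      using Suc that by (simp add: b_def D_def)
    have step: "nrm (\<alpha> g (P b) \<ominus> \<alpha> z b) \<le> w + q * D" if g: "g \<in> H" and z: "z \<in> H" for g z
    proof -
      let ?xs = "map (\<lambda>h. \<alpha> (g \<otimes>\<^bsub>G\<^esub> h) b) hs"
      have "\<alpha> g (P b) = foldr mid (map (\<alpha> g) (map (\<lambda>h. \<alpha> h b) hs)) (\<alpha> g b)"
        unfolding P_def net_mean_def using hsc b g
        by (intro linear_map_foldr_mid act_linear) auto
      also have "map (\<alpha> g) (map (\<lambda>h. \<alpha> h b) hs) = ?xs"
        using hsc b g by (simp add: act_mult)
      finally have e: "\<alpha> g (P b) = foldr mid ?xs (\<alpha> g b)" .
      obtain h where h: "h \<in> set hs"
        and close: "\<And>x. x \<in> H \<Longrightarrow> nrm (\<alpha> (g \<otimes>\<^bsub>G\<^esub> h \<otimes>\<^bsub>G\<^esub> x) a \<ominus> \<alpha> (z \<otimes>\<^bsub>G\<^esub> x) a) \<le> w"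
        using closeL[OF g z] by blast
      have hH: "h \<in> H" using h hsc by simp
      let ?S = "\<lambda>y. \<alpha> (g \<otimes>\<^bsub>G\<^esub> h) y \<ominus> \<alpha> z y"
      have S: "linear_map ?S"
        using act_linear[of "g \<otimes>\<^bsub>G\<^esub> h"] act_linear[of z] g z hH
        by (auto simp: linear_map_def smult_add_r smult_neg minus_eq minus_add a_ac)
      have "b \<in> {y \<in> carrier A. ?S y \<in> {v \<in> carrier A. nrm (v \<ominus> \<zero>) \<le> w}}"
        unfolding b_def
      proof (rule averaging_hull[OF H Pn midconvex_vimage[OF S midconvex_ball] a])
        fix x assume x: "x \<in> H"
        then show "\<alpha> x a \<in> {y \<in> carrier A. ?S y \<in> {v \<in> carrier A. nrm (v \<ominus> \<zero>) \<le> w}}"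
          using close[OF x] g z hH a by (simp add: act_mult minus_eq[of _ \<zero>])
      qed simp
      then have "nrm (\<alpha> (g \<otimes>\<^bsub>G\<^esub> h) b \<ominus> \<alpha> z b) \<le> w" by (auto simp: minus_eq[of _ \<zero>])
      then have "\<exists>x\<in>set ?xs. nrm (x \<ominus> \<alpha> z b) \<le> w" using h by auto
      then have "nrm (foldr mid ?xs (\<alpha> g b) \<ominus> \<alpha> z b) \<le> w + (1 - (1/2) ^ length ?xs) * D"
        using hsc b g z D IH by (intro foldr_mid_contract) auto
      then show ?thesis unfolding e by (simp add: q_def)
    qed
    have "nrm (\<alpha> g (P b) \<ominus> \<alpha> z (P b)) \<le> w + q * D" if g: "g \<in> H" and z: "z \<in> H" for g z
    proof -
      have gb: "\<alpha> g (P b) \<in> carrier A" using g b by simp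
      have "(\<lambda>y. \<alpha> z (P y)) b \<in> {y \<in> carrier A. nrm (y \<ominus> \<alpha> g (P b)) \<le> w + q * D}"
        by (rule averaging_hull[OF H averaging.comp[OF averaging.act[OF z] P] midconvex_ball[OF gb] b])
           (use step[OF g] b gb nrm_diff_commute[OF gb] in auto)
      then show ?thesis using nrm_diff_commute[OF gb] by simp
    qed
    then show ?case by (simp add: b_def D_def mult.assoc)
  qed
  have R: "\<forall>g\<in>H. \<forall>z\<in>H. nrm ((P ^^ n) (\<alpha> g a) \<ominus> (P ^^ n) (\<alpha> z a)) \<le> w + q ^ n * (2 * nrm a)" for n
  proof (induction n)
    case 0
    have "nrm (\<alpha> g a \<ominus> \<alpha> z a) \<le> w + 2 * nrm a" if "g \<in> H" "z \<in> H" for g z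
      using nrm_diff_le[of "\<alpha> g a" "\<alpha> z a"] that a w by simp
    then show ?case by simp
  next
    case (Suc n)
    let ?Q = "P ^^ n"
    define D where "D = q ^ n * (2 * nrm a)"
    have D: "0 \<le> D" using q0 a by (simp add: D_def)
    have IH: "nrm (?Q (\<alpha> g a) \<ominus> ?Q (\<alpha> z a)) \<le> w + D" if "g \<in> H" "z \<in> H" for g z
      using Suc that by (simp add: D_def)
    have step: "nrm (?Q (P (\<alpha> g a)) \<ominus> ?Q (\<alpha> z a)) \<le> w + q * D" if g: "g \<in> H" and z: "z \<in> H" for g z
    proof -
      let ?xs = "map (\<lambda>h. ?Q (\<alpha> (h \<otimes>\<^bsub>G\<^esub> g) a)) hs"
      have "?Q (P (\<alpha> g a)) = foldr mid (map ?Q (map (\<lambda>h. \<alpha> h (\<alpha> g a)) hs)) (?Q (\<alpha> g a))"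
        unfolding P_def net_mean_def using hsc a g
        by (intro linear_map_foldr_mid Pnlin[unfolded P_def net_mean_def]) auto
      also have "map ?Q (map (\<lambda>h. \<alpha> h (\<alpha> g a)) hs) = ?xs"
        using hsc a g by (simp add: act_mult)
      finally have e: "?Q (P (\<alpha> g a)) = foldr mid ?xs (?Q (\<alpha> g a))" .
      obtain h where h: "h \<in> set hs" and close: "nrm (\<alpha> (h \<otimes>\<^bsub>G\<^esub> g) a \<ominus> \<alpha> z a) \<le> w"
        using closeR[OF g z] by blast
      have hH: "h \<in> H" using h hsc by simp
      have "nrm (?Q (\<alpha> (h \<otimes>\<^bsub>G\<^esub> g) a) \<ominus> ?Q (\<alpha> z a)) = nrm (?Q (\<alpha> (h \<otimes>\<^bsub>G\<^esub> g) a \<ominus> \<alpha> z a))"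
        using g z hH a by (simp add: linear_map_diff[OF Pnlin])
      also have "\<dots> \<le> w"
        using averaging_nrm[OF H Pn, of "\<alpha> (h \<otimes>\<^bsub>G\<^esub> g) a \<ominus> \<alpha> z a" n] close g z hH a by simp
      finally have "\<exists>x\<in>set ?xs. nrm (x \<ominus> ?Q (\<alpha> z a)) \<le> w" using h by auto
      then have "nrm (foldr mid ?xs (?Q (\<alpha> g a)) \<ominus> ?Q (\<alpha> z a)) \<le> w + (1 - (1/2) ^ length ?xs) * D"
        using hsc a g z D IH by (intro foldr_mid_contract) auto
      then show ?thesis unfolding e by (simp add: q_def)
    qed
    have "nrm (?Q (P (\<alpha> g a)) \<ominus> ?Q (P (\<alpha> z a))) \<le> w + q * D" if g: "g \<in> H" and z: "z \<in> H" for g z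
    proof -
      have gb: "?Q (P (\<alpha> g a)) \<in> carrier A" using g a by simp
      have "(\<lambda>y. P (\<alpha> z y)) a \<in> {y \<in> carrier A. ?Q y \<in> {y \<in> carrier A. nrm (y \<ominus> ?Q (P (\<alpha> g a))) \<le> w + q * D}}"
        by (rule averaging_hull[OF H averaging.comp[OF P averaging.act[OF z]]
              midconvex_vimage[OF Pnlin midconvex_ball[OF gb]] a])
           (use step[OF g] a gb nrm_diff_commute[OF gb] in auto)
      then show ?thesis using nrm_diff_commute[OF gb] by simp
    qed
    then show ?case by (simp add: D_def mult.assoc funpow_swap1)
  qed
  show "g \<in> H \<Longrightarrow> z \<in> H \<Longrightarrow> nrm (\<alpha> g ((P ^^ n) a) \<ominus> \<alpha> z ((P ^^ n) a)) \<le> w + q ^ n * (2 * nrm a)"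
    using L by blast
  show "g \<in> H \<Longrightarrow> z \<in> H \<Longrightarrow> nrm ((P ^^ n) (\<alpha> g a) \<ominus> (P ^^ n) (\<alpha> z a)) \<le> w + q ^ n * (2 * nrm a)"
    using R by blast
qed

end

section \<open>Conditional expectations onto fixed points\<close>

context cstar begin

definition norm_closed :: "'a set \<Rightarrow> bool" where
  "norm_closed C \<longleftrightarrow> (\<forall>x l. norm_lim x l \<longrightarrow> (\<forall>n. x n \<in> C) \<longrightarrow> l \<in> C)"

lemma norm_closed_ball:
  assumes c: "c \<in> carrier A" shows "norm_closed {y \<in> carrier A. nrm (y \<ominus> c) \<le> r}"
  unfolding norm_closed_def
proof (intro allI impI)
  fix x l assume l: "norm_lim x l" and x: "\<forall>n. x n \<in> {y \<in> carrier A. nrm (y \<ominus> c) \<le> r}"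
  have "norm_lim (\<lambda>n. x n \<ominus> c) (l \<ominus> c)" by (intro norm_lim_diff l norm_lim_const c)
  then have "nrm (l \<ominus> c) \<le> r" by (rule norm_lim_nrm_le) (use x in simp)
  then show "l \<in> {y \<in> carrier A. nrm (y \<ominus> c) \<le> r}" using norm_limD(2)[OF l] by simp
qed

lemma norm_closed_pos: "norm_closed pos"
  unfolding norm_closed_def using pos_norm_lim by blast

lemma midconvex_pos: "midconvex pos"
  unfolding midconvex_def
proof (intro conjI ballI)
  fix x y assume "x \<in> pos" "y \<in> pos"
  then show "mid x y \<in> pos" using pos_smult[OF pos_add, of x y "1/2"] by (simp add: mid_def)
qed (use pos_carrier in blast)

end

context compact_action begin

text \<open>The \<open>k\<close>-th mean uses a net at scale \<open>1 / (k + 1)\<close> and is iterated until the contraction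
  factor of \<open>net_mean_oscillation\<close> has dropped below \<open>1 / (k + 1)\<close>. The choices depend on the
  group only, so one sequence serves all elements of the algebra, and its limit is linear.\<close>

lemma asymptotically_invariant_means:
  assumes H: "closed_subgroup G T H"
  shows "\<exists>B :: nat \<Rightarrow> 'a \<Rightarrow> 'a. (\<forall>k. B k \<in> averaging H) \<and>
    (\<forall>a\<in>carrier A. \<forall>e>0. \<exists>K. \<forall>k\<ge>K. \<forall>g\<in>H. \<forall>z\<in>H.
        nrm (\<alpha> g (B k a) \<ominus> \<alpha> z (B k a)) \<le> e \<and> nrm (B k (\<alpha> g a) \<ominus> B k (\<alpha> z a)) \<le> e)"
proof -
  have sub: "subgroup H G" using H by (simp add: closed_subgroup_def)
  let ?net = "\<lambda>k hs. set hs \<subseteq> H \<and> (\<forall>y\<in>H. \<exists>h\<in>set hs. \<forall>g\<in>carrier G.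
      len (inv\<^bsub>G\<^esub> g \<otimes>\<^bsub>G\<^esub> (inv\<^bsub>G\<^esub> h \<otimes>\<^bsub>G\<^esub> y) \<otimes>\<^bsub>G\<^esub> g) \<le> 1 / real (Suc k))"
  have "\<exists>hs. ?net k hs" for k
    by (rule closed_subgroup_finite_net[OF H, of "1 / real (Suc k)"]) (simp, blast)
  then obtain hs where hs: "\<And>k. ?net k (hs k)" by metis
  define q where "q k = 1 - (1/2::real) ^ length (hs k)" for k
  have q: "0 \<le> q k" "q k < 1" for k by (simp_all add: q_def power_le_one)
  have "\<exists>n. q k ^ n < 1 / real (Suc k)" for k using q(2)[of k] by (intro real_arch_pow_inv) simp_all
  then obtain n where n: "\<And>k. q k ^ n k < 1 / real (Suc k)" by metis
  define B where "B k = net_mean (hs k) ^^ n k" for k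
  show ?thesis
  proof (intro exI[of _ B] conjI ballI allI impI)
    show "B k \<in> averaging H" for k
      unfolding B_def by (rule averaging_funpow[OF net_mean_averaging]) (use hs in blast)
    fix a and e :: real assume a: "a \<in> carrier A" and e: "0 < e"
    obtain d where d: "0 < d" "\<And>k. k \<in> carrier G \<Longrightarrow> len k \<le> d \<Longrightarrow> nrm (\<alpha> k a \<ominus> a) \<le> e / 2"
      using act_modulus[OF a, of "e / 2"] e by auto
    obtain K where K: "max (1 / d) (4 * nrm a / e) < real K" using reals_Archimedean2 by blast
    show "\<exists>K. \<forall>k\<ge>K. \<forall>g\<in>H. \<forall>z\<in>H.
        nrm (\<alpha> g (B k a) \<ominus> \<alpha> z (B k a)) \<le> e \<and> nrm (B k (\<alpha> g a) \<ominus> B k (\<alpha> z a)) \<le> e"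
    proof (intro exI[of _ K] allI impI ballI)
      fix k g z assume k: "K \<le> k" and g: "g \<in> H" and z: "z \<in> H"
      have kK: "real K \<le> real (Suc k)" using k by simp
      have "1 / d < real (Suc k)" using K kK by linarith
      then have kd: "1 / real (Suc k) \<le> d" using d(1) by (simp add: field_simps)
      have "4 * nrm a / e < real (Suc k)" using K kK by linarith
      then have "2 * nrm a / real (Suc k) \<le> e / 2" using e by (simp add: field_simps)
      moreover have "q k ^ n k * (2 * nrm a) \<le> 1 / real (Suc k) * (2 * nrm a)"
        by (rule mult_right_mono) (use n[of k] a in simp_all)
      ultimately have bound: "e / 2 + q k ^ n k * (2 * nrm a) \<le> e" by simp
      have modulus: "nrm (\<alpha> h a \<ominus> a) \<le> e / 2"
        if "h \<in> carrier G" "len h \<le> 1 / real (Suc k)" for h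
        using d(2)[of h] that kd by simp
      have "nrm (\<alpha> g (B k a) \<ominus> \<alpha> z (B k a)) \<le> e / 2 + q k ^ n k * (2 * nrm a)"
        unfolding B_def q_def
        by (rule net_mean_oscillation(1)[OF sub _ _ a modulus _ g z]) (use hs[of k] e in auto)
      moreover have "nrm (B k (\<alpha> g a) \<ominus> B k (\<alpha> z a)) \<le> e / 2 + q k ^ n k * (2 * nrm a)"
        unfolding B_def q_def
        by (rule net_mean_oscillation(2)[OF sub _ _ a modulus _ g z]) (use hs[of k] e in auto)
      ultimately show "nrm (\<alpha> g (B k a) \<ominus> \<alpha> z (B k a)) \<le> e \<and> nrm (B k (\<alpha> g a) \<ominus> B k (\<alpha> z a)) \<le> e"
        using bound by linarith
    qed
  qed
qed

text \<open>The last clause contains all further properties: unit, positivity, contractivity and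
  the decrease of the Lip-norm are closed convex conditions.\<close>

definition conditional_expectation :: "'g set \<Rightarrow> ('a \<Rightarrow> 'a) \<Rightarrow> bool" where
  "conditional_expectation H E \<longleftrightarrow> linear_map E \<and>
     (\<forall>a\<in>carrier A. \<forall>h\<in>H. \<alpha> h (E a) = E a) \<and>
     (\<forall>C a. midconvex C \<longrightarrow> norm_closed C \<longrightarrow> a \<in> carrier A \<longrightarrow> (\<forall>h\<in>H. \<alpha> h a \<in> C) \<longrightarrow> E a \<in> C)"

text \<open>The means \<open>B k a\<close> are Cauchy: \<open>B j (B k a)\<close> is close to \<open>B k a\<close> because \<open>B k a\<close> is
  almost invariant (left oscillation), and close to \<open>B j a\<close> because \<open>B j\<close> is almost constant on
  the orbit of \<open>a\<close> (right oscillation).\<close>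

lemma conditional_expectation_exists:
  assumes H: "closed_subgroup G T H"
  shows "\<exists>E. conditional_expectation H E"
proof -
  have sub: "subgroup H G" using H by (simp add: closed_subgroup_def)
  have Hc: "H \<subseteq> carrier G" by (rule subgroup.subset[OF sub])
  have one: "\<one>\<^bsub>G\<^esub> \<in> H" by (rule subgroup.one_closed[OF sub])
  obtain B :: "nat \<Rightarrow> 'a \<Rightarrow> 'a" where B: "\<And>k. B k \<in> averaging H"
    and osc: "\<And>a e. a \<in> carrier A \<Longrightarrow> 0 < e \<Longrightarrow> \<exists>K. \<forall>k\<ge>K. \<forall>g\<in>H. \<forall>z\<in>H.
        nrm (\<alpha> g (B k a) \<ominus> \<alpha> z (B k a)) \<le> e \<and> nrm (B k (\<alpha> g a) \<ominus> B k (\<alpha> z a)) \<le> e"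
    using asymptotically_invariant_means[OF H] by blast
  note lin = averaging_linear[OF Hc B]
  note Bc [simp] = linear_mapD(1)[OF lin]
  have "\<exists>l. norm_lim (\<lambda>k. B k a) l" if a: "a \<in> carrier A" for a
  proof (rule norm_Cauchy_lim[of "\<lambda>k. B k a"])
    show "B n a \<in> carrier A" for n using a by simp
    fix e :: real assume e: "0 < e"
    obtain K where K: "\<And>k g z. K \<le> k \<Longrightarrow> g \<in> H \<Longrightarrow> z \<in> H \<Longrightarrow>
        nrm (\<alpha> g (B k a) \<ominus> \<alpha> z (B k a)) \<le> e / 3 \<and> nrm (B k (\<alpha> g a) \<ominus> B k (\<alpha> z a)) \<le> e / 3"
      using osc[OF a, of "e / 3"] e by auto
    have "nrm (B j a \<ominus> B k a) < e" if j: "K \<le> j" and k: "K \<le> k" for j k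
    proof -
      have c: "B j a \<in> carrier A" "B k a \<in> carrier A" "B j (B k a) \<in> carrier A" using a by simp_all
      have "B j (B k a) \<in> {y \<in> carrier A. nrm (y \<ominus> B k a) \<le> e / 3}"
        by (rule averaging_hull[OF sub B midconvex_ball[OF c(2)] c(2)])
           (use K[OF k _ one] c Hc in \<open>simp add: act_one subsetD\<close>)
      moreover have "B k a \<in> {y \<in> carrier A. B j y \<in> {y \<in> carrier A. nrm (y \<ominus> B j a) \<le> e / 3}}"
        by (rule averaging_hull[OF sub B midconvex_vimage[OF lin midconvex_ball[OF c(1)]] a])
           (use K[OF j _ one] a Hc in \<open>simp add: act_one subsetD\<close>)
      ultimately have "nrm (B j (B k a) \<ominus> B k a) \<le> e / 3" "nrm (B j (B k a) \<ominus> B j a) \<le> e / 3" by auto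
      then show ?thesis
        using nrm_diff_triangle[OF c(1,3,2)] nrm_diff_commute[OF c(1,3)] e by linarith
    qed
    then show "\<exists>N. \<forall>m\<ge>N. \<forall>n\<ge>N. nrm (B n a \<ominus> B m a) < e" by blast
  qed blast
  then obtain E where E: "\<And>a. a \<in> carrier A \<Longrightarrow> norm_lim (\<lambda>k. B k a) (E a)" by metis
  have Ec: "E a \<in> carrier A" if "a \<in> carrier A" for a using norm_limD(2)[OF E[OF that]] .
  have "linear_map E"
    unfolding linear_map_def
  proof (intro conjI ballI allI)
    show "E a \<in> carrier A" if "a \<in> carrier A" for a by (rule Ec[OF that])
    show "E (a \<oplus> b) = E a \<oplus> E b" if ab: "a \<in> carrier A" "b \<in> carrier A" for a b
    proof (rule norm_lim_unique)
      show "norm_lim (\<lambda>k. B k (a \<oplus> b)) (E (a \<oplus> b))" by (rule E) (use ab in simp)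
      have "norm_lim (\<lambda>k. B k a \<oplus> B k b) (E a \<oplus> E b)" by (intro norm_lim_add E ab)
      then show "norm_lim (\<lambda>k. B k (a \<oplus> b)) (E a \<oplus> E b)" using ab by (simp add: linear_mapD(2)[OF lin])
    qed
    show "E (c \<odot> a) = c \<odot> E a" if a: "a \<in> carrier A" for c a
    proof (rule norm_lim_unique)
      show "norm_lim (\<lambda>k. B k (c \<odot> a)) (E (c \<odot> a))" by (rule E) (use a in simp)
      have "norm_lim (\<lambda>k. c \<odot> B k a) (c \<odot> E a)" by (intro norm_lim_smult E a)
      then show "norm_lim (\<lambda>k. B k (c \<odot> a)) (c \<odot> E a)" using a by (simp add: linear_mapD(3)[OF lin])
    qed
  qed
  moreover have "\<alpha> h (E a) = E a" if a: "a \<in> carrier A" and h: "h \<in> H" for a h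
  proof -
    have hc: "h \<in> carrier G" using h Hc by blast
    have "norm_lim (\<lambda>k. \<alpha> h (B k a)) (\<alpha> h (E a))"
      by (rule norm_limI[OF _ _ _ norm_limD(3)[OF E[OF a]]])
         (use a hc Ec[OF a] in \<open>simp_all flip: act_diff\<close>)
    from norm_lim_diff[OF this E[OF a]]
    have lim: "(\<lambda>k. nrm (\<alpha> h (B k a) \<ominus> B k a)) \<longlonglongrightarrow> nrm (\<alpha> h (E a) \<ominus> E a)" by (rule norm_lim_nrm)
    have "nrm (\<alpha> h (E a) \<ominus> E a) \<le> e" if e: "0 < e" for e
    proof -
      obtain K where K: "\<And>k g z. K \<le> k \<Longrightarrow> g \<in> H \<Longrightarrow> z \<in> H \<Longrightarrow> nrm (\<alpha> g (B k a) \<ominus> \<alpha> z (B k a)) \<le> e"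
        using osc[OF a e] by auto
      show ?thesis
        by (rule LIMSEQ_le_const2[OF lim]) (use K[OF _ h one] a in \<open>auto simp: act_one\<close>)
    qed
    then have "nrm (\<alpha> h (E a) \<ominus> E a) \<le> 0" by (rule field_le_epsilon) simp
    then show ?thesis using a hc Ec[OF a] by (simp add: diff_eq_zero_iff)
  qed
  moreover have "E a \<in> C"
    if "midconvex C" "norm_closed C" "a \<in> carrier A" "\<forall>h\<in>H. \<alpha> h a \<in> C" for C a
  proof -
    have "B k a \<in> C" for k using averaging_hull[OF sub B that(1,3)] that(4) by blast
    then show ?thesis using that(2) E[OF that(3)] unfolding norm_closed_def by blast
  qed
  ultimately show ?thesis unfolding conditional_expectation_def by blast
qed

end

section \<open>Fixed point algebras\<close>

text \<open>Applied to the norm distances of an algebra and of a subalgebra, which differ off the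
  carrier of the subalgebra.\<close>

lemma mtopology_cong:
  assumes "Metric_space M d" "Metric_space M d'" "\<And>x y. x \<in> M \<Longrightarrow> y \<in> M \<Longrightarrow> d x y = d' x y"
  shows "Metric_space.mtopology M d = Metric_space.mtopology M d'"
proof -
  interpret X: Metric_space M d by fact
  interpret Y: Metric_space M d' by fact
  have "X.mball x r = Y.mball x r" for x r
    unfolding X.mball_def Y.mball_def using assms(3) by auto
  then show ?thesis by (simp add: topology_eq X.openin_mtopology Y.openin_mtopology)
qed

locale fixed_points = compact_action A G T len \<alpha>
  for A :: "'a cstar_algebra" (structure) and G :: "('g, 'm) monoid_scheme" and T len \<alpha> +
  fixes H :: "'g set"
  assumes H: "closed_subgroup G T H"
begin

abbreviation AH :: "'a cstar_algebra" where
  "AH \<equiv> fixed_point_algebra A \<alpha> H"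

lemma H_carrier [simp]: "h \<in> H \<Longrightarrow> h \<in> carrier G"
  using H subgroup.subset by (auto simp: closed_subgroup_def)

lemma fixed_simps [simp]:
  "(\<otimes>\<^bsub>AH\<^esub>) = (\<otimes>)" "(\<oplus>\<^bsub>AH\<^esub>) = (\<oplus>)" "\<one>\<^bsub>AH\<^esub> = \<one>" "\<zero>\<^bsub>AH\<^esub> = \<zero>"
  "(\<odot>\<^bsub>AH\<^esub>) = (\<odot>)" "star AH = adj" "cnorm AH = nrm"
  by (simp_all add: fixed_point_algebra_def)

lemma carrier_fixed: "a \<in> carrier AH \<longleftrightarrow> a \<in> carrier A \<and> (\<forall>h\<in>H. \<alpha> h a = a)"
  by (simp add: fixed_point_algebra_def)

lemma fixed_carrier [simp]: "a \<in> carrier AH \<Longrightarrow> a \<in> carrier A"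
  and fixedD: "a \<in> carrier AH \<Longrightarrow> h \<in> H \<Longrightarrow> \<alpha> h a = a"
  by (simp_all add: carrier_fixed)

lemma fixed_subring: "subring (carrier AH) A"
proof (rule subringI)
  note h = star_homD[OF act_hom]
  show "\<ominus> x \<in> carrier AH" if "x \<in> carrier AH" for x
    using that by (simp add: carrier_fixed neg_smult h(5))
qed (auto simp: carrier_fixed star_homD(2-4)[OF act_hom])

lemma fixed_ring: "Ring.ring AH"
proof -
  have "A\<lparr>carrier := carrier AH\<rparr> = AH" unfolding fixed_point_algebra_def by simp
  then show ?thesis using subring_is_ring[OF fixed_subring] by (simp only:)
qed

lemma fixed_smult_closed: "a \<in> carrier AH \<Longrightarrow> c \<odot> a \<in> carrier AH"
  by (simp add: carrier_fixed star_homD(5)[OF act_hom])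

lemma fixed_adj: "a \<in> carrier AH \<Longrightarrow> adj a \<in> carrier AH"
  by (simp add: carrier_fixed star_homD(6)[OF act_hom])

lemma fixed_uminus:
  assumes "a \<in> carrier AH" shows "\<ominus>\<^bsub>AH\<^esub> a = \<ominus> a"
proof -
  interpret R: Ring.ring AH by (rule fixed_ring)
  have "\<ominus> a \<in> carrier AH" using fixed_smult_closed[OF assms, of "-1"] assms by (simp add: neg_smult)
  then show ?thesis using R.minus_equality[of "\<ominus> a" a] assms by (simp add: l_neg)
qed

lemma fixed_minus: "a \<in> carrier AH \<Longrightarrow> b \<in> carrier AH \<Longrightarrow> a \<ominus>\<^bsub>AH\<^esub> b = a \<ominus> b"
  by (simp add: a_minus_def fixed_uminus)

lemma fixed_norm_lim: "norm_lim x l \<Longrightarrow> (\<And>n. x n \<in> carrier AH) \<Longrightarrow> l \<in> carrier AH"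
proof -
  assume l: "norm_lim x l" and x: "\<And>n. x n \<in> carrier AH"
  have lc: "l \<in> carrier A" by (rule norm_limD(2)[OF l])
  have "\<alpha> h l = l" if h: "h \<in> H" for h
  proof (rule norm_lim_unique)
    have "norm_lim (\<lambda>k. \<alpha> h (x k)) (\<alpha> h l)"
      by (rule norm_limI[OF _ _ _ norm_limD(3)[OF l]])
         (use x h lc in \<open>simp_all flip: act_diff\<close>)
    then show "norm_lim x (\<alpha> h l)" using fixedD[OF x h] by simp
  qed (rule l)
  then show ?thesis using lc by (simp add: carrier_fixed)
qed

lemma fixed_metric: "Metric_space (carrier AH) (cdist AH)"
  by unfold_locales
     (auto simp: cdist_def fixed_minus nrm_diff_commute nrm_diff_eq0 nrm_diff_triangle)

lemma fixed_mcomplete: "Metric_space.mcomplete (carrier AH) (cdist AH)"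
proof -
  interpret X: Metric_space "carrier AH" "cdist AH" by (rule fixed_metric)
  show ?thesis
    unfolding X.mcomplete_def
  proof (intro allI impI)
    fix x assume x: "X.MCauchy x"
    then have xc: "x n \<in> carrier AH" for n by (auto simp: X.MCauchy_def)
    obtain l where l: "norm_lim x l"
    proof (rule norm_Cauchy_lim)
      fix e :: real assume "0 < e"
      then obtain N where "\<And>n n'. N \<le> n \<Longrightarrow> N \<le> n' \<Longrightarrow> cdist AH (x n) (x n') < e"
        using x unfolding X.MCauchy_def by blast
      then show "\<exists>N. \<forall>m\<ge>N. \<forall>n\<ge>N. nrm (x n \<ominus> x m) < e"
        using xc by (intro exI[of _ N]) (simp add: cdist_def fixed_minus)
    qed (use xc in auto)
    have lc: "l \<in> carrier AH" by (rule fixed_norm_lim[OF l xc])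
    have "limitin X.mtopology x l sequentially"
      using norm_limD(3)[OF l] xc lc by (simp add: X.limitin_metric_dist_null cdist_def fixed_minus)
    then show "\<exists>l. limitin X.mtopology x l sequentially" by blast
  qed
qed

lemma fixed_module: "Module.module complex_field AH"
proof (rule moduleI)
  interpret R: Ring.ring AH by (rule fixed_ring)
  show "abelian_group AH" by (rule R.is_abelian_group)
  show "cring complex_field" by (rule complex_field_cring)
qed (auto simp: complex_field_def fixed_smult_closed smult_add_l smult_add_r smult_smult)

lemma fixed_cstar_algebra: "unital_cstar_algebra AH"
  unfolding unital_cstar_algebra_def
  using fixed_ring fixed_module fixed_mcomplete one_not_zero
  by (simp add: smult_mult_l smult_mult_r adj_add adj_mult adj_smult nrm_eq0 nrm_add nrm_mult
      nrm_adj_mult fixed_adj)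

sublocale AH: cstar AH
  by unfold_locales (rule fixed_cstar_algebra)

lemma norm_topology_fixed: "norm_topology AH = subtopology (norm_topology A) (carrier AH)"
proof -
  interpret S: Submetric "carrier A" "cdist A" "carrier AH"
    by unfold_locales (auto simp: carrier_fixed)
  have "Metric_space.mtopology (carrier AH) (cdist AH) = Metric_space.mtopology (carrier AH) (cdist A)"
    by (rule mtopology_cong[OF fixed_metric S.sub.Metric_space_axioms])
       (simp add: cdist_def fixed_minus)
  then show ?thesis by (simp add: norm_topology_def S.mtopology_submetric)
qed

lemma sa_fixed: "a \<in> sa AH \<longleftrightarrow> a \<in> sa A \<and> a \<in> carrier AH"
  unfolding sa_def fixed_simps by auto

definition E :: "'a \<Rightarrow> 'a" where
  "E = (SOME E. conditional_expectation H E)"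

lemma E: "conditional_expectation H E"
  unfolding E_def by (rule someI_ex[OF conditional_expectation_exists[OF H]])

lemma E_linear: "linear_map E"
  and E_hull: "midconvex C \<Longrightarrow> norm_closed C \<Longrightarrow> a \<in> carrier A \<Longrightarrow> (\<And>h. h \<in> H \<Longrightarrow> \<alpha> h a \<in> C) \<Longrightarrow> E a \<in> C"
  using E by (auto simp: conditional_expectation_def)

lemma E_fixed [simp]: "a \<in> carrier A \<Longrightarrow> E a \<in> carrier AH"
  using E by (simp add: conditional_expectation_def carrier_fixed linear_mapD(1))

lemma E_near:
  assumes "a \<in> carrier A" "c \<in> carrier A" "\<And>h. h \<in> H \<Longrightarrow> nrm (\<alpha> h a \<ominus> c) \<le> r"
  shows "nrm (E a \<ominus> c) \<le> r"
proof -
  have "E a \<in> {y \<in> carrier A. nrm (y \<ominus> c) \<le> r}"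
    by (rule E_hull[OF midconvex_ball norm_closed_ball]) (use assms in auto)
  then show ?thesis by simp
qed

lemma E_nrm: "a \<in> carrier A \<Longrightarrow> nrm (E a) \<le> nrm a"
  using E_near[of a \<zero> "nrm a"] by (simp add: minus_eq)

lemma E_ident: "a \<in> carrier AH \<Longrightarrow> E a = a"
  using E_near[of a a 0] by (simp add: fixedD minus_eq[of a a] r_neg diff_eq_zero_iff)

text \<open>Positivity in the whole algebra is a closed convex condition, hence preserved by
  averaging. By \<open>pos_near\<close> it is a condition on norms, hence inherited by the fixed point algebra,
  where the square root is then available.\<close>

lemma E_adj_mult_pos: "a \<in> carrier A \<Longrightarrow> E (adj a \<otimes> a) \<in> AH.pos"
proof -
  assume a: "a \<in> carrier A"
  let ?x = "E (adj a \<otimes> a)"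
  have "?x \<in> pos"
  proof (rule E_hull[OF midconvex_pos norm_closed_pos])
    fix h assume "h \<in> H"
    then have "\<alpha> h (adj a \<otimes> a) = adj (\<alpha> h a) \<otimes> \<alpha> h a"
      using a by (simp add: star_homD(3,6)[OF act_hom])
    then show "\<alpha> h (adj a \<otimes> a) \<in> pos" using adj_mult_pos[of "\<alpha> h a"] a \<open>h \<in> H\<close> by simp
  qed (use a in simp)
  moreover have x: "?x \<in> carrier AH" using a by simp
  ultimately show ?thesis
    using pos_nearD[of ?x "nrm ?x"] fixed_smult_closed[of \<one>] AH.one_closed
    by (intro AH.pos_near[where t = "nrm ?x"]) (simp_all add: sa_fixed fixed_minus)
qed

lemma E_state:
  assumes \<phi>: "\<phi> \<in> states AH"
  shows "restrict (\<phi> \<circ> E) (carrier A) \<in> states A"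
proof -
  have "E \<one> = \<one>" using E_ident[of \<one>] AH.one_closed by simp
  then show ?thesis
    using AH.stateD(1,2,4,5)[OF \<phi>] AH.state_pos[OF \<phi> E_adj_mult_pos] linear_mapD[OF E_linear]
    by (simp add: states_def)
qed

lemma restrict_state: "\<phi> \<in> states A \<Longrightarrow> restrict \<phi> (carrier AH) \<in> states AH"
  using AH.add.m_closed AH.smult_closed AH.adj_closed AH.m_closed AH.one_closed
  by (simp add: states_def)

lemma restrict_E_state: "\<phi> \<in> states AH \<Longrightarrow> restrict (restrict (\<phi> \<circ> E) (carrier A)) (carrier AH) = \<phi>"
  by (rule extensionalityI[where A = "carrier AH"]) (auto simp: AH.stateD(5) E_ident)

end

section \<open>Lip-norms and group actions\<close>

locale lipschitz_action = compact_action A G T len \<alpha>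
  for A :: "'a cstar_algebra" (structure) and G :: "('g, 'm) monoid_scheme" and T len \<alpha> +
  fixes F :: "real \<Rightarrow> real \<Rightarrow> real \<Rightarrow> real \<Rightarrow> real" and L :: "'a \<Rightarrow> ennreal"
  assumes qcms: "quasi_leibniz_qcms F (A, L)"
    and L_act: "g \<in> carrier G \<Longrightarrow> a \<in> sa A \<Longrightarrow> L (\<alpha> g a) \<le> L a"
begin

lemma dom_iff: "a \<in> dom_lip (A, L) \<longleftrightarrow> a \<in> sa A \<and> L a < \<infinity>"
  by (simp add: dom_lip_def)

lemma dom_add: "a \<in> dom_lip (A, L) \<Longrightarrow> b \<in> dom_lip (A, L) \<Longrightarrow> a \<oplus> b \<in> dom_lip (A, L)"
  and L_add: "a \<in> dom_lip (A, L) \<Longrightarrow> b \<in> dom_lip (A, L) \<Longrightarrow> L (a \<oplus> b) \<le> L a + L b"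
  and dom_smult: "a \<in> dom_lip (A, L) \<Longrightarrow> complex_of_real r \<odot> a \<in> dom_lip (A, L)"
  and L_smult: "a \<in> dom_lip (A, L) \<Longrightarrow> L (complex_of_real r \<odot> a) = ennreal \<bar>r\<bar> * L a"
  and dom_jordan: "a \<in> dom_lip (A, L) \<Longrightarrow> b \<in> dom_lip (A, L) \<Longrightarrow> jordan_prod A a b \<in> dom_lip (A, L)"
  and dom_lie: "a \<in> dom_lip (A, L) \<Longrightarrow> b \<in> dom_lip (A, L) \<Longrightarrow> lie_prod A a b \<in> dom_lip (A, L)"
  and dom_dense: "sa A \<subseteq> norm_topology A closure_of dom_lip (A, L)"
  and L_kernel: "{a \<in> dom_lip (A, L). L a = 0} = range (\<lambda>r::real. complex_of_real r \<odot> \<one>)"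
  and mk_finite: "\<phi> \<in> states A \<Longrightarrow> \<psi> \<in> states A \<Longrightarrow> mk_dist (A, L) \<phi> \<psi> < \<infinity>"
  and mk_metric: "Metric_space (states A) (\<lambda>\<phi> \<psi>. enn2real (mk_dist (A, L) \<phi> \<psi>))"
  and mk_topology: "Metric_space.mtopology (states A) (\<lambda>\<phi> \<psi>. enn2real (mk_dist (A, L) \<phi> \<psi>))
      = weak_star_topology A"
  and L_closed: "closedin (subtopology (norm_topology A) (sa A)) {a \<in> sa A. L a \<le> t}"
  and L_leibniz: "a \<in> dom_lip (A, L) \<Longrightarrow> b \<in> dom_lip (A, L) \<Longrightarrow>
      max (L (jordan_prod A a b)) (L (lie_prod A a b))
        \<le> ennreal (F (nrm a) (nrm b) (enn2real (L a)) (enn2real (L b)))"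
  using qcms unfolding quasi_leibniz_qcms_def prod.case by (blast, blast, blast, blast, blast, blast, blast, blast, blast, blast, blast, blast, blast)

lemma mk_le: "a \<in> sa A \<Longrightarrow> L a \<le> 1 \<Longrightarrow> ennreal (cmod (\<phi> a - \<psi> a)) \<le> mk_dist (A, L) \<phi> \<psi>"
  unfolding mk_dist_def prod.case
  by (rule SUP_upper2[where i = a]) (auto simp: dom_iff intro: le_less_trans)

sublocale mk: Metric_space "states A" "\<lambda>\<phi> \<psi>. enn2real (mk_dist (A, L) \<phi> \<psi>)"
  by (rule mk_metric)

lemma L_ball_midconvex: "midconvex {x \<in> sa A. L x \<le> t}"
  unfolding midconvex_def
proof (intro conjI ballI)
  fix x y assume x: "x \<in> {x \<in> sa A. L x \<le> t}" and y: "y \<in> {x \<in> sa A. L x \<le> t}"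
  have sa: "mid x y \<in> sa A" using x y sa_smult[of "x \<oplus> y" "1/2"] by (simp add: mid_def)
  have "L (mid x y) \<le> t"
  proof (cases "t = \<infinity>")
    case False
    then have d: "x \<in> dom_lip (A, L)" "y \<in> dom_lip (A, L)"
      using x y by (auto simp: dom_iff top.not_eq_extremum intro: le_less_trans)
    have "L (mid x y) = ennreal (1/2) * L (x \<oplus> y)"
      using L_smult[OF dom_add[OF d], of "1/2"] by (simp add: mid_def)
    also have "\<dots> \<le> ennreal (1/2) * (t + t)"
      using L_add[OF d] x y by (intro mult_left_mono) (auto intro: order_trans[OF _ add_mono])
    also have "\<dots> = (ennreal (1/2) + ennreal (1/2)) * t" by (simp only: distrib_left distrib_right)
    also have "ennreal (1/2) + ennreal (1/2) = ennreal (1/2 + 1/2)" by (rule ennreal_plus[symmetric]) simp_all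
    also have "\<dots> * t = t" by simp
    finally show ?thesis .
  qed simp
  then show "mid x y \<in> {x \<in> sa A. L x \<le> t}" using sa by simp
qed auto

text \<open>Lower semicontinuity makes Lip-balls closed in the self-adjoint part, which is itself
  closed.\<close>

lemma L_ball_closed: "norm_closed {x \<in> sa A. L x \<le> t}"
  unfolding norm_closed_def
proof (intro allI impI)
  fix x l assume l: "norm_lim x l" and x: "\<forall>n. x n \<in> {x \<in> sa A. L x \<le> t}"
  have "limitin (norm_topology A) x l sequentially"
    unfolding norm_topology_def using limitin_norm_iff[of x l] norm_limD(1)[OF l] l by blast
  moreover have "l \<in> sa A" by (rule sa_norm_lim[OF l]) (use x in blast)
  ultimately have "limitin (subtopology (norm_topology A) (sa A)) x l sequentially"
    using x by (simp add: limitin_subtopology)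
  then show "l \<in> {x \<in> sa A. L x \<le> t}"
    by (rule limitin_closedin[OF _ L_closed]) (use x in simp_all)
qed

lemma act_state:
  assumes k: "k \<in> carrier G" and \<phi>: "\<phi> \<in> states A"
  shows "restrict (\<phi> \<circ> \<alpha> k) (carrier A) \<in> states A"
  using stateD(1-4)[OF \<phi>] k star_homD[OF act_hom[OF k]] by (simp add: states_def)

lemma limitin_weak_star:
  assumes "\<And>n. \<phi> n \<in> states A" "\<psi> \<in> states A"
  shows "limitin (weak_star_topology A) \<phi> \<psi> sequentially \<longleftrightarrow>
    (\<forall>a\<in>carrier A. (\<lambda>n. \<phi> n a) \<longlonglongrightarrow> \<psi> a)"
  using assms stateD(5)
  by (auto simp: weak_star_topology_def limitin_subtopology limitin_componentwise PiE_def)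

text \<open>Otherwise there are \<open>k\<^sub>n\<close> tending to the identity and states \<open>\<phi>\<^sub>n\<close>, obtained as norming
  states of \<open>\<alpha> k\<^sub>n a\<^sub>n - a\<^sub>n\<close>, with \<open>\<phi>\<^sub>n \<circ> \<alpha> k\<^sub>n\<close> at distance at least \<open>e\<close> from \<open>\<phi>\<^sub>n\<close>. By
  compactness a subsequence of \<open>\<phi>\<^sub>n\<close> converges. By strong continuity of the action \<open>\<phi>\<^sub>n \<circ> \<alpha> k\<^sub>n\<close>
  converges weak* to the same limit along it, hence also in the Monge-Kantorovich metric, a
  contradiction.\<close>

lemma uniform_modulus:
  assumes e: "0 < e"
  shows "\<exists>d>0. \<forall>k\<in>carrier G. \<forall>a\<in>sa A. len k \<le> d \<longrightarrow> L a \<le> 1 \<longrightarrow> nrm (\<alpha> k a \<ominus> a) \<le> e"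
proof (rule ccontr)
  assume "\<not> ?thesis"
  then have no: "\<exists>k\<in>carrier G. \<exists>a\<in>sa A. len k \<le> d \<and> L a \<le> 1 \<and> e < nrm (\<alpha> k a \<ominus> a)"
    if "0 < d" for d using that by (auto simp: not_le)
  let ?d = "\<lambda>\<phi> \<psi>. enn2real (mk_dist (A, L) \<phi> \<psi>)"
  have "\<exists>k a \<phi>. k \<in> carrier G \<and> len k \<le> 1 / real (Suc n) \<and> \<phi> \<in> states A \<and>
      e \<le> ?d (restrict (\<phi> \<circ> \<alpha> k) (carrier A)) \<phi>" for n
  proof -
    obtain k a where k: "k \<in> carrier G" "len k \<le> 1 / real (Suc n)"
      and a: "a \<in> sa A" "L a \<le> 1" and big: "e < nrm (\<alpha> k a \<ominus> a)"
      using no[of "1 / real (Suc n)"] by auto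
    have x: "\<alpha> k a \<ominus> a \<in> sa A" using act_sa[OF k(1) a(1)] a(1) by simp
    obtain \<phi> where \<phi>: "\<phi> \<in> states A" "cmod (\<phi> (\<alpha> k a \<ominus> a)) = nrm (\<alpha> k a \<ominus> a)"
      by (rule norming_state[OF x])
    let ?\<psi> = "restrict (\<phi> \<circ> \<alpha> k) (carrier A)"
    have "cmod (?\<psi> a - \<phi> a) = nrm (\<alpha> k a \<ominus> a)"
      using \<phi> k a by (simp add: state_diff)
    then have "ennreal e \<le> ennreal (cmod (?\<psi> a - \<phi> a))"
      using big by (intro ennreal_leI) (simp only: less_imp_le)
    then have "ennreal e \<le> mk_dist (A, L) ?\<psi> \<phi>"
      by (rule order_trans) (rule mk_le[OF a])
    then have "e \<le> ?d ?\<psi> \<phi>"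
      using enn2real_mono[of "ennreal e" "mk_dist (A, L) ?\<psi> \<phi>"] mk_finite[OF act_state[OF k(1) \<phi>(1)] \<phi>(1)] e
      by simp
    then show ?thesis using k \<phi>(1) by blast
  qed
  then obtain k \<phi> where k: "\<And>n. k n \<in> carrier G" "\<And>n. len (k n) \<le> 1 / real (Suc n)"
    and \<phi>: "\<And>n. \<phi> n \<in> states A" and big: "\<And>n. e \<le> ?d (restrict (\<phi> n \<circ> \<alpha> (k n)) (carrier A)) (\<phi> n)"
    by metis
  define \<psi> where "\<psi> n = restrict (\<phi> n \<circ> \<alpha> (k n)) (carrier A)" for n
  have \<psi>: "\<psi> n \<in> states A" for n unfolding \<psi>_def by (rule act_state[OF k(1) \<phi>])
  have "compactin mk.mtopology (states A)"
    using compact_weak_star mk.topspace_mtopology by (simp add: mk_topology compact_space_def)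
  then obtain \<omega> s where \<omega>: "\<omega> \<in> states A" and s: "strict_mono (s :: nat \<Rightarrow> nat)"
    and lim: "limitin mk.mtopology (\<phi> \<circ> s) \<omega> sequentially"
    using \<phi> unfolding mk.compactin_sequentially by (metis image_subsetI)
  have "(\<lambda>n. \<psi> (s n) a) \<longlonglongrightarrow> \<omega> a" if a: "a \<in> carrier A" for a
  proof -
    have "(\<lambda>n. \<phi> (s n) a) \<longlonglongrightarrow> \<omega> a"
      using lim a \<phi> \<omega> limitin_weak_star[of "\<phi> \<circ> s" \<omega>] by (simp add: mk_topology o_def)
    moreover have "(\<lambda>n. \<psi> (s n) a - \<phi> (s n) a) \<longlonglongrightarrow> 0"
    proof (rule LIMSEQ_I)
      fix r :: real assume r: "0 < r"
      obtain d where d: "0 < d" "\<And>k. k \<in> carrier G \<Longrightarrow> len k \<le> d \<Longrightarrow> nrm (\<alpha> k a \<ominus> a) \<le> r / 4"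
        using act_modulus[OF a, of "r / 4"] r by auto
      obtain N where N: "1 / d < real N" using reals_Archimedean2 by blast
      show "\<exists>N. \<forall>n\<ge>N. norm (\<psi> (s n) a - \<phi> (s n) a - 0) < r"
      proof (intro exI[of _ N] allI impI)
        fix n assume n: "N \<le> n"
        have "real N \<le> real (Suc (s n))" using n strict_mono_imp_increasing[OF s, of n] by simp
        then have "1 / d < real (Suc (s n))" using N by linarith
        then have "1 / real (Suc (s n)) \<le> d" using d(1) by (simp add: field_simps)
        then have "nrm (\<alpha> (k (s n)) a \<ominus> a) \<le> r / 4" using d(2)[OF k(1)] k(2)[of "s n"] by simp
        moreover have "\<psi> (s n) a - \<phi> (s n) a = \<phi> (s n) (\<alpha> (k (s n)) a \<ominus> a)"
          using a k(1) by (simp add: \<psi>_def state_diff[OF \<phi>])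
        ultimately show "norm (\<psi> (s n) a - \<phi> (s n) a - 0) < r"
          using state_bound[OF \<phi>, of "\<alpha> (k (s n)) a \<ominus> a" "s n"] a k(1) r by simp
      qed
    qed
    ultimately show ?thesis using tendsto_add by fastforce
  qed
  then have "limitin mk.mtopology (\<psi> \<circ> s) \<omega> sequentially"
    using limitin_weak_star[of "\<psi> \<circ> s" \<omega>] \<psi> \<omega> by (simp add: mk_topology o_def)
  then have "(\<lambda>n. ?d (\<psi> (s n)) \<omega>) \<longlonglongrightarrow> 0" by (simp add: mk.limitin_metric_dist_null o_def)
  moreover have "(\<lambda>n. ?d (\<phi> (s n)) \<omega>) \<longlonglongrightarrow> 0" using lim by (simp add: mk.limitin_metric_dist_null o_def)
  ultimately have "(\<lambda>n. ?d (\<psi> (s n)) \<omega> + ?d (\<phi> (s n)) \<omega>) \<longlonglongrightarrow> 0" using tendsto_add by fastforce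
  then obtain n where "?d (\<psi> (s n)) \<omega> + ?d (\<phi> (s n)) \<omega> < e"
    using order_tendstoD(2)[of _ 0 sequentially e] e by (auto simp: eventually_sequentially)
  moreover have "?d (\<psi> (s n)) (\<phi> (s n)) \<le> ?d (\<psi> (s n)) \<omega> + ?d (\<phi> (s n)) \<omega>"
    using mk.triangle[OF \<psi> \<omega> \<phi>] mk.commute by metis
  ultimately show False using big[of "s n"] by (simp add: \<psi>_def)
qed

end

section \<open>Lip-norms on fixed point algebras\<close>

locale lipschitz_fixed_points = lipschitz_action A G T len \<alpha> F L + fixed_points A G T len \<alpha> H
  for A :: "'a cstar_algebra" (structure) and G :: "('g, 'm) monoid_scheme" and T len \<alpha> F L H
begin

lemma E_sa: "a \<in> sa A \<Longrightarrow> E a \<in> sa AH"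
  and L_E: "a \<in> sa A \<Longrightarrow> L (E a) \<le> L a"
proof -
  assume a: "a \<in> sa A"
  have "E a \<in> {x \<in> sa A. L x \<le> L a}"
    by (rule E_hull[OF L_ball_midconvex L_ball_closed]) (use a L_act act_sa in auto)
  then show "E a \<in> sa AH" "L (E a) \<le> L a" using a by (auto simp: sa_fixed)
qed

lemma dom_fixed: "a \<in> dom_lip (AH, L) \<longleftrightarrow> a \<in> dom_lip (A, L) \<and> a \<in> carrier AH"
  by (auto simp: dom_lip_def sa_fixed)

lemma jordan_fixed: "jordan_prod AH a b = jordan_prod A a b"
  by (simp add: jordan_prod_def)

lemma lie_fixed: "a \<in> carrier AH \<Longrightarrow> b \<in> carrier AH \<Longrightarrow> lie_prod AH a b = lie_prod A a b"
  using AH.m_closed by (simp add: lie_prod_def fixed_minus)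

lemma dom_fixed_dense: "sa AH \<subseteq> norm_topology AH closure_of dom_lip (AH, L)"
proof
  fix a assume a: "a \<in> sa AH"
  then have aA: "a \<in> sa A" and aH: "a \<in> carrier AH" by (auto simp: sa_fixed)
  show "a \<in> norm_topology AH closure_of dom_lip (AH, L)"
    unfolding norm_topology_def AH.metric.metric_closure_of
  proof (intro CollectI conjI allI impI aH)
    fix r :: real assume "0 < r"
    then obtain b where b: "b \<in> dom_lip (A, L)" "b \<in> metric.mball a r"
      using dom_dense aA unfolding norm_topology_def metric.metric_closure_of by blast
    have bs: "b \<in> sa A" using b(1) by (simp add: dom_iff)
    have "E b \<in> dom_lip (AH, L)"
      using b(1) E_sa[OF bs] L_E[OF bs] by (auto simp: dom_lip_def)
    moreover have "E b \<in> AH.metric.mball a r"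
    proof -
      have "a \<ominus> E b = E (a \<ominus> b)"
        using aH bs by (simp add: linear_map_diff[OF E_linear] E_ident)
      then have "nrm (a \<ominus> E b) \<le> nrm (a \<ominus> b)" using E_nrm[of "a \<ominus> b"] aA bs by simp
      moreover have "nrm (a \<ominus> b) < r" using b(2) aA bs by (auto simp: cdist_def)
      ultimately show ?thesis using aH bs by (simp add: cdist_def fixed_minus)
    qed
    ultimately show "\<exists>y\<in>dom_lip (AH, L). y \<in> AH.metric.mball a r" by blast
  qed
qed

definition extension :: "('a \<Rightarrow> complex) \<Rightarrow> 'a \<Rightarrow> complex" where
  "extension \<phi> = restrict (\<phi> \<circ> E) (carrier A)"

definition restriction :: "('a \<Rightarrow> complex) \<Rightarrow> 'a \<Rightarrow> complex" where
  "restriction \<phi> = restrict \<phi> (carrier AH)"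

lemma extend_state: "\<phi> \<in> states AH \<Longrightarrow> extension \<phi> \<in> states A"
  unfolding extension_def by (rule E_state)

lemma cut_state: "\<phi> \<in> states A \<Longrightarrow> restriction \<phi> \<in> states AH"
  unfolding restriction_def by (rule restrict_state)

lemma cut_extend: "\<phi> \<in> states AH \<Longrightarrow> restriction (extension \<phi>) = \<phi>"
  unfolding restriction_def extension_def by (rule restrict_E_state)

lemma mk_cut: "mk_dist (AH, L) (restriction \<phi>) (restriction \<psi>) \<le> mk_dist (A, L) \<phi> \<psi>"
  unfolding mk_dist_def prod.case
  by (rule SUP_mono) (force simp: dom_fixed restriction_def)

text \<open>The Lipschitz elements of the fixed point algebra are both among those of the whole
  algebra and, by \<open>L_E\<close>, the averages of those; so the two suprema agree.\<close>

lemma mk_extend: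
  assumes "\<phi> \<in> states AH" "\<psi> \<in> states AH"
  shows "mk_dist (A, L) (extension \<phi>) (extension \<psi>) = mk_dist (AH, L) \<phi> \<psi>"
proof (rule antisym)
  show "mk_dist (AH, L) \<phi> \<psi> \<le> mk_dist (A, L) (extension \<phi>) (extension \<psi>)"
    using mk_cut[of "extension \<phi>" "extension \<psi>"] assms by (simp add: cut_extend)
  show "mk_dist (A, L) (extension \<phi>) (extension \<psi>) \<le> mk_dist (AH, L) \<phi> \<psi>"
    unfolding mk_dist_def prod.case
  proof (rule SUP_mono)
    fix a assume a: "a \<in> {a \<in> dom_lip (A, L). L a \<le> 1}"
    then have sa: "a \<in> sa A" by (simp add: dom_iff)
    have "E a \<in> dom_lip (AH, L)" "L (E a) \<le> 1"
      using a E_sa[OF sa] L_E[OF sa] by (auto simp: dom_lip_def)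
    then show "\<exists>b\<in>{a \<in> dom_lip (AH, L). L a \<le> 1}.
        ennreal (cmod (extension \<phi> a - extension \<psi> a)) \<le> ennreal (cmod (\<phi> b - \<psi> b))"
      using sa by (intro bexI[of _ "E a"]) (simp_all add: extension_def)
  qed
qed

lemma mk_fixed_metric: "Metric_space (states AH) (\<lambda>\<phi> \<psi>. enn2real (mk_dist (AH, L) \<phi> \<psi>))"
proof
  fix \<phi> \<psi> \<omega> :: "'a \<Rightarrow> complex"
  show "0 \<le> enn2real (mk_dist (AH, L) \<phi> \<psi>)" by simp
  show "enn2real (mk_dist (AH, L) \<phi> \<psi>) = enn2real (mk_dist (AH, L) \<psi> \<phi>)"
    by (simp add: mk_dist_def norm_minus_commute)
  assume \<phi>: "\<phi> \<in> states AH" and \<psi>: "\<psi> \<in> states AH"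
  show "enn2real (mk_dist (AH, L) \<phi> \<psi>) = 0 \<longleftrightarrow> \<phi> = \<psi>"
  proof -
    have "enn2real (mk_dist (AH, L) \<phi> \<psi>) = 0 \<longleftrightarrow> extension \<phi> = extension \<psi>"
      using mk.zero[OF extend_state[OF \<phi>] extend_state[OF \<psi>]] by (simp only: mk_extend[OF \<phi> \<psi>])
    also have "\<dots> \<longleftrightarrow> \<phi> = \<psi>"
    proof
      assume "extension \<phi> = extension \<psi>"
      then have "restriction (extension \<phi>) = restriction (extension \<psi>)" by (simp only:)
      then show "\<phi> = \<psi>" by (simp only: cut_extend[OF \<phi>] cut_extend[OF \<psi>])
    qed (simp only:)
    finally show ?thesis .
  qed
  assume \<omega>: "\<omega> \<in> states AH"
  show "enn2real (mk_dist (AH, L) \<phi> \<omega>) \<le> enn2real (mk_dist (AH, L) \<phi> \<psi>) + enn2real (mk_dist (AH, L) \<psi> \<omega>)"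
    using mk.triangle[OF extend_state[OF \<phi>] extend_state[OF \<psi>] extend_state[OF \<omega>]]
    by (simp add: mk_extend \<phi> \<psi> \<omega>)
qed

text \<open>Both topologies make extension of states continuous into the state space of the whole
  algebra, and restriction continuous out of it, where metric and weak* topology agree. Since
  restriction after extension is the identity, the identity is continuous in both directions.\<close>

lemma mk_fixed_topology:
  "Metric_space.mtopology (states AH) (\<lambda>\<phi> \<psi>. enn2real (mk_dist (AH, L) \<phi> \<psi>)) = weak_star_topology AH"
proof -
  interpret X: Metric_space "states AH" "\<lambda>\<phi> \<psi>. enn2real (mk_dist (AH, L) \<phi> \<psi>)"
    by (rule mk_fixed_metric)
  let ?W = "weak_star_topology A" and ?WH = "weak_star_topology AH"
  have top: "topspace ?W = states A" "topspace ?WH = states AH"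
    using stateD(5) AH.stateD(5) by (auto simp: weak_star_topology_def PiE_def)
  have ext_m: "continuous_map X.mtopology mk.mtopology extension"
    unfolding mk.continuous_map_to_metric
  proof (intro ballI allI impI)
    fix \<phi> and r :: real assume "\<phi> \<in> topspace X.mtopology" "0 < r"
    then show "\<exists>U. openin X.mtopology U \<and> \<phi> \<in> U \<and> (\<forall>\<psi>\<in>U. extension \<psi> \<in> mk.mball (extension \<phi>) r)"
      by (intro exI[of _ "X.mball \<phi> r"]) (auto simp: extend_state mk_extend)
  qed
  have cut_m: "continuous_map mk.mtopology X.mtopology restriction"
    unfolding X.continuous_map_to_metric
  proof (intro ballI allI impI)
    fix \<phi> and r :: real assume \<phi>: "\<phi> \<in> topspace mk.mtopology" and r: "0 < r"
    have "enn2real (mk_dist (AH, L) (restriction \<phi>) (restriction \<psi>)) \<le> enn2real (mk_dist (A, L) \<phi> \<psi>)"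
      if "\<psi> \<in> states A" for \<psi>
      using mk_finite[of \<phi> \<psi>] that \<phi> by (intro enn2real_mono mk_cut) (simp add: less_top)
    then show "\<exists>U. openin mk.mtopology U \<and> \<phi> \<in> U \<and> (\<forall>\<psi>\<in>U. restriction \<psi> \<in> X.mball (restriction \<phi>) r)"
      using \<phi> r by (intro exI[of _ "mk.mball \<phi> r"]) (force simp: cut_state intro: le_less_trans)
  qed
  have ext_w: "continuous_map ?WH ?W extension"
    unfolding weak_star_topology_def[of A] continuous_map_in_subtopology continuous_map_componentwise
  proof (intro conjI ballI)
    show "extension ` topspace ?WH \<subseteq> extensional (carrier A)" by (auto simp: extension_def)
    show "extension \<in> topspace ?WH \<rightarrow> states A" using extend_state top by auto
    fix a assume a: "a \<in> carrier A"
    have "continuous_map ?WH euclidean (\<lambda>\<phi>. \<phi> (E a))"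
      unfolding weak_star_topology_def
      using a by (intro continuous_map_from_subtopology
          continuous_map_product_projection[where X = "\<lambda>_. euclidean", simplified]) simp
    then show "continuous_map ?WH euclidean (\<lambda>\<phi>. extension \<phi> a)" using a by (simp add: extension_def)
  qed
  have cut_w: "continuous_map ?W ?WH restriction"
    unfolding weak_star_topology_def[of AH] continuous_map_in_subtopology continuous_map_componentwise
  proof (intro conjI ballI)
    show "restriction ` topspace ?W \<subseteq> extensional (carrier AH)" by (auto simp: restriction_def)
    show "restriction \<in> topspace ?W \<rightarrow> states AH" using cut_state top by auto
    fix a assume a: "a \<in> carrier AH"
    have "continuous_map ?W euclidean (\<lambda>\<phi>. \<phi> a)"
      unfolding weak_star_topology_def
      using a by (intro continuous_map_from_subtopology
          continuous_map_product_projection[where X = "\<lambda>_. euclidean", simplified]) simp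
    then show "continuous_map ?W euclidean (\<lambda>\<phi>. restriction \<phi> a)" using a by (simp add: restriction_def)
  qed
  have "continuous_map X.mtopology ?WH (restriction \<circ> extension)"
    by (rule continuous_map_compose[OF ext_m]) (use cut_w in \<open>simp add: mk_topology\<close>)
  then have 1: "continuous_map X.mtopology ?WH id"
    by (rule continuous_map_eq) (simp add: cut_extend)
  have "continuous_map ?WH X.mtopology (restriction \<circ> extension)"
    by (rule continuous_map_compose[OF ext_w]) (use cut_m in \<open>simp add: mk_topology\<close>)
  then have 2: "continuous_map ?WH X.mtopology id"
    by (rule continuous_map_eq) (simp add: cut_extend top)
  show ?thesis
    using topology_finer_continuous_id[of X.mtopology ?WH] topology_finer_continuous_id[of ?WH X.mtopology] 1 2 top
    by (auto simp: topology_eq)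
qed

lemma fixed_qcms: "quasi_leibniz_qcms F (AH, L)"
  unfolding quasi_leibniz_qcms_def prod.case
proof (intro conjI ballI allI)
  fix a b assume a: "a \<in> dom_lip (AH, L)" and b: "b \<in> dom_lip (AH, L)"
  then have ab: "a \<in> dom_lip (A, L)" "b \<in> dom_lip (A, L)" "a \<in> carrier AH" "b \<in> carrier AH"
    by (auto simp: dom_fixed)
  show "a \<oplus>\<^bsub>AH\<^esub> b \<in> dom_lip (AH, L)" using ab AH.a_closed[of a b] by (simp add: dom_fixed dom_add)
  show "L (a \<oplus>\<^bsub>AH\<^esub> b) \<le> L a + L b" using ab by (simp add: L_add)
  have "jordan_prod AH a b \<in> carrier AH" "lie_prod AH a b \<in> carrier AH"
    using ab by (simp_all only: jordan_prod_def lie_prod_def AH.smult_closed AH.a_closed AH.m_closed AH.minus_closed)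
  then show "jordan_prod AH a b \<in> dom_lip (AH, L)" "lie_prod AH a b \<in> dom_lip (AH, L)"
    using ab by (simp_all add: dom_fixed jordan_fixed lie_fixed dom_jordan dom_lie)
  show "max (L (jordan_prod AH a b)) (L (lie_prod AH a b))
      \<le> ennreal (F (cnorm AH a) (cnorm AH b) (enn2real (L a)) (enn2real (L b)))"
    using L_leibniz[OF ab(1,2)] ab by (simp add: jordan_fixed lie_fixed)
next
  fix r :: real and a assume a: "a \<in> dom_lip (AH, L)"
  show "complex_of_real r \<odot>\<^bsub>AH\<^esub> a \<in> dom_lip (AH, L)" "L (complex_of_real r \<odot>\<^bsub>AH\<^esub> a) = ennreal \<bar>r\<bar> * L a"
    using a by (simp_all add: dom_fixed dom_smult L_smult fixed_smult_closed)
next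
  have "{a \<in> dom_lip (AH, L). L a = 0} = {a \<in> dom_lip (A, L). L a = 0} \<inter> carrier AH"
    by (auto simp: dom_fixed)
  also have "\<dots> = range (\<lambda>r::real. complex_of_real r \<odot> \<one>)"
    unfolding L_kernel using fixed_smult_closed[of \<one>] AH.one_closed by auto
  finally show "{a \<in> dom_lip (AH, L). L a = 0} = range (\<lambda>r::real. complex_of_real r \<odot>\<^bsub>AH\<^esub> \<one>\<^bsub>AH\<^esub>)"
    by simp
next
  fix \<phi> \<psi> assume "\<phi> \<in> states AH" "\<psi> \<in> states AH"
  then show "mk_dist (AH, L) \<phi> \<psi> < \<infinity>"
    using mk_finite[OF extend_state extend_state] by (simp add: mk_extend)
next
  fix t
  have "{a \<in> sa AH. L a \<le> t} = sa AH \<inter> {a \<in> sa A. L a \<le> t}" by (auto simp: sa_fixed)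
  moreover have "sa AH \<inter> carrier AH = sa AH" "sa A \<inter> sa AH = sa AH" by (auto simp: sa_fixed)
  moreover have "closedin (subtopology (subtopology (norm_topology A) (sa A)) (sa AH))
      (sa AH \<inter> {a \<in> sa A. L a \<le> t})"
    using L_closed[of t] by (rule closedin_subtopology_Int_closed)
  ultimately show "closedin (subtopology (norm_topology AH) (sa AH)) {a \<in> sa AH. L a \<le> t}"
    by (simp add: norm_topology_fixed subtopology_subtopology Int_commute)
qed (rule fixed_cstar_algebra dom_fixed_dense mk_fixed_metric mk_fixed_topology)+

text \<open>The orbit of \<open>a\<close> under \<open>H\<close> stays within \<open>e\<close> of \<open>a\<close>: an element \<open>h\<close> of \<open>H\<close> moves \<open>a\<close> as
  much as \<open>inv g \<otimes> h\<close> does, where \<open>g\<close> is a nearby element of \<open>K\<close>, which fixes \<open>a\<close>.\<close>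

lemma E_approx:
  assumes a: "a \<in> sa A" "L a \<le> 1" "\<And>g. g \<in> K \<Longrightarrow> \<alpha> g a = a" and K: "K \<subseteq> carrier G"
    and modulus: "\<And>k a. k \<in> carrier G \<Longrightarrow> len k \<le> d \<Longrightarrow> a \<in> sa A \<Longrightarrow> L a \<le> 1 \<Longrightarrow> nrm (\<alpha> k a \<ominus> a) \<le> e"
    and near: "\<And>h. h \<in> H \<Longrightarrow> \<exists>g\<in>K. len (inv\<^bsub>G\<^esub> g \<otimes>\<^bsub>G\<^esub> h) \<le> d"
  shows "E a \<in> sa AH" "L (E a) \<le> 1" "nrm (E a \<ominus> a) \<le> e"
proof -
  show "E a \<in> sa AH" "L (E a) \<le> 1" using E_sa[OF a(1)] L_E[OF a(1)] a(2) by auto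
  show "nrm (E a \<ominus> a) \<le> e"
  proof (rule E_near)
    fix h assume h: "h \<in> H"
    obtain g where g: "g \<in> K" "len (inv\<^bsub>G\<^esub> g \<otimes>\<^bsub>G\<^esub> h) \<le> d" using near[OF h] by blast
    have gc: "g \<in> carrier G" using g(1) K by blast
    have "nrm (\<alpha> h a \<ominus> \<alpha> g a) = nrm (\<alpha> (inv\<^bsub>G\<^esub> g \<otimes>\<^bsub>G\<^esub> h) a \<ominus> a)"
      using nrm_act_diff[of g h a] nrm_diff_commute[of "\<alpha> g a" "\<alpha> h a"] gc h a(1) by simp
    also have "\<dots> \<le> e" using modulus[of "inv\<^bsub>G\<^esub> g \<otimes>\<^bsub>G\<^esub> h" a] g gc h a by simp
    finally show "nrm (\<alpha> h a \<ominus> a) \<le> e" using a(3)[OF g(1)] by simp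
  qed (use a in simp_all)
qed

end

section \<open>Bridges between fixed point algebras\<close>

lemma hausdorff_distance_refl:
  "(\<And>x. x \<in> X \<Longrightarrow> d x x = 0) \<Longrightarrow> hausdorff_distance d X X = 0"
proof -
  assume d: "\<And>x. x \<in> X \<Longrightarrow> d x x = 0"
  have "(SUP x\<in>X. INF y\<in>X. d x y) \<le> 0" "(SUP y\<in>X. INF x\<in>X. d x y) \<le> 0"
    by (intro SUP_least INF_lower2; use d in force)+
  then show ?thesis by (simp add: hausdorff_distance_def)
qed

text \<open>The bridge is the whole algebra with the two inclusions and pivot \<open>1\<close>. All states are
  states of the pivot, and restricting them gives all states of either fixed point algebra.\<close>

lemma (in lipschitz_action) propinquity_fixed_le:
  assumes H: "closed_subgroup G T H" and K: "closed_subgroup G T K" and e: "0 \<le> e"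
    and modulus: "\<And>k a. k \<in> carrier G \<Longrightarrow> len k \<le> d \<Longrightarrow> a \<in> sa A \<Longrightarrow> L a \<le> 1 \<Longrightarrow> nrm (\<alpha> k a \<ominus> a) \<le> e"
    and HK: "\<And>g. g \<in> H \<Longrightarrow> \<exists>h\<in>K. len (inv\<^bsub>G\<^esub> g \<otimes>\<^bsub>G\<^esub> h) \<le> d"
    and KH: "\<And>h. h \<in> K \<Longrightarrow> \<exists>g\<in>H. len (inv\<^bsub>G\<^esub> g \<otimes>\<^bsub>G\<^esub> h) \<le> d"
  shows "quantum_propinquity F (fixed_point_algebra A \<alpha> H, L) (fixed_point_algebra A \<alpha> K, L) \<le> ennreal e"
proof -
  interpret X: lipschitz_fixed_points A G T len \<alpha> F L H by unfold_locales (rule H)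
  interpret Y: lipschitz_fixed_points A G T len \<alpha> F L K by unfold_locales (rule K)
  define \<gamma> :: "('a, 'a, 'a) bridge" where
    "\<gamma> = \<lparr>bridge_algebra = A, bridge_left = (\<lambda>x. x), bridge_right = (\<lambda>x. x), pivot = \<one>\<rparr>"
  have \<gamma>: "bridge_algebra \<gamma> = A" "bridge_left \<gamma> = (\<lambda>x. x)" "bridge_right \<gamma> = (\<lambda>x. x)" "pivot \<gamma> = \<one>"
    by (simp_all add: \<gamma>_def)
  have P: "pivot_states A \<one> = states A" by (auto simp: pivot_states_def)
  have "states A \<noteq> {}" using norming_state[OF sa_one] by blast
  moreover have "(\<lambda>x. x) \<in> star_hom X.AH A" "(\<lambda>x. x) \<in> star_hom Y.AH A"
    by (auto simp: star_hom_def ring_hom_def)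
  ultimately have bridge: "is_bridge \<gamma> X.AH Y.AH"
    by (simp add: is_bridge_def \<gamma> P cstar)
  have refl: "mk_dist Z \<phi> \<phi> = 0" for Z :: "'a cstar_pair" and \<phi>
    by (cases Z) (simp add: mk_dist_def SUP_constant bot_ennreal)
  have "(\<lambda>\<phi>. restrict \<phi> (carrier X.AH)) ` states A = states X.AH"
    using X.cut_state X.cut_extend X.extend_state by (force simp: X.restriction_def[symmetric])
  moreover have "(\<lambda>\<phi>. restrict \<phi> (carrier Y.AH)) ` states A = states Y.AH"
    using Y.cut_state Y.cut_extend Y.extend_state by (force simp: Y.restriction_def[symmetric])
  ultimately have height: "bridge_height \<gamma> (X.AH, L) (Y.AH, L) = 0"
    by (simp add: bridge_height_def \<gamma> P Let_def o_def hausdorff_distance_refl refl)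
  have len_inv: "len (inv\<^bsub>G\<^esub> h \<otimes>\<^bsub>G\<^esub> g) = len (inv\<^bsub>G\<^esub> g \<otimes>\<^bsub>G\<^esub> h)" if "g \<in> carrier G" "h \<in> carrier G" for g h
  proof -
    have "inv\<^bsub>G\<^esub> h \<otimes>\<^bsub>G\<^esub> g = inv\<^bsub>G\<^esub> (inv\<^bsub>G\<^esub> g \<otimes>\<^bsub>G\<^esub> h)" using that by (simp add: G.inv_mult_group)
    then show ?thesis using length_fun that by (simp add: length_function_def)
  qed
  have near: "\<exists>h\<in>K. len (inv\<^bsub>G\<^esub> h \<otimes>\<^bsub>G\<^esub> g) \<le> d" if "g \<in> H" for g
    using HK[OF that] that len_inv by force
  have n: "nrm (a \<otimes> \<one> \<ominus> \<one> \<otimes> b) = nrm (a \<ominus> b)" if "a \<in> sa A" "b \<in> sa A" for a b using that by simp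
  have "bridge_reach \<gamma> (X.AH, L) (Y.AH, L) \<le> ennreal e"
    unfolding bridge_reach_def prod.case Let_def \<gamma>
  proof (intro max.boundedI SUP_least)
    fix a assume "a \<in> {a \<in> sa X.AH. L a \<le> 1}"
    then have a: "a \<in> sa A" "L a \<le> 1" "\<And>g. g \<in> H \<Longrightarrow> \<alpha> g a = a" by (auto simp: X.sa_fixed X.fixedD)
    have b: "Y.E a \<in> sa Y.AH" "L (Y.E a) \<le> 1" "nrm (Y.E a \<ominus> a) \<le> e"
      using Y.E_approx[OF a _ modulus KH] X.H_carrier by blast+
    have "nrm (a \<otimes> \<one> \<ominus> \<one> \<otimes> Y.E a) \<le> e"
      using b a nrm_diff_commute[of a "Y.E a"] by (simp add: Y.sa_fixed)
    then show "(INF b\<in>{b \<in> sa Y.AH. L b \<le> 1}. ennreal (nrm (a \<otimes> \<one> \<ominus> \<one> \<otimes> b))) \<le> ennreal e"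
      using b by (intro INF_lower2[of "Y.E a"]) (auto intro: ennreal_leI)
  next
    fix b assume "b \<in> {b \<in> sa Y.AH. L b \<le> 1}"
    then have b: "b \<in> sa A" "L b \<le> 1" "\<And>g. g \<in> K \<Longrightarrow> \<alpha> g b = b" by (auto simp: Y.sa_fixed Y.fixedD)
    have a: "X.E b \<in> sa X.AH" "L (X.E b) \<le> 1" "nrm (X.E b \<ominus> b) \<le> e"
      using X.E_approx[OF b _ modulus near] Y.H_carrier by blast+
    have "nrm (X.E b \<otimes> \<one> \<ominus> \<one> \<otimes> b) \<le> e"
      using a b by (simp add: X.sa_fixed)
    then show "(INF a\<in>{a \<in> sa X.AH. L a \<le> 1}. ennreal (nrm (a \<otimes> \<one> \<ominus> \<one> \<otimes> b))) \<le> ennreal e"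
      using a by (intro INF_lower2[of "X.E b"]) (auto intro: ennreal_leI)
  qed
  then have "bridge_length \<gamma> (X.AH, L) (Y.AH, L) \<le> ennreal e"
    by (simp add: bridge_length_def height)
  moreover have "quantum_propinquity F (X.AH, L) (Y.AH, L) \<le> bridge_length \<gamma> (X.AH, L) (Y.AH, L)"
    by (rule quantum_propinquity_le_bridge_length) (simp_all add: X.fixed_qcms Y.fixed_qcms bridge)
  ultimately show ?thesis by (rule order_trans[rotated])
qed

theorem theorem3p1:
  fixes F :: "real \<Rightarrow> real \<Rightarrow> real \<Rightarrow> real \<Rightarrow> real"
    and A :: "'a cstar_algebra" and L :: "'a \<Rightarrow> ennreal"
    and G :: "('g, 'm) monoid_scheme" and T :: "'g topology" and len :: "'g \<Rightarrow> real"
    and \<alpha> :: "'g \<Rightarrow> 'a \<Rightarrow> 'a"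
    and Gs :: "nat \<Rightarrow> 'g set" and G_inf :: "'g set"
  assumes "admissible F"
    and "quasi_leibniz_qcms F (A, L)"
    and "compact_metrizable_group G T"
    and "length_function G len" and "continuous_map T euclideanreal len"
    and "strongly_continuous_action G T A \<alpha>"
    and "\<forall>g\<in>carrier G. \<forall>a\<in>sa A. L (\<alpha> g a) \<le> L a"
    and "\<forall>n. closed_subgroup G T (Gs n)" and "closed_subgroup G T G_inf"
    and "(\<lambda>n. haus_length G len (Gs n) G_inf) \<longlonglongrightarrow> 0"
  shows "(\<forall>n. quasi_leibniz_qcms F (fixed_point_algebra A \<alpha> (Gs n), L)) \<and>
         quasi_leibniz_qcms F (fixed_point_algebra A \<alpha> G_inf, L) \<and>
         (\<lambda>n. quantum_propinquity F (fixed_point_algebra A \<alpha> (Gs n), L)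
                                    (fixed_point_algebra A \<alpha> G_inf, L)) \<longlonglongrightarrow> 0"
proof -
  have cstar: "unital_cstar_algebra A" using assms(2) by (simp add: quasi_leibniz_qcms_def)
  interpret lipschitz_action A G T len \<alpha> F L
    by unfold_locales (use cstar assms in auto)
  have fixed: "quasi_leibniz_qcms F (fixed_point_algebra A \<alpha> H, L)" if "closed_subgroup G T H" for H
  proof -
    interpret lipschitz_fixed_points A G T len \<alpha> F L H by unfold_locales (rule that)
    show ?thesis by (rule fixed_qcms)
  qed
  have "(\<lambda>n. quantum_propinquity F (fixed_point_algebra A \<alpha> (Gs n), L)
      (fixed_point_algebra A \<alpha> G_inf, L)) \<longlonglongrightarrow> 0"
  proof (rule order_tendstoI)
    fix c :: ennreal assume "0 < c"
    then obtain x where x: "0 < x" "x < c" using dense by blast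
    then obtain e where e: "0 < e" "ennreal e < c" by (cases x) (auto simp: less_top)
    obtain d where d: "0 < d"
      "\<And>k a. k \<in> carrier G \<Longrightarrow> len k \<le> d \<Longrightarrow> a \<in> sa A \<Longrightarrow> L a \<le> 1 \<Longrightarrow> cnorm A (\<alpha> k a \<ominus>\<^bsub>A\<^esub> a) \<le> e"
      using uniform_modulus[OF e(1)] by blast
    have "\<forall>\<^sub>F n in sequentially. haus_length G len (Gs n) G_inf < ennreal d"
      using order_tendstoD(2)[OF assms(10), of "ennreal d"] d(1) by simp
    then show "\<forall>\<^sub>F n in sequentially. quantum_propinquity F (fixed_point_algebra A \<alpha> (Gs n), L)
      (fixed_point_algebra A \<alpha> G_inf, L) < c"
    proof eventually_elim
      case (elim n)
      have le: "x \<le> d" if "ennreal x < ennreal d" for x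
        using that ennreal_leI[of d x] by (cases "x \<le> d") auto
      let ?D = "\<lambda>g h. ennreal (len (inv\<^bsub>G\<^esub> g \<otimes>\<^bsub>G\<^esub> h))"
      have sub: "Gs n \<subseteq> carrier G" "G_inf \<subseteq> carrier G"
        using assms(8,9) subgroup.subset by (auto simp: closed_subgroup_def)
      have "\<exists>h\<in>G_inf. len (inv\<^bsub>G\<^esub> g \<otimes>\<^bsub>G\<^esub> h) \<le> d" if g: "g \<in> Gs n" for g
      proof -
        have "(INF h\<in>G_inf. ?D g h) \<le> (SUP g\<in>Gs n. INF h\<in>G_inf. ?D g h)" using g by (rule SUP_upper)
        then have "(INF h\<in>G_inf. ?D g h) < ennreal d"
          using elim by (auto simp: haus_length_def hausdorff_distance_def intro: le_less_trans)
        then show ?thesis by (auto simp: INF_less_iff intro: le)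
      qed
      moreover have "\<exists>g\<in>Gs n. len (inv\<^bsub>G\<^esub> g \<otimes>\<^bsub>G\<^esub> h) \<le> d" if h: "h \<in> G_inf" for h
      proof -
        have "(INF g\<in>Gs n. ?D g h) \<le> (SUP h\<in>G_inf. INF g\<in>Gs n. ?D g h)" using h by (rule SUP_upper)
        then have "(INF g\<in>Gs n. ?D g h) < ennreal d"
          using elim by (auto simp: haus_length_def hausdorff_distance_def intro: le_less_trans)
        then show ?thesis by (auto simp: INF_less_iff intro: le)
      qed
      ultimately have "quantum_propinquity F (fixed_point_algebra A \<alpha> (Gs n), L)
          (fixed_point_algebra A \<alpha> G_inf, L) \<le> ennreal e"
        using assms(8,9) e(1) d(2) by (intro propinquity_fixed_le[where d = d]) auto
      then show ?case using e(2) by (rule le_less_trans)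
    qed
  qed simp
  then show ?thesis using fixed assms(8,9) by blast
qed

end
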